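(* Let $X$ be a metric surface. For any choice of a uniformization map $u\colon M\to X$, with singular-set image $X_0^u$, the family of all rectifiable curves $\gamma$ in $X$ satisfying $\mathcal H^1(|\gamma|\cap X_0^u)>0$ is exceptional.
   Context: $\mathcal H^n$ is the Hausdorff $n$-measure, normalized to agree with Lebesgue measure on open subsets of $\mathbb R^n$. A metric surface is a metric space whose Hausdorff $2$-measure is finite on compact subsets and which is homeomorphic to a connected $2$-manifold without boundary. Curves: a curve is a continuous map $\gamma\colon I\to X$ from an interval; $|\gamma|$ is its image; it is rectifiable if its length is finite. A family $\Gamma_0$ of rectifiable curves in $X$ is exceptional if there is $A\subset X$ with $\mathcal H^2(A)=0$ such that $\mathcal H^1(|\gamma|\cap A)>0$ for every $\gamma\in\Gamma_0$. Sobolev maps: a Borel function $\rho\colon M\to[0,\infty]$ is an upper gradient of $h\colon M\to X$ if $d(h(x),h(y))\le\int_\gamma\rho\,ds$ for all $x,y\in M$ and every rectifiable curve $\gamma$ joining $x$ and $y$. $N^{1,2}(M,X)$ is the space of Borel maps $h\colon M\to X$ that have an upper gradient in $L^2(M)$ and for which $z\mapsto d(x,h(z))$ is in $L^2(M)$ for some $x\in X$; $N^{1,2}_{\mathrm{loc}}(M,X)$ is the local version. Approximate metric derivatives: let $D\subset\mathbb R^2$ be the open unit disk and $h\in N^{1,2}(D,X)$. For almost every $z\in D$ there is a seminorm $\operatorname{apmd}h_z$ on $\mathbb R^2$, the approximate metric derivative, such that there are pairwise disjoint compact sets $G_j\subset D$, $j=1,2,\dots$, with: (i) $G_0:=D\setminus\bigcup_{j\ge1}G_j$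 has Lebesgue measure zero; (ii) for $j\ge1$, $h|_{G_j}$ is Lipschitz and $\operatorname{apmd}h_z$ exists for every $z\in G_j$; (iii) for $j\ge 1$ and every $\varepsilon>0$ there is $r_j(\varepsilon)>0$ such that $|d(h(z+v),h(z+w))-\operatorname{apmd}h_z(v-w)|\le\varepsilon|v-w|$ for every $z\in G_j$ and all $v,w\in\mathbb R^2$ with $|v|,|w|\le r_j(\varepsilon)$ and $z+v,z+w\in G_j$. For a Riemannian $2$-manifold $M$ and $h\in N^{1,2}_{\mathrm{loc}}(M,X)$, the same notions are used in conformal local coordinates, with pairwise disjoint compact sets $G_j\subset M$ each contained in a coordinate chart and $G_0=M\setminus\bigcup_{j\ge 1}G_j$ of measure zero. The Jacobian $J(N)$ of a seminorm $N$ on $\mathbb R^2$ is $0$ if $N$ is not a norm, and $J(N)=\pi/|\{y\in\mathbb R^2:N(y)\le1\}|_2$ otherwise, where $|\cdot|_2$ is Lebesgue measure. $L_h(z)=\max\{\operatorname{apmd}h_z(v):|v|=1\}$. Uniformization map: a map $u\in N^{1,2}_{\mathrm{loc}}(M,X)$, where $M$ is a Riemannian $2$-manifold of constant curvature homeomorphic to $X$, such that $u$ is continuous, surjective, proper (preimages of compact sets are compact), monotone (preimages of points are connected), satisfies $N(x,u,M)=1$ for $\mathcal H^2$-almost every $x\in X$, where $N(x,u,M)$ is the number of preimages of $x$ in $M$, and satisfies $L_u(z)^2\le\frac4\pi J(\operatorname{apmd}u_z)$ for almost every $z\in M$. (Such a map exists for every metric surface.) Singular-set image: given $u$, choose pairwise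 disjoint compact sets $G_j\subset M$, $j\ge1$, each contained in a conformal coordinate chart of $M$, such that $G_0:=M\setminus\bigcup_{j\ge1}G_j$ has measure zero and such that, in the chart coordinates, for every $j\ge1$ the map $u|_{G_j}$ is Lipschitz, $\operatorname{apmd}u_z$ exists for every $z\in G_j$, and for every $\varepsilon>0$ there is $r_j(\varepsilon)>0$ with $|d(u(z+v),u(z+w))-\operatorname{apmd}u_z(v-w)|\le\varepsilon|v-w|$ for every $z\in G_j$ and all $v,w\in\mathbb R^2$ with $|v|,|w|\le r_j(\varepsilon)$ and $z+v,z+w\in G_j$; then set $X_0^u:=u(G_0)$. *)

theory Defs
  imports "HOL-Analysis.Analysis"
begin

section \<open>Hausdorff measure\<close>

text \<open>
  The factor \<open>unit_ball_vol n / 2 ^ n\<close> is the normalization for which the Hausdorff \<open>n\<close>-measure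
  agrees with Lebesgue measure on Euclidean \<open>n\<close>-space. Boundedness of the covering sets is demanded
  separately because \<^const>\<open>diameter\<close> is a junk value on unbounded sets; empty covering
  sets count \<open>0\<close> (which matters only for \<open>n = 0\<close>).
\<close>

definition hausdorff_delta :: "nat \<Rightarrow> real \<Rightarrow> 'a::metric_space set \<Rightarrow> ennreal" where
  "hausdorff_delta n \<delta> A =
     (INF C \<in> {C :: nat \<Rightarrow> 'a set. A \<subseteq> (\<Union>i. C i) \<and> (\<forall>i. bounded (C i) \<and> diameter (C i) \<le> \<delta>)}.
        \<Sum>i. if C i = {} then 0 else ennreal (unit_ball_vol (real n) * (diameter (C i) / 2) ^ n))"

definition hausdorff :: "nat \<Rightarrow> 'a::metric_space set \<Rightarrow> ennreal" where
  "hausdorff n A = (SUP \<delta> \<in> {0<..}. hausdorff_delta n \<delta> A)"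

text \<open>
  \<^const>\<open>hausdorff\<close> is the outer measure, defined on all sets; \<open>hausdorff_measure\<close> is its restriction
  to the Borel sets as an object of type \<^typ>\<open>'a measure\<close>, needed for integration.
\<close>

definition hausdorff_measure :: "nat \<Rightarrow> 'a::metric_space measure" where
  "hausdorff_measure n = measure_of UNIV (sets borel) (hausdorff n)"

section \<open>Metric surfaces\<close>

definition two_manifold :: "'a topology \<Rightarrow> bool" where
  "two_manifold T \<longleftrightarrow> Hausdorff_space T \<and> second_countable T \<and>
     (\<forall>x \<in> topspace T. \<exists>U (V :: (real^2) set).
        openin T U \<and> x \<in> U \<and> open V \<and> subtopology T U homeomorphic_space top_of_set V)"

text \<open>
  The surface is the whole type \<open>'x\<close>. Being homeomorphic to a connected 2-manifold without boundary
  is the same as the metric topology being one.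
\<close>

definition metric_surface :: "'x::metric_space itself \<Rightarrow> bool" where
  "metric_surface _ \<longleftrightarrow>
     two_manifold (euclidean :: 'x topology) \<and> connected (UNIV :: 'x set) \<and>
     (\<forall>K :: 'x set. compact K \<longrightarrow> hausdorff 2 K < \<infinity>)"

section \<open>Curves, line integrals and exceptional families\<close>

text \<open>
  A curve is represented by its parameter interval \<open>I\<close>, which may be open, half-open or unbounded,
  and a function whose values outside \<open>I\<close> are irrelevant.
\<close>

definition curve_length :: "real set \<Rightarrow> (real \<Rightarrow> 'a::metric_space) \<Rightarrow> ennreal" where
  "curve_length I \<gamma> =
     (SUP ts \<in> {ts. sorted ts \<and> set ts \<subseteq> I}.
        \<Sum>i < length ts - 1. ennreal (dist (\<gamma> (ts ! i)) (\<gamma> (ts ! Suc i))))"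

definition curve :: "real set \<Rightarrow> (real \<Rightarrow> 'a::metric_space) \<Rightarrow> bool" where
  "curve I \<gamma> \<longleftrightarrow> is_interval I \<and> continuous_on I \<gamma>"

definition rectifiable_curve :: "real set \<Rightarrow> (real \<Rightarrow> 'a::metric_space) \<Rightarrow> bool" where
  "rectifiable_curve I \<gamma> \<longleftrightarrow> curve I \<gamma> \<and> curve_length I \<gamma> < \<infinity>"

definition exceptional :: "(real set \<times> (real \<Rightarrow> 'x::metric_space)) set \<Rightarrow> bool" where
  "exceptional \<Gamma> \<longleftrightarrow>
     (\<forall>(I, \<gamma>) \<in> \<Gamma>. rectifiable_curve I \<gamma>) \<and>
     (\<exists>A. hausdorff 2 A = 0 \<and> (\<forall>(I, \<gamma>) \<in> \<Gamma>. hausdorff 1 (\<gamma> ` I \<inter> A) > 0))"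

text \<open>
  \<open>\<gamma> \<circ> inv_into {a..b} s\<close> below is the arc-length parametrization of \<open>\<gamma>\<close>: it does not depend on the
  choice made by \<^const>\<open>inv_into\<close>, because \<open>\<gamma>\<close> is constant on the fibres of its length function \<open>s\<close>.
\<close>

definition line_integral :: "real \<Rightarrow> real \<Rightarrow> (real \<Rightarrow> 'a::metric_space) \<Rightarrow> ('a \<Rightarrow> ennreal) \<Rightarrow> ennreal" where
  "line_integral a b \<gamma> \<rho> =
     (let s = (\<lambda>t. enn2real (curve_length {a..t} \<gamma>))
      in \<integral>\<^sup>+ r \<in> {0..s b}. \<rho> (\<gamma> (inv_into {a..b} s r)) \<partial>lborel)"

section \<open>Sobolev maps\<close>

definition upper_gradient_on ::
    "'m::metric_space set \<Rightarrow> ('m \<Rightarrow> 'x::metric_space) \<Rightarrow> ('m \<Rightarrow> ennreal) \<Rightarrow> bool" where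
  "upper_gradient_on S h \<rho> \<longleftrightarrow>
     \<rho> \<in> borel_measurable (restrict_space borel S) \<and>
     (\<forall>a b \<gamma>. a \<le> b \<and> \<gamma> ` {a..b} \<subseteq> S \<and> rectifiable_curve {a..b} \<gamma> \<longrightarrow>
        ennreal (dist (h (\<gamma> a)) (h (\<gamma> b))) \<le> line_integral a b \<gamma> \<rho>)"

text \<open>
  The measure on the domain is the Hausdorff 2-measure. On a Riemannian 2-manifold with its Riemannian
  distance this is the Riemannian area; on a planar domain it is Lebesgue measure.
\<close>

definition N12_on :: "'m::metric_space set \<Rightarrow> ('m \<Rightarrow> 'x::metric_space) set" where
  "N12_on S = {h. h \<in> borel_measurable (restrict_space borel S) \<and>
     (\<exists>\<rho>. upper_gradient_on S h \<rho> \<and> (\<integral>\<^sup>+ z \<in> S. (\<rho> z)\<^sup>2 \<partial>hausdorff_measure 2) < \<infinity>) \<and>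
     (\<exists>x. (\<integral>\<^sup>+ z \<in> S. ennreal ((dist x (h z))\<^sup>2) \<partial>hausdorff_measure 2) < \<infinity>)}"

definition N12_loc :: "('m::metric_space \<Rightarrow> 'x::metric_space) set" where
  "N12_loc = {h. \<forall>z. \<exists>U. open U \<and> z \<in> U \<and> h \<in> N12_on U}"

section \<open>Approximate metric derivatives\<close>

definition seminorm :: "(real^2 \<Rightarrow> real) \<Rightarrow> bool" where
  "seminorm N \<longleftrightarrow> (\<forall>v w. N (v + w) \<le> N v + N w) \<and> (\<forall>c v. N (c *\<^sub>R v) = \<bar>c\<bar> * N v)"

text \<open>
  \<open>N\<close> is the approximate metric derivative of \<open>h\<close> at \<open>z\<close> if
  \<open>(d (h y, h z) - N (y - z)) / |y - z|\<close> has approximate limit \<open>0\<close> as \<open>y\<close> tends to \<open>z\<close>, i.e. if for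
  every \<open>\<epsilon> > 0\<close> the set where its absolute value exceeds \<open>\<epsilon>\<close> has Lebesgue density \<open>0\<close> at \<open>z\<close>.
  Only the values of \<open>h\<close> near \<open>z\<close> matter, and there is at most one such \<open>N\<close>.
\<close>

definition has_apmd :: "(real^2 \<Rightarrow> 'x::metric_space) \<Rightarrow> real^2 \<Rightarrow> (real^2 \<Rightarrow> real) \<Rightarrow> bool" where
  "has_apmd h z N \<longleftrightarrow> seminorm N \<and>
     (\<forall>\<epsilon>>0. ((\<lambda>r. outer_measure_of lebesgue
                   {y \<in> ball z r. \<bar>dist (h y) (h z) - N (y - z)\<bar> > \<epsilon> * norm (y - z)}
                 / emeasure lebesgue (ball z r)) \<longlongrightarrow> 0) (at_right 0))"

definition apmd_exists :: "(real^2 \<Rightarrow> 'x::metric_space) \<Rightarrow> real^2 \<Rightarrow> bool" where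
  "apmd_exists h z \<longleftrightarrow> (\<exists>N. has_apmd h z N)"

definition apmd :: "(real^2 \<Rightarrow> 'x::metric_space) \<Rightarrow> real^2 \<Rightarrow> real^2 \<Rightarrow> real" where
  "apmd h z = (THE N. has_apmd h z N)"

definition jacobian_seminorm :: "(real^2 \<Rightarrow> real) \<Rightarrow> real" where
  "jacobian_seminorm N =
     (if \<exists>v. v \<noteq> 0 \<and> N v = 0 then 0 else pi / measure lebesgue {y. N y \<le> 1})"

text \<open>The supremum is a maximum, as seminorms on the plane are continuous.\<close>

definition max_stretch :: "(real^2 \<Rightarrow> real) \<Rightarrow> real" where
  "max_stretch N = (SUP v \<in> sphere 0 1. N v)"

section \<open>Riemannian 2-manifolds\<close>

definition partial :: "2 \<Rightarrow> (real^2 \<Rightarrow> 'b::real_normed_vector) \<Rightarrow> real^2 \<Rightarrow> 'b" where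
  "partial i f x = frechet_derivative f (at x) (axis i 1)"

primrec Ck_on :: "nat \<Rightarrow> (real^2 \<Rightarrow> 'b::real_normed_vector) \<Rightarrow> (real^2) set \<Rightarrow> bool" where
  "Ck_on 0 f S \<longleftrightarrow> continuous_on S f"
| "Ck_on (Suc k) f S \<longleftrightarrow> (\<forall>x\<in>S. f differentiable at x) \<and> (\<forall>i. Ck_on k (partial i f) S)"

definition smooth_on :: "(real^2 \<Rightarrow> 'b::real_normed_vector) \<Rightarrow> (real^2) set \<Rightarrow> bool" where
  "smooth_on f S \<longleftrightarrow> (\<forall>k. Ck_on k f S)"

text \<open>A chart is its domain together with its coordinate map.\<close>

type_synonym 'm chart = "'m set \<times> ('m \<Rightarrow> real^2)"

definition chart_image :: "'m chart \<Rightarrow> (real^2) set" where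
  "chart_image c = snd c ` fst c"

definition chart_inv :: "'m chart \<Rightarrow> real^2 \<Rightarrow> 'm" where
  "chart_inv c = inv_into (fst c) (snd c)"

definition is_chart :: "'m::topological_space chart \<Rightarrow> bool" where
  "is_chart c \<longleftrightarrow> open (fst c) \<and> open (chart_image c) \<and>
     homeomorphism (fst c) (chart_image c) (snd c) (chart_inv c)"

definition transition :: "'m chart \<Rightarrow> 'm chart \<Rightarrow> real^2 \<Rightarrow> real^2" where
  "transition c c' = snd c' \<circ> chart_inv c"

definition compatible :: "'m chart \<Rightarrow> 'm chart \<Rightarrow> bool" where
  "compatible c c' \<longleftrightarrow>
     smooth_on (transition c c') (snd c ` (fst c \<inter> fst c')) \<and>
     smooth_on (transition c' c) (snd c' ` (fst c \<inter> fst c'))"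

text \<open>A smooth structure is a maximal smooth atlas.\<close>

definition smooth_structure :: "'m::topological_space chart set \<Rightarrow> bool" where
  "smooth_structure \<A> \<longleftrightarrow>
     (\<forall>c\<in>\<A>. is_chart c) \<and> (\<Union>c\<in>\<A>. fst c) = UNIV \<and>
     (\<forall>c\<in>\<A>. \<forall>c'\<in>\<A>. compatible c c') \<and>
     (\<forall>c. is_chart c \<and> (\<forall>c'\<in>\<A>. compatible c c') \<longrightarrow> c \<in> \<A>)"

text \<open>
  A metric tensor is given by its coefficient matrix in every chart of the smooth structure, as a
  function on the image of the chart.
\<close>

type_synonym 'm metric_tensor = "'m chart \<Rightarrow> real^2 \<Rightarrow> real^2^2"

definition riemannian_metric :: "'m chart set \<Rightarrow> 'm metric_tensor \<Rightarrow> bool" where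
  "riemannian_metric \<A> g \<longleftrightarrow>
     (\<forall>c\<in>\<A>. smooth_on (g c) (chart_image c) \<and>
        (\<forall>x \<in> chart_image c. transpose (g c x) = g c x \<and> (\<forall>v. v \<noteq> 0 \<longrightarrow> v \<bullet> (g c x *v v) > 0))) \<and>
     (\<forall>c\<in>\<A>. \<forall>c'\<in>\<A>. \<forall>x \<in> snd c ` (fst c \<inter> fst c').
        let J = jacobian (transition c c') (at x)
        in g c x = transpose J ** g c' (transition c c' x) ** J)"

definition piecewise_C1_path :: "'m::topological_space chart set \<Rightarrow> (real \<Rightarrow> 'm) \<Rightarrow> bool" where
  "piecewise_C1_path \<A> \<gamma> \<longleftrightarrow> path \<gamma> \<and>
     (\<forall>c\<in>\<A>. \<forall>a b. {a..b} \<subseteq> {0..1} \<and> \<gamma> ` {a..b} \<subseteq> fst c \<longrightarrow>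
        (snd c \<circ> \<gamma>) piecewise_C1_differentiable_on {a..b})"

text \<open>By the transformation law for \<open>g\<close>, the speed is independent of the chart chosen here.\<close>

definition riemannian_speed :: "'m chart set \<Rightarrow> 'm metric_tensor \<Rightarrow> (real \<Rightarrow> 'm) \<Rightarrow> real \<Rightarrow> real" where
  "riemannian_speed \<A> g \<gamma> t =
     (let c = (SOME c. c \<in> \<A> \<and> \<gamma> t \<in> fst c);
          v = vector_derivative (snd c \<circ> \<gamma>) (at t)
      in sqrt (v \<bullet> (g c (snd c (\<gamma> t)) *v v)))"

definition riemannian_length :: "'m chart set \<Rightarrow> 'm metric_tensor \<Rightarrow> (real \<Rightarrow> 'm) \<Rightarrow> ennreal" where
  "riemannian_length \<A> g \<gamma> = (\<integral>\<^sup>+ t \<in> {0..1}. ennreal (riemannian_speed \<A> g \<gamma> t) \<partial>lborel)"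

definition riemannian_distance ::
    "'m::topological_space chart set \<Rightarrow> 'm metric_tensor \<Rightarrow> 'm \<Rightarrow> 'm \<Rightarrow> ennreal" where
  "riemannian_distance \<A> g x y =
     (INF \<gamma> \<in> {\<gamma>. piecewise_C1_path \<A> \<gamma> \<and> pathstart \<gamma> = x \<and> pathfinish \<gamma> = y}.
        riemannian_length \<A> g \<gamma>)"

text \<open>
  The manifold is the whole type \<open>'m\<close>, and \<^const>\<open>dist\<close> on it is the Riemannian distance. As the
  distance is finite, the manifold is connected.
\<close>

definition riemannian_2_manifold :: "'m::metric_space chart set \<Rightarrow> 'm metric_tensor \<Rightarrow> bool" where
  "riemannian_2_manifold \<A> g \<longleftrightarrow>
     second_countable (euclidean :: 'm topology) \<and> smooth_structure \<A> \<and> riemannian_metric \<A> g \<and>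
     (\<forall>x y. ennreal (dist x y) = riemannian_distance \<A> g x y)"

text \<open>
  Below, \<open>christoffel G k i j\<close> is $\Gamma^k_{ij}$, and \<open>riemann_tensor G l i j k\<close> is $R^l{}_{ijk}$,
  the \<open>l\<close>-th component of $R(\partial_j, \partial_k) \partial_i$ where
  $R(X,Y) = [\nabla_X, \nabla_Y] - \nabla_{[X,Y]}$.
\<close>

definition christoffel :: "(real^2 \<Rightarrow> real^2^2) \<Rightarrow> 2 \<Rightarrow> 2 \<Rightarrow> 2 \<Rightarrow> real^2 \<Rightarrow> real" where
  "christoffel G k i j x =
     (\<Sum>l\<in>UNIV. matrix_inv (G x) $ k $ l *
        (partial i (\<lambda>y. G y $ j $ l) x + partial j (\<lambda>y. G y $ i $ l) x
         - partial l (\<lambda>y. G y $ i $ j) x)) / 2"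

definition riemann_tensor :: "(real^2 \<Rightarrow> real^2^2) \<Rightarrow> 2 \<Rightarrow> 2 \<Rightarrow> 2 \<Rightarrow> 2 \<Rightarrow> real^2 \<Rightarrow> real" where
  "riemann_tensor G l i j k x =
     partial j (christoffel G l k i) x - partial k (christoffel G l j i) x
     + (\<Sum>m\<in>UNIV. christoffel G l j m x * christoffel G m k i x
                  - christoffel G l k m x * christoffel G m j i x)"

definition gauss_curvature :: "(real^2 \<Rightarrow> real^2^2) \<Rightarrow> real^2 \<Rightarrow> real" where
  "gauss_curvature G x = (\<Sum>l\<in>UNIV. G x $ 1 $ l * riemann_tensor G l 2 1 2 x) / det (G x)"

definition constant_curvature :: "'m chart set \<Rightarrow> 'm metric_tensor \<Rightarrow> bool" where
  "constant_curvature \<A> g \<longleftrightarrow>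
     (\<exists>\<kappa>. \<forall>c\<in>\<A>. \<forall>x \<in> chart_image c. gauss_curvature (g c) x = \<kappa>)"

definition conformal_chart :: "'m chart set \<Rightarrow> 'm metric_tensor \<Rightarrow> 'm chart \<Rightarrow> bool" where
  "conformal_chart \<A> g c \<longleftrightarrow> c \<in> \<A> \<and>
     (\<forall>x \<in> chart_image c. \<exists>\<mu>>0. g c x = \<mu> *\<^sub>R mat 1)"

section \<open>Uniformization maps and the image of the singular set\<close>

text \<open>
  The dilatation inequality is read in conformal coordinates; passing to other conformal coordinates
  multiplies both sides by the same positive factor.
\<close>

definition uniformization_map ::
    "'m::metric_space chart set \<Rightarrow> 'm metric_tensor \<Rightarrow> ('m \<Rightarrow> 'x::metric_space) \<Rightarrow> bool" where
  "uniformization_map \<A> g u \<longleftrightarrow>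
     riemannian_2_manifold \<A> g \<and> constant_curvature \<A> g \<and>
     (UNIV :: 'm set) homeomorphic (UNIV :: 'x set) \<and>
     u \<in> N12_loc \<and>
     continuous_on UNIV u \<and> surj u \<and>
     (\<forall>K. compact K \<longrightarrow> compact (u -` K)) \<and>
     (\<forall>x. connected (u -` {x})) \<and>
     hausdorff 2 {x. card (u -` {x}) \<noteq> 1} = 0 \<and>
     (\<forall>c. conformal_chart \<A> g c \<longrightarrow>
        hausdorff 2 {z \<in> fst c.
          \<not> (apmd_exists (u \<circ> chart_inv c) (snd c z) \<and>
             (max_stretch (apmd (u \<circ> chart_inv c) (snd c z)))\<^sup>2
               \<le> 4 / pi * jacobian_seminorm (apmd (u \<circ> chart_inv c) (snd c z)))} = 0)"

text \<open>
  \<open>K\<close> is one of the good pieces, in coordinates, of a map \<open>h\<close> defined near \<open>K\<close> in the plane.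
\<close>

definition good_piece :: "(real^2 \<Rightarrow> 'x::metric_space) \<Rightarrow> (real^2) set \<Rightarrow> bool" where
  "good_piece h K \<longleftrightarrow>
     (\<exists>L. L-lipschitz_on K h) \<and> (\<forall>z\<in>K. apmd_exists h z) \<and>
     (\<forall>\<epsilon>>0. \<exists>r>0. \<forall>z\<in>K. \<forall>v w.
        norm v \<le> r \<and> norm w \<le> r \<and> z + v \<in> K \<and> z + w \<in> K \<longrightarrow>
        \<bar>dist (h (z + v)) (h (z + w)) - apmd h z (v - w)\<bar> \<le> \<epsilon> * norm (v - w))"

text \<open>The good pieces are \<open>G j\<close> for \<open>j \<ge> 1\<close>, and \<open>G 0\<close> is the remaining null set.\<close>

definition singular_decomposition ::
    "'m::metric_space chart set \<Rightarrow> 'm metric_tensor \<Rightarrow> ('m \<Rightarrow> 'x::metric_space) \<Rightarrow> (nat \<Rightarrow> 'm set) \<Rightarrow> bool"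
  where
  "singular_decomposition \<A> g u G \<longleftrightarrow>
     disjoint_family_on G {1..} \<and>
     (\<forall>j\<ge>1. compact (G j) \<and>
        (\<exists>c. conformal_chart \<A> g c \<and> G j \<subseteq> fst c \<and>
             good_piece (u \<circ> chart_inv c) (snd c ` G j))) \<and>
     G 0 = UNIV - (\<Union>j\<in>{1..}. G j) \<and>
     hausdorff 2 (G 0) = 0"

end

theory Submission
  imports Defs
begin

text \<open>
  In bi-Lipschitz coordinates let \<open>\<rho>\<close> be an upper gradient of \<open>u\<close>, and let
  \<open>m\<close> be the image under \<open>u\<close> of the measure with density \<open>\<rho>\<^sup>2 + 1\<close>. The points \<open>x = u w\<close> with
  \<open>w \<in> G 0\<close> and fibre \<open>{w}\<close> form an \<open>m\<close>-null set, so by Vitali's covering argument \<open>m (B x r) = o(r\<^sup>2)\<close> at all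
  of them outside an \<open>\<H>\<^sup>2\<close>-null set. That null set and the points with multiple fibres form the set \<open>A\<close>
  witnessing that the family is exceptional.

  Indeed, at \<open>\<H>\<^sup>1\<close>-almost every point \<open>x\<close> of a rectifiable curve the two halves of the curve separate
  linearly. If also \<open>x = u w\<close> as above, their preimages are connected, so every small square around
  \<open>w\<close> meets both, and the oscillation of \<open>u\<close> on its boundary is comparable to the largest distance from
  \<open>x\<close> there. A length-area estimate over squares of all sizes then contradicts \<open>m (B x r) = o(r\<^sup>2)\<close>.
\<close>

section \<open>Hausdorff measure\<close>

text \<open>Smallness is known in \<open>X\<close>, for balls around \<open>x\<close>, but the
  length-area estimate runs over squares around \<open>w\<close>, and nothing relates the side of a
  square to the size of its image. This is why the squares are sorted by the size of their images
  rather than by their sides. The upper gradient bounds only the diameter of the image of a square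
  boundary. That image could be a loop lying far from \<open>x\<close> compared with its diameter,
  and then no lower bound for the energy would follow. Two continua that separate linearly at
  \<open>x\<close> exclude this, because the loop meets both of them. The fibre of \<open>x\<close>
  has to be a point for the density estimate: an open set of small mass around the null set then
  contains the preimage of a whole ball around \<open>x\<close>, whereas a larger fibre would bring
  in mass away from the null set. Vitali's argument is used in the form with balls enlarged five
  times, which holds in every metric space and so asks nothing of \<open>X\<close> such as a
  doubling measure.\<close>

definition gauge_cost :: "nat \<Rightarrow> 'a::metric_space set \<Rightarrow> ennreal" where
  "gauge_cost n C = (if C = {} then 0 else ennreal (unit_ball_vol (real n) * (diameter C / 2) ^ n))"

lemma gauge_cost_empty [simp]: "gauge_cost n {} = 0"
  by (simp add: gauge_cost_def)

lemma gauge_cost_mono: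
  assumes "A \<subseteq> B" "bounded B"
  shows "gauge_cost n A \<le> gauge_cost n B"
proof (cases "A = {}")
  case False
  then have "B \<noteq> {}" using assms by auto
  have "0 \<le> diameter A" "diameter A \<le> diameter B"
    using assms bounded_subset by (auto intro: diameter_ge_0 diameter_subset)
  then have "(diameter A / 2) ^ n \<le> (diameter B / 2) ^ n"
    by (intro power_mono) auto
  then show ?thesis
    using False \<open>B \<noteq> {}\<close> by (auto simp: gauge_cost_def intro!: ennreal_leI mult_left_mono)
qed (simp add: gauge_cost_def)

lemma hausdorff_delta_gauge_cost:
  "hausdorff_delta n \<delta> A =
     (INF C \<in> {C. A \<subseteq> (\<Union>i. C i) \<and> (\<forall>i. bounded (C i) \<and> diameter (C i) \<le> \<delta>)}. \<Sum>i. gauge_cost n (C i))"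
  unfolding hausdorff_delta_def gauge_cost_def ..

lemma hausdorff_delta_le:
  assumes "A \<subseteq> (\<Union>i. C i)" "\<And>i. bounded (C i)" "\<And>i. diameter (C i) \<le> \<delta>"
  shows "hausdorff_delta n \<delta> A \<le> (\<Sum>i. gauge_cost n (C i))"
  unfolding hausdorff_delta_gauge_cost using assms by (intro INF_lower) auto

lemma hausdorff_delta_coverE:
  assumes "hausdorff_delta n \<delta> A < e"
  obtains C where "A \<subseteq> (\<Union>i. C i)" "\<And>i. bounded (C i)" "\<And>i. diameter (C i) \<le> \<delta>"
    "(\<Sum>i. gauge_cost n (C i)) < e"
  using assms unfolding hausdorff_delta_gauge_cost INF_less_iff by auto

lemma hausdorff_delta_mono: "A \<subseteq> B \<Longrightarrow> hausdorff_delta n \<delta> A \<le> hausdorff_delta n \<delta> B"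
  unfolding hausdorff_delta_gauge_cost by (intro INF_superset_mono) auto

lemma hausdorff_delta_antimono:
  "\<delta> \<le> \<delta>' \<Longrightarrow> hausdorff_delta n \<delta>' A \<le> hausdorff_delta n \<delta> A"
  unfolding hausdorff_delta_gauge_cost by (intro INF_superset_mono) (auto intro: order_trans)

lemma hausdorff_delta_empty [simp]: "0 \<le> \<delta> \<Longrightarrow> hausdorff_delta n \<delta> {} = 0"
  using hausdorff_delta_le[of "{}" "\<lambda>i. {}" \<delta> n] by (simp add: gauge_cost_def)

lemma hausdorff_delta_UN:
  "hausdorff_delta n \<delta> (\<Union>k. A k) \<le> (\<Sum>k. hausdorff_delta n \<delta> (A k :: 'a::metric_space set))"
proof (cases "(\<Sum>k. hausdorff_delta n \<delta> (A k)) = \<infinity>")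
  case False
  have fin: "hausdorff_delta n \<delta> (A k) < \<infinity>" for k
    using False ennreal_suminf_lessD[of "\<lambda>k. hausdorff_delta n \<delta> (A k)" \<infinity> k]
    by (simp add: top.not_eq_extremum)
  show ?thesis
  proof (rule ennreal_le_epsilon)
    fix e :: real assume "0 < e"
    have "\<exists>C. A k \<subseteq> (\<Union>i. C i) \<and> (\<forall>i. bounded (C i) \<and> diameter (C i) \<le> \<delta>) \<and>
         (\<Sum>i. gauge_cost n (C i)) \<le> hausdorff_delta n \<delta> (A k) + ennreal (e * (1/2)^Suc k)" for k
    proof -
      have "hausdorff_delta n \<delta> (A k) < hausdorff_delta n \<delta> (A k) + ennreal (e * (1/2)^Suc k)"
        using fin[of k] \<open>0 < e\<close>
        by (cases "hausdorff_delta n \<delta> (A k)" rule: ennreal_cases)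
           (auto simp: ennreal_less_iff simp flip: ennreal_plus)
      then show ?thesis
        by (elim hausdorff_delta_coverE) (metis less_imp_le)
    qed
    then obtain C where C: "\<And>k. A k \<subseteq> (\<Union>i. C k i)"
        "\<And>k i. bounded (C k i)" "\<And>k i. diameter (C k i) \<le> \<delta>"
        "\<And>k. (\<Sum>i. gauge_cost n (C k i)) \<le> hausdorff_delta n \<delta> (A k) + ennreal (e * (1/2)^Suc k)"
      by metis
    define D where "D j = (case prod_decode j of (k, i) \<Rightarrow> C k i)" for j
    have "(\<Union>k. A k) \<subseteq> (\<Union>j. D j)"
    proof safe
      fix x k assume "x \<in> A k"
      then obtain i where "x \<in> C k i" using C(1) by blast
      then have "x \<in> D (prod_encode (k, i))" by (simp add: D_def)
      then show "x \<in> (\<Union>j. D j)" by blast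
    qed
    then have "hausdorff_delta n \<delta> (\<Union>k. A k) \<le> (\<Sum>j. gauge_cost n (D j))"
      by (rule hausdorff_delta_le) (auto simp: D_def C split: prod.split)
    also have "\<dots> = (\<Sum>k. \<Sum>i. gauge_cost n (C k i))"
      using suminf_ennreal_2dimen[of "\<lambda>k. \<Sum>i. gauge_cost n (C k i)" "\<lambda>(k, i). gauge_cost n (C k i)"]
      by (simp add: D_def case_prod_unfold o_def)
    also have "\<dots> \<le> (\<Sum>k. hausdorff_delta n \<delta> (A k) + ennreal (e * (1/2)^Suc k))"
      using C(4) by (intro suminf_le) auto
    also have "\<dots> = (\<Sum>k. hausdorff_delta n \<delta> (A k)) + (\<Sum>k. ennreal (e * (1/2)^Suc k))"
      by (rule suminf_add[symmetric]) auto
    also have "(\<Sum>k. ennreal (e * (1/2)^Suc k)) = ennreal e"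
    proof (rule suminf_ennreal_eq)
      show "(\<lambda>k. e * (1/2)^Suc k) sums e"
        using sums_mult[OF power_half_series, of e] by simp
    qed (use \<open>0 < e\<close> in auto)
    finally show "hausdorff_delta n \<delta> (\<Union>k. A k) \<le> (\<Sum>k. hausdorff_delta n \<delta> (A k)) + ennreal e" .
  qed
qed simp

lemma hausdorff_delta_Un:
  fixes A B :: "'a::metric_space set"
  assumes "0 \<le> \<delta>"
  shows "hausdorff_delta n \<delta> (A \<union> B) \<le> hausdorff_delta n \<delta> A + hausdorff_delta n \<delta> B"
proof -
  have "hausdorff_delta n \<delta> (\<Union>k. binaryset A B k) \<le> (\<Sum>k. hausdorff_delta n \<delta> (binaryset A B k))"
    by (rule hausdorff_delta_UN)
  also have "\<dots> = hausdorff_delta n \<delta> A + hausdorff_delta n \<delta> B"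
    using assms by (intro suminf_binaryset_eq[where f = "hausdorff_delta n \<delta>"]) simp
  finally show ?thesis by (simp only: UN_binaryset_eq)
qed

lemma hausdorff_mono: "A \<subseteq> B \<Longrightarrow> hausdorff n A \<le> hausdorff n B"
  unfolding hausdorff_def by (intro SUP_mono' hausdorff_delta_mono)

lemma hausdorff_delta_le_hausdorff: "0 < \<delta> \<Longrightarrow> hausdorff_delta n \<delta> A \<le> hausdorff n A"
  unfolding hausdorff_def by (intro SUP_upper) auto

lemma hausdorff_eq_0I:
  assumes "\<And>\<delta>. 0 < \<delta> \<Longrightarrow> hausdorff_delta n \<delta> A = 0"
  shows "hausdorff n A = 0"
proof -
  have "hausdorff n A \<le> 0"
    unfolding hausdorff_def using assms by (intro SUP_least) simp
  then show ?thesis by simp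
qed

lemma hausdorff_empty [simp]: "hausdorff n {} = 0"
  by (rule hausdorff_eq_0I) simp

lemma hausdorff_UN: "hausdorff n (\<Union>k. A k) \<le> (\<Sum>k. hausdorff n (A k :: 'a::metric_space set))"
  unfolding hausdorff_def[of n "\<Union>k. A k"]
proof (rule SUP_least)
  fix \<delta> :: real assume "\<delta> \<in> {0<..}"
  then have "(\<Sum>k. hausdorff_delta n \<delta> (A k)) \<le> (\<Sum>k. hausdorff n (A k))"
    by (intro suminf_le) (auto intro: hausdorff_delta_le_hausdorff)
  with hausdorff_delta_UN show "hausdorff_delta n \<delta> (\<Union>k. A k) \<le> (\<Sum>k. hausdorff n (A k))"
    by (rule order_trans)
qed

lemma hausdorff_Un: "hausdorff n (A \<union> B) \<le> hausdorff n A + hausdorff n B"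
proof -
  have "hausdorff n (\<Union>k. binaryset A B k) \<le> (\<Sum>k. hausdorff n (binaryset A B k))"
    by (rule hausdorff_UN)
  also have "\<dots> = hausdorff n A + hausdorff n B"
    by (rule suminf_binaryset_eq[where f = "hausdorff n"]) simp
  finally show ?thesis by (simp only: UN_binaryset_eq)
qed

lemma hausdorff_null_UN:
  assumes "countable I" "\<And>i. i \<in> I \<Longrightarrow> hausdorff n (A i) = 0"
  shows "hausdorff n (\<Union>i\<in>I. A i) = 0"
proof (cases "I = {}")
  case False
  have "(\<Union>i\<in>I. A i) = (\<Union>k. A (from_nat_into I k))"
    using range_from_nat_into[OF False assms(1)] by (metis image_image)
  moreover have "hausdorff n (A (from_nat_into I k)) = 0" for k
    using False assms(2) by (simp add: from_nat_into)
  ultimately show ?thesis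
    using hausdorff_UN[of n "\<lambda>k. A (from_nat_into I k)"] by simp
qed simp

lemma hausdorff_singleton [simp]:
  assumes "n > 0" shows "hausdorff n {x} = 0"
proof -
  have "hausdorff_delta n \<delta> {x} = 0" if "\<delta> > 0" for \<delta>
  proof -
    have "gauge_cost n {x} = 0" using assms by (simp add: gauge_cost_def)
    moreover have "hausdorff_delta n \<delta> {x} \<le> (\<Sum>i. gauge_cost n {x})"
      using that by (intro hausdorff_delta_le) auto
    ultimately show ?thesis by simp
  qed
  then show ?thesis by (rule hausdorff_eq_0I)
qed

lemma hausdorff_countable:
  assumes "n > 0" "countable A" shows "hausdorff n A = 0"
  using hausdorff_null_UN[of A n "\<lambda>x. {x}"] assms by simp

text \<open>A covering set of diameter below \<open>d\<close> cannot meet both \<open>A\<close> and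
  \<open>B\<close>, so its cost is charged to only one of the two covers obtained by
  intersecting.\<close>

lemma hausdorff_add_separated:
  fixes A B :: "'a::metric_space set"
  assumes "0 < d" "\<And>a b. a \<in> A \<Longrightarrow> b \<in> B \<Longrightarrow> d \<le> dist a b"
  shows "hausdorff n A + hausdorff n B \<le> hausdorff n (A \<union> B)"
proof -
  have *: "hausdorff_delta n \<delta> A + hausdorff_delta n \<delta> B \<le> hausdorff_delta n \<delta> (A \<union> B)"
    if "0 < \<delta>" "\<delta> < d" for \<delta>
    unfolding hausdorff_delta_gauge_cost[of n \<delta> "A \<union> B"]
  proof (rule INF_greatest, clarify)
    fix C :: "nat \<Rightarrow> 'a set" assume C: "A \<union> B \<subseteq> (\<Union>i. C i)" "\<forall>i. bounded (C i) \<and> diameter (C i) \<le> \<delta>"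
    have "hausdorff_delta n \<delta> A \<le> (\<Sum>i. gauge_cost n (C i \<inter> A))"
    proof (rule hausdorff_delta_le)
      show "diameter (C i \<inter> A) \<le> \<delta>" for i
        using diameter_subset[of "C i \<inter> A" "C i"] C(2) by (auto intro: order_trans)
    qed (use C in auto)
    moreover have "hausdorff_delta n \<delta> B \<le> (\<Sum>i. gauge_cost n (C i \<inter> B))"
    proof (rule hausdorff_delta_le)
      show "diameter (C i \<inter> B) \<le> \<delta>" for i
        using diameter_subset[of "C i \<inter> B" "C i"] C(2) by (auto intro: order_trans)
    qed (use C in auto)
    ultimately have "hausdorff_delta n \<delta> A + hausdorff_delta n \<delta> B
        \<le> (\<Sum>i. gauge_cost n (C i \<inter> A)) + (\<Sum>i. gauge_cost n (C i \<inter> B))"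
      by (rule add_mono)
    also have "\<dots> = (\<Sum>i. gauge_cost n (C i \<inter> A) + gauge_cost n (C i \<inter> B))"
      by (rule suminf_add) auto
    also have "\<dots> \<le> (\<Sum>i. gauge_cost n (C i))"
    proof (rule suminf_le)
      fix i
      have "C i \<inter> A = {} \<or> C i \<inter> B = {}"
      proof (rule ccontr)
        assume "\<not> ?thesis"
        then obtain a b where "a \<in> C i" "a \<in> A" "b \<in> C i" "b \<in> B" by blast
        then show False
          using assms(2)[of a b] diameter_bounded_bound[of "C i" a b] C(2)[rule_format, of i] \<open>\<delta> < d\<close>
          by linarith
      qed
      moreover have "gauge_cost n (C i \<inter> A) \<le> gauge_cost n (C i)"
        "gauge_cost n (C i \<inter> B) \<le> gauge_cost n (C i)"
        using C(2) by (auto intro: gauge_cost_mono)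
      ultimately show "gauge_cost n (C i \<inter> A) + gauge_cost n (C i \<inter> B) \<le> gauge_cost n (C i)"
        by (elim disjE) auto
    qed auto
    finally show "hausdorff_delta n \<delta> A + hausdorff_delta n \<delta> B \<le> (\<Sum>i. gauge_cost n (C i))" .
  qed
  have "hausdorff n A + hausdorff n B = (SUP \<delta>\<in>{0<..}. hausdorff_delta n \<delta> A) + (SUP \<delta>\<in>{0<..}. hausdorff_delta n \<delta> B)"
    unfolding hausdorff_def ..
  also have "\<dots> = (SUP \<delta>\<in>{0<..}. hausdorff_delta n \<delta> A + hausdorff_delta n \<delta> B)"
  proof (rule SUP_add_directed_ennreal[symmetric])
    fix i j :: real assume "i \<in> {0<..}" "j \<in> {0<..}"
    then show "\<exists>k\<in>{0<..}. hausdorff_delta n i A + hausdorff_delta n j B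
        \<le> hausdorff_delta n k A + hausdorff_delta n k B"
      by (intro bexI[of _ "min i j"] add_mono hausdorff_delta_antimono) auto
  qed
  also have "\<dots> \<le> hausdorff n (A \<union> B)"
  proof (rule SUP_least)
    fix \<delta> :: real assume "\<delta> \<in> {0<..}"
    then have "hausdorff_delta n \<delta> A + hausdorff_delta n \<delta> B
       \<le> hausdorff_delta n (min \<delta> (d/2)) A + hausdorff_delta n (min \<delta> (d/2)) B"
      by (intro add_mono hausdorff_delta_antimono) auto
    also have "\<dots> \<le> hausdorff_delta n (min \<delta> (d/2)) (A \<union> B)"
      using \<open>\<delta> \<in> _\<close> \<open>0 < d\<close> by (intro *) auto
    also have "\<dots> \<le> hausdorff n (A \<union> B)"
      using \<open>\<delta> \<in> _\<close> \<open>0 < d\<close> by (intro hausdorff_delta_le_hausdorff) auto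
    finally show "hausdorff_delta n \<delta> A + hausdorff_delta n \<delta> B \<le> hausdorff n (A \<union> B)" .
  qed
  finally show ?thesis .
qed

section \<open>Caratheodory measurability of Borel sets\<close>

lemma suminf_ennreal_tail_tendsto_0:
  fixes f :: "nat \<Rightarrow> ennreal"
  assumes "(\<Sum>k. f k) \<noteq> \<infinity>"
  shows "(\<lambda>k. \<Sum>j. f (j + k)) \<longlonglongrightarrow> 0"
proof -
  have fin: "f k \<noteq> \<infinity>" for k
    using assms ennreal_suminf_lessD[of f \<infinity> k] by (auto simp: less_top[symmetric])
  define g where "g k = enn2real (f k)" for k
  have f: "f = (\<lambda>k. ennreal (g k))" using fin by (auto simp: g_def less_top)
  have g0: "0 \<le> g k" for k by (simp add: g_def)
  have "summable g"
    using assms g0 by (intro summable_suminf_not_top) (auto simp: f)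
  then have "(\<lambda>k. \<Sum>j. g (j + k)) \<longlonglongrightarrow> 0" by (rule suminf_exist_split2)
  then have "(\<lambda>k. ennreal (\<Sum>j. g (j + k))) \<longlonglongrightarrow> ennreal 0" by (rule tendsto_ennrealI)
  moreover have "(\<Sum>j. f (j + k)) = ennreal (\<Sum>j. g (j + k))" for k
    unfolding f using g0 \<open>summable g\<close> by (intro suminf_ennreal2) (auto simp: summable_iff_shift)
  ultimately show ?thesis by simp
qed

text \<open>Caratheodory's criterion: the shells \<open>R k\<close> at distance about \<open>1 / k\<close> from \<open>F\<close> have summable
  measure, since shells of the same parity are pairwise separated.\<close>

lemma hausdorff_split_closed:
  fixes F :: "'a::metric_space set"
  assumes "closed F"
  shows "hausdorff n (A \<inter> F) + hausdorff n (A - F) \<le> hausdorff n A"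
proof (cases "F = {} \<or> hausdorff n A = \<infinity>")
  case True then show ?thesis by auto
next
  case False
  define f where "f x = infdist x F" for x
  have f_le: "f x \<le> f y + dist x y" for x y
    unfolding f_def by (rule infdist_triangle)
  have f0: "f x = 0" if "x \<in> F" for x using that by (simp add: f_def)
  have fpos: "0 < f x" if "x \<notin> F" for x
    using that assms False in_closed_iff_infdist_zero[of F x] infdist_nonneg[of x F]
    unfolding f_def by force
  define B where "B k = {x \<in> A. 1 / real (Suc k) \<le> f x}" for k
  define R where "R k = {x \<in> A. 1 / real (Suc (Suc k)) \<le> f x \<and> f x < 1 / real (Suc k)}" for k
  have fin: "hausdorff n Y < \<infinity>" if "Y \<subseteq> A" for Y
    using hausdorff_mono[OF that, of n] False by (auto simp: less_top intro: le_less_trans)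
  have shells: "(\<Sum>j<m. hausdorff n (R (2 * j + p))) \<le> hausdorff n A" for m p
  proof -
    have "(\<Sum>j<m. hausdorff n (R (2 * j + p))) \<le> hausdorff n (\<Union>j<m. R (2 * j + p))" for m
    proof (induction m)
      case (Suc m)
      show ?case
      proof (cases "m = 0")
        case False
        \<comment> \<open>The shell with index \<open>2 * m + p - 1\<close> is skipped, and
          \<open>e\<close> is the width of the range allowed to \<open>f\<close> on it. For
          \<open>m = 0\<close> the quotient \<open>1 / real (2 * m + p)\<close> may be the junk
          value \<open>1 / 0\<close>, hence the case split; the union is empty there.\<close>
        define e where "e = 1 / real (2 * m + p) - 1 / real (Suc (2 * m + p))"
        have "0 < e" using False by (simp add: e_def divide_strict_left_mono)
        have sep: "e \<le> dist a b" if a: "a \<in> (\<Union>j<m. R (2 * j + p))" and b: "b \<in> R (2 * m + p)" for a b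
        proof -
          from a obtain j where "j < m" "a \<in> R (2 * j + p)" by auto
          then have "1 / real (Suc (Suc (2 * j + p))) \<le> f a" by (simp add: R_def)
          moreover have "1 / real (2 * m + p) \<le> 1 / real (Suc (Suc (2 * j + p)))"
            using \<open>j < m\<close> by (intro divide_left_mono) auto
          moreover have "f b < 1 / real (Suc (2 * m + p))" using b by (simp add: R_def)
          ultimately show ?thesis using f_le[of a b] by (simp add: e_def)
        qed
        have "(\<Sum>j<Suc m. hausdorff n (R (2 * j + p)))
            \<le> hausdorff n (\<Union>j<m. R (2 * j + p)) + hausdorff n (R (2 * m + p))"
          using Suc.IH by (simp add: add_right_mono)
        also have "\<dots> \<le> hausdorff n ((\<Union>j<m. R (2 * j + p)) \<union> R (2 * m + p))"
          by (rule hausdorff_add_separated[OF \<open>0 < e\<close> sep])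
        also have "(\<Union>j<m. R (2 * j + p)) \<union> R (2 * m + p) = (\<Union>j<Suc m. R (2 * j + p))"
          by (auto simp: less_Suc_eq)
        finally show ?thesis .
      qed (simp add: lessThan_Suc)
    qed simp
    also have "hausdorff n (\<Union>j<m. R (2 * j + p)) \<le> hausdorff n A"
      by (rule hausdorff_mono) (auto simp: R_def)
    finally show ?thesis .
  qed
  have "(\<Sum>k<m. hausdorff n (R k)) \<le> 2 * hausdorff n A" for m
  proof -
    have "(\<Sum>k<m. hausdorff n (R k)) \<le> (\<Sum>k<2*m. hausdorff n (R k))"
      by (rule sum_mono2) auto
    also have "\<dots> = (\<Sum>j<m. hausdorff n (R (2*j))) + (\<Sum>j<m. hausdorff n (R (2*j+1)))"
      by (induction m) (auto simp: algebra_simps)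
    also have "\<dots> \<le> hausdorff n A + hausdorff n A"
      using shells[where p=0] shells[where p=1] by (intro add_mono) auto
    finally show ?thesis by (simp add: mult_2)
  qed
  then have "(\<Sum>k. hausdorff n (R k)) \<le> 2 * hausdorff n A"
    by (intro suminf_le_const) auto
  also have "\<dots> < \<infinity>" using fin[of A] by (simp add: ennreal_mult_less_top)
  finally have sum_fin: "(\<Sum>k. hausdorff n (R k)) \<noteq> \<infinity>" by simp
  have tail0: "(\<lambda>k. \<Sum>j. hausdorff n (R (j + k))) \<longlonglongrightarrow> 0"
    by (rule suminf_ennreal_tail_tendsto_0[OF sum_fin])
  \<comment> \<open>\<open>B k\<close> has positive distance from \<open>F\<close>, so the two
    measures add up; what \<open>B k\<close> misses of \<open>A - F\<close> is covered by the tail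
    of the shells.\<close>
  have step: "hausdorff n (A \<inter> F) + hausdorff n (A - F) \<le> hausdorff n A + (\<Sum>j. hausdorff n (R (j + k)))" for k
  proof -
    have "A - F \<subseteq> B k \<union> (\<Union>j. R (j + k))"
    proof
      fix x assume x: "x \<in> A - F"
      define P where "P m \<longleftrightarrow> 1 / real (Suc m) \<le> f x" for m
      show "x \<in> B k \<union> (\<Union>j. R (j + k))"
      proof (cases "P k")
        case False
        obtain m where "inverse (real (Suc m)) < f x" using reals_Archimedean fpos x by blast
        then have "P m" by (simp add: P_def inverse_eq_divide)
        define l where "l = (LEAST m. P m)"
        have "P l" unfolding l_def by (rule LeastI[of P m]) fact
        have "k < l"
        proof (rule ccontr)
          assume "\<not> k < l"
          then have "1 / real (Suc k) \<le> 1 / real (Suc l)" by (intro divide_left_mono) auto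
          with \<open>P l\<close> False show False by (simp add: P_def)
        qed
        then obtain i where i: "l = Suc i" "k \<le> i" by (cases l) auto
        have "\<not> P i" using not_less_Least[of i P] i by (simp add: l_def[symmetric])
        then have "x \<in> R i" using \<open>P l\<close> x i by (auto simp: R_def P_def)
        then have "x \<in> R ((i - k) + k)" using i by simp
        then show ?thesis by blast
      qed (use x in \<open>auto simp: B_def P_def\<close>)
    qed
    then have "hausdorff n (A - F) \<le> hausdorff n (B k \<union> (\<Union>j. R (j + k)))" by (rule hausdorff_mono)
    also have "\<dots> \<le> hausdorff n (B k) + hausdorff n (\<Union>j. R (j + k))" by (rule hausdorff_Un)
    also have "\<dots> \<le> hausdorff n (B k) + (\<Sum>j. hausdorff n (R (j + k)))"
      by (intro add_left_mono hausdorff_UN)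
    finally have 1: "hausdorff n (A - F) \<le> hausdorff n (B k) + (\<Sum>j. hausdorff n (R (j + k)))" .
    have sep: "1 / real (Suc k) \<le> dist a b" if "a \<in> A \<inter> F" "b \<in> B k" for a b
      using f_le[of b a] f0[of a] that by (auto simp: B_def dist_commute)
    have "hausdorff n (A \<inter> F) + hausdorff n (B k) \<le> hausdorff n (A \<inter> F \<union> B k)"
      by (rule hausdorff_add_separated[OF _ sep]) auto
    also have "\<dots> \<le> hausdorff n A" by (rule hausdorff_mono) (auto simp: B_def)
    finally have 2: "hausdorff n (A \<inter> F) + hausdorff n (B k) \<le> hausdorff n A" .
    have "hausdorff n (A \<inter> F) + hausdorff n (A - F)
        \<le> hausdorff n (A \<inter> F) + (hausdorff n (B k) + (\<Sum>j. hausdorff n (R (j + k))))"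
      by (intro add_left_mono 1)
    also have "\<dots> = (hausdorff n (A \<inter> F) + hausdorff n (B k)) + (\<Sum>j. hausdorff n (R (j + k)))"
      by (simp add: add.assoc)
    also have "\<dots> \<le> hausdorff n A + (\<Sum>j. hausdorff n (R (j + k)))"
      by (intro add_right_mono 2)
    finally show ?thesis .
  qed
  have "(\<lambda>k. hausdorff n A + (\<Sum>j. hausdorff n (R (j + k)))) \<longlonglongrightarrow> hausdorff n A + 0"
    by (intro tendsto_add tendsto_const tail0)
  then show ?thesis
    using step by (intro LIMSEQ_le_const[of _ "hausdorff n A"]) auto
qed

text \<open>The sets that split every set additively form a sigma-algebra on which an outer measure
  is countably additive. It contains the closed sets by \<open>hausdorff_split_closed\<close>, hence
  all Borel sets.\<close>

lemma measure_space_hausdorff: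
  "measure_space UNIV (sets (borel :: 'a::metric_space measure)) (hausdorff n)"
proof -
  interpret sigma_algebra UNIV "Pow (UNIV :: 'a set)" by (rule sigma_algebra_Pow)
  define L where "L = lambda_system (UNIV :: 'a set) (Pow UNIV) (hausdorff n)"
  have oms: "outer_measure_space (Pow UNIV) (hausdorff n :: 'a set \<Rightarrow> ennreal)"
    unfolding outer_measure_space_def positive_def increasing_def countably_subadditive_def
    by (auto intro: hausdorff_mono hausdorff_UN)
  have ms: "measure_space UNIV L (hausdorff n)"
    unfolding L_def by (rule caratheodory_lemma[OF oms])
  have cl: "F \<in> L" if "closed F" for F
  proof -
    have "hausdorff n (x \<inter> F) + hausdorff n (x - F) = hausdorff n x" for x
      using hausdorff_split_closed[OF that, of n x] hausdorff_Un[of n "x \<inter> F" "x - F"]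
      by (simp add: Int_Diff_Un antisym)
    then show ?thesis unfolding L_def lambda_system_eq by auto
  qed
  have sigL: "sigma_algebra UNIV L" using ms by (simp add: measure_space_def)
  have "sets (borel :: 'a measure) \<subseteq> L"
    unfolding borel_eq_closed
    using cl sigma_algebra.sigma_sets_subset[OF sigL, of "Collect closed"] by auto
  then show ?thesis
    using ms sets.sigma_algebra_axioms[of "borel :: 'a measure"]
    by (auto simp: measure_space_def positive_def countably_additive_def)
qed

lemma sets_hausdorff_measure [simp, measurable_cong]:
  "sets (hausdorff_measure n) = sets (borel :: 'a::metric_space measure)"
proof -
  have "sigma_sets UNIV (sets borel) = sets (borel :: 'a measure)"
    using sets.sigma_sets_eq[of "borel :: 'a measure"] by simp
  then show ?thesis
    unfolding hausdorff_measure_def by simp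
qed

lemma space_hausdorff_measure [simp]: "space (hausdorff_measure n) = UNIV"
  unfolding hausdorff_measure_def by (simp add: space_measure_of_conv)

text \<open>\<open>measure_of\<close> falls back to the zero measure unless its arguments form a
  measure space, so the value on a Borel set rests on
  \<open>measure_space_hausdorff\<close>.\<close>

lemma emeasure_hausdorff_measure:
  assumes "A \<in> sets (borel :: 'a::metric_space measure)"
  shows "emeasure (hausdorff_measure n) A = hausdorff n A"
proof -
  have "sigma_algebra UNIV (sets (borel :: 'a measure))"
    using sets.sigma_algebra_axioms[of "borel :: 'a measure"] by simp
  then show ?thesis
    unfolding hausdorff_measure_def
    using measure_space_hausdorff[of n, where 'a='a] assms
    by (intro emeasure_measure_of_sigma) (auto simp: measure_space_def)
qed

section \<open>Coverings and upper densities\<close>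

text \<open>The 5r-covering lemma. Balls are pairs of centre and radius, since in a general metric
  space the point set determines neither.\<close>

lemma vitali_cball:
  fixes J :: "('a::metric_space \<times> real) set"
  assumes J: "\<And>p. p \<in> J \<Longrightarrow> 0 < snd p" "\<And>p. p \<in> J \<Longrightarrow> snd p \<le> B"
  obtains F where "F \<subseteq> J"
    "\<And>p q. p \<in> F \<Longrightarrow> q \<in> F \<Longrightarrow> p \<noteq> q \<Longrightarrow> cball (fst p) (snd p) \<inter> cball (fst q) (snd q) = {}"
    "\<And>p. p \<in> J \<Longrightarrow> \<exists>q\<in>F. cball (fst p) (snd p) \<subseteq> cball (fst q) (5 * snd q)"
proof -
  define cb where "cb p = cball (fst p) (snd p)" for p :: "'a \<times> real"
  \<comment> \<open>Zorn's lemma runs over disjoint families with a further property: a ball of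
    \<open>J\<close> that meets the family meets a member of at least half its radius. Such a
    member, enlarged five times, contains it.\<close>
  define \<F> where "\<F> = {F. F \<subseteq> J \<and> (\<forall>p\<in>F. \<forall>q\<in>F. p \<noteq> q \<longrightarrow> cb p \<inter> cb q = {}) \<and>
     (\<forall>j\<in>J. (\<forall>f\<in>F. cb j \<inter> cb f = {}) \<or> (\<exists>f\<in>F. cb j \<inter> cb f \<noteq> {} \<and> snd j \<le> 2 * snd f))}"
  have "\<exists>F\<in>\<F>. \<forall>X\<in>\<F>. F \<subseteq> X \<longrightarrow> X = F"
  proof (rule subset_Zorn')
    fix C assume C: "subset.chain \<F> C"
    have CF: "c \<in> \<F>" if "c \<in> C" for c
      using C that by (auto simp: subset.chain_def)
    have lin: "c \<subseteq> d \<or> d \<subseteq> c" if "c \<in> C" "d \<in> C" for c d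
      using C that by (auto simp: subset_chain_def)
    show "\<Union>C \<in> \<F>"
      unfolding \<F>_def
    proof (intro CollectI conjI ballI impI)
      show "\<Union>C \<subseteq> J" using CF unfolding \<F>_def by blast
    next
      fix p q assume pq: "p \<in> \<Union>C" "q \<in> \<Union>C" "p \<noteq> q"
      from pq(1,2) obtain c1 c2 where "c1 \<in> C" "p \<in> c1" "c2 \<in> C" "q \<in> c2" by blast
      then obtain c where "c \<in> C" "p \<in> c" "q \<in> c"
        using lin[of c1 c2] by blast
      then show "cb p \<inter> cb q = {}" using CF[of c] pq(3) by (auto simp: \<F>_def)
    next
      fix j assume "j \<in> J"
      show "(\<forall>f\<in>\<Union>C. cb j \<inter> cb f = {}) \<or> (\<exists>f\<in>\<Union>C. cb j \<inter> cb f \<noteq> {} \<and> snd j \<le> 2 * snd f)"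
      proof (cases "\<forall>f\<in>\<Union>C. cb j \<inter> cb f = {}")
        case False
        then obtain f c where "c \<in> C" "f \<in> c" "cb j \<inter> cb f \<noteq> {}" by blast
        then have "\<exists>f\<in>c. cb j \<inter> cb f \<noteq> {} \<and> snd j \<le> 2 * snd f"
          using CF[of c] \<open>j \<in> J\<close> unfolding \<F>_def by blast
        then show ?thesis using \<open>c \<in> C\<close> by blast
      qed simp
    qed
  qed
  then obtain F where F: "F \<in> \<F>" and maxF: "\<And>X. X \<in> \<F> \<Longrightarrow> F \<subseteq> X \<Longrightarrow> X = F" by blast
  have hit: "\<exists>f\<in>F. cb j \<inter> cb f \<noteq> {}" if "j \<in> J" for j
  proof (rule ccontr)
    assume no: "\<not> ?thesis"
    \<comment> \<open>If some ball missed all of \<open>F\<close>, one of more than half the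
      supremal radius among such balls could be added to \<open>F\<close>: every other such ball has
      at most twice its radius, so the extended family keeps the property.\<close>
    define D where "D = {i\<in>J. \<forall>f\<in>F. cb i \<inter> cb f = {}}"
    have "D \<noteq> {}" using no that unfolding D_def by blast
    have bdd: "bdd_above (snd ` D)" using J(2) by (intro bdd_aboveI[where M = B]) (auto simp: D_def)
    have "0 < snd j" using J(1) that by blast
    then have S: "0 < (SUP i\<in>D. snd i)"
      using no that by (intro less_le_trans[OF _ cSUP_upper[OF _ bdd, of j]]) (auto simp: D_def)
    then have "(SUP i\<in>D. snd i) / 2 < (SUP i\<in>D. snd i)" by simp
    then obtain k where k: "k \<in> D" "(SUP i\<in>D. snd i) / 2 < snd k"
      using less_cSUP_iff[OF \<open>D \<noteq> {}\<close> bdd] by blast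
    have "insert k F \<in> \<F>"
      unfolding \<F>_def
    proof (intro CollectI conjI ballI impI)
      show "insert k F \<subseteq> J" using k F by (auto simp: D_def \<F>_def)
    next
      fix p q assume "p \<in> insert k F" "q \<in> insert k F" "p \<noteq> q"
      then show "cb p \<inter> cb q = {}"
      proof (elim insertE)
        show "cb p \<inter> cb q = {}" if "p = k" "q \<in> F" using that k(1) by (simp add: D_def)
        show "cb p \<inter> cb q = {}" if "p \<in> F" "q = k" using that k(1) unfolding D_def by blast
        show "cb p \<inter> cb q = {}" if "p \<in> F" "q \<in> F"
          using that \<open>p \<noteq> q\<close> F unfolding \<F>_def by blast
      qed simp
    next
      fix i assume "i \<in> J"
      show "(\<forall>f\<in>insert k F. cb i \<inter> cb f = {}) \<or>
          (\<exists>f\<in>insert k F. cb i \<inter> cb f \<noteq> {} \<and> snd i \<le> 2 * snd f)"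
      proof (cases "i \<in> D")
        case True
        then have "snd i \<le> (SUP i\<in>D. snd i)" by (intro cSUP_upper bdd)
        then show ?thesis using k True by (auto simp: D_def)
      next
        case False
        then show ?thesis using \<open>i \<in> J\<close> F unfolding D_def \<F>_def by blast
      qed
    qed
    then have "k \<in> F" using maxF[of "insert k F"] by blast
    moreover have "cb k \<noteq> {}" using J(1)[of k] k by (auto simp: cb_def D_def)
    ultimately show False using k by (auto simp: D_def)
  qed
  show ?thesis
  proof (rule that[of F])
    show "F \<subseteq> J" using F by (auto simp: \<F>_def)
    show "cball (fst p) (snd p) \<inter> cball (fst q) (snd q) = {}" if "p \<in> F" "q \<in> F" "p \<noteq> q" for p q
      using F that unfolding \<F>_def cb_def by blast
    fix p assume p: "p \<in> J"
    then obtain f where f: "f \<in> F" "cb p \<inter> cb f \<noteq> {}" "snd p \<le> 2 * snd f"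
      using hit[of p] F unfolding \<F>_def by blast
    then obtain z where z: "dist (fst p) z \<le> snd p" "dist (fst f) z \<le> snd f" by (auto simp: cb_def)
    have "cball (fst p) (snd p) \<subseteq> cball (fst f) (5 * snd f)"
    proof
      fix y assume "y \<in> cball (fst p) (snd p)"
      then have "dist (fst p) y \<le> snd p" by simp
      moreover have "dist (fst f) y \<le> dist (fst f) z + dist (fst p) z + dist (fst p) y"
        using dist_triangle[of "fst f" y z] dist_triangle2[of z y "fst p"] 
        by (smt (verit) dist_commute dist_triangle)
      ultimately show "y \<in> cball (fst f) (5 * snd f)" using z f by simp
    qed
    then show "\<exists>q\<in>F. cball (fst p) (snd p) \<subseteq> cball (fst q) (5 * snd q)" using f by blast
  qed
qed

lemma diameter_cball_le:
  fixes x :: "'a::metric_space"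
  assumes "0 \<le> r"
  shows "diameter (cball x r) \<le> 2 * r"
proof -
  have *: "dist a b \<le> 2 * r" if "a \<in> cball x r" "b \<in> cball x r" for a b
    using that dist_triangle2[of a b x] by (simp add: dist_commute)
  have False if "2 * r < diameter (cball x r)"
  proof -
    have "0 < (2 * r + diameter (cball x r)) / 2" "(2 * r + diameter (cball x r)) / 2 < diameter (cball x r)"
      using that assms by simp_all
    then obtain a b where "a \<in> cball x r" "b \<in> cball x r" "(2 * r + diameter (cball x r)) / 2 < dist a b"
      using diameter_bounded(2)[of "cball x r"] by blast
    with * that show False by force
  qed
  then show ?thesis by fastforce
qed

text \<open>The enlarged balls have diameter at most \<open>10 * snd p\<close>, which explains the
  factor \<open>5 ^ n\<close> and the condition on \<open>\<delta>\<close>.\<close>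

lemma hausdorff_delta_le_packing:
  fixes F :: "('a::metric_space \<times> real) set"
  assumes "n > 0"
    and F: "\<And>p. p \<in> F \<Longrightarrow> 0 < snd p" "\<And>p. p \<in> F \<Longrightarrow> 10 * snd p \<le> \<delta>" and "0 \<le> \<delta>"
    and cover: "E \<subseteq> (\<Union>p\<in>F. cball (fst p) (5 * snd p))"
    and sum: "\<And>F'. finite F' \<Longrightarrow> F' \<subseteq> F \<Longrightarrow> (\<Sum>p\<in>F'. snd p ^ n) \<le> K"
  shows "hausdorff_delta n \<delta> E \<le> ennreal (unit_ball_vol (real n) * 5 ^ n * K)"
proof -
  \<comment> \<open>Positive terms with bounded finite sums are countably many; this yields an
    enumeration of the balls without separability of the space.\<close>
  have "(\<lambda>p. snd p ^ n) summable_on F"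
  proof (rule nonneg_bdd_above_summable_on)
    show "bdd_above (sum (\<lambda>p. snd p ^ n) ` {F'. F' \<subseteq> F \<and> finite F'})"
      using sum by (intro bdd_aboveI[where M = K]) blast
  qed (use F(1) in \<open>simp add: less_imp_le\<close>)
  then have "countable {p\<in>F. snd p ^ n \<noteq> 0}" by (rule summable_countable_real)
  moreover have "{p\<in>F. snd p ^ n \<noteq> 0} = F" using F(1) by force
  ultimately have cF: "countable F" by simp
  define e where "e = to_nat_on F"
  have inj: "inj_on e F" unfolding e_def using cF by (rule inj_on_to_nat_on)
  define g where "g = inv_into F e"
  define C where "C i = (if i \<in> e ` F then cball (fst (g i)) (5 * snd (g i)) else {})" for i
  have gF: "g i \<in> F" if "i \<in> e ` F" for i using that by (auto simp: g_def inv_into_into)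
  have diam: "diameter (C i) \<le> 10 * snd (g i)" if "i \<in> e ` F" for i
    using diameter_cball_le[of "5 * snd (g i)" "fst (g i)"] F(1)[OF gF[OF that]] that by (auto simp: C_def)
  have "E \<subseteq> (\<Union>i. C i)"
  proof
    fix x assume "x \<in> E"
    then obtain p where p: "p \<in> F" "x \<in> cball (fst p) (5 * snd p)" using cover by blast
    then have "x \<in> C (e p)" using inj by (simp add: C_def g_def)
    then show "x \<in> (\<Union>i. C i)" by blast
  qed
  then have "hausdorff_delta n \<delta> E \<le> (\<Sum>i. gauge_cost n (C i))"
  proof (rule hausdorff_delta_le)
    show "bounded (C i)" for i by (simp add: C_def)
    show "diameter (C i) \<le> \<delta>" for i
    proof (cases "i \<in> e ` F")
      case True
      then show ?thesis using diam[OF True] F(2)[OF gF[OF True]] by simp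
    qed (use \<open>0 \<le> \<delta>\<close> in \<open>auto simp: C_def\<close>)
  qed
  also have "\<dots> \<le> ennreal (unit_ball_vol (real n) * 5 ^ n * K)"
  proof (rule suminf_le_const)
    fix N
    define I where "I = {i. i < N \<and> i \<in> e ` F}"
    have "inj_on g I" unfolding g_def I_def by (rule inj_on_subset[OF inj_on_inv_into[of "e ` F"]]) auto
    have "(\<Sum>i<N. gauge_cost n (C i)) = (\<Sum>i\<in>I. gauge_cost n (C i))"
      by (rule sum.mono_neutral_right) (auto simp: I_def C_def)
    also have "\<dots> \<le> (\<Sum>i\<in>I. ennreal (unit_ball_vol (real n) * 5 ^ n * snd (g i) ^ n))"
    proof (rule sum_mono)
      fix i assume i: "i \<in> I"
      then have "i \<in> e ` F" by (simp add: I_def)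
      have "0 \<le> diameter (C i)" by (intro diameter_ge_0) (simp add: C_def)
      then have "(diameter (C i) / 2) ^ n \<le> (5 * snd (g i)) ^ n"
        using diam[OF \<open>i \<in> e ` F\<close>] by (intro power_mono) auto
      then show "gauge_cost n (C i) \<le> ennreal (unit_ball_vol (real n) * 5 ^ n * snd (g i) ^ n)"
        unfolding gauge_cost_def
        by (auto intro!: ennreal_leI mult_left_mono simp: mult.assoc power_mult_distrib)
    qed
    also have "\<dots> = ennreal (\<Sum>i\<in>I. unit_ball_vol (real n) * 5 ^ n * snd (g i) ^ n)"
      using F(1) gF 
      by (intro sum_ennreal mult_nonneg_nonneg zero_le_power less_imp_le[OF F(1)] gF) (auto simp: I_def)
    also have "(\<Sum>i\<in>I. unit_ball_vol (real n) * 5 ^ n * snd (g i) ^ n) =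
        unit_ball_vol (real n) * 5 ^ n * (\<Sum>p\<in>g ` I. snd p ^ n)"
      using \<open>inj_on g I\<close> by (simp add: sum.reindex sum_distrib_left)
    also have "\<dots> \<le> unit_ball_vol (real n) * 5 ^ n * K"
      using gF by (intro mult_left_mono sum) (auto simp: I_def)
    finally show "(\<Sum>i<N. gauge_cost n (C i)) \<le> ennreal (unit_ball_vol (real n) * 5 ^ n * K)"
      by (simp add: ennreal_leI)
  qed auto
  finally show ?thesis .
qed

text \<open>Disjoint balls whose preimages have mass above \<open>t * r\<^sup>2\<close> and lie in a
  set of mass \<open>e\<close> have \<open>e / t\<close> as a bound for the sum of their
  \<open>r\<^sup>2\<close>; Vitali's lemma turns this into a bound for the content. The hypothesis
  \<open>small\<close> plays the part of outer regularity, phrased so that the preimages of small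
  balls around points of \<open>E\<close> fit into a set of small mass.\<close>

lemma hausdorff_upper_density_null:
  fixes m :: "'b measure" and h :: "'b \<Rightarrow> 'x::metric_space"
  assumes meas: "\<And>x r. h -` cball x r \<inter> space m \<in> sets m"
    and small: "\<And>e. 0 < e \<Longrightarrow> \<exists>U\<in>sets m. emeasure m U \<le> ennreal e \<and>
                  (\<forall>x\<in>E. \<exists>r>0. h -` cball x r \<inter> space m \<subseteq> U)"
    and "0 < t"
  shows "hausdorff 2 {x\<in>E. \<forall>r0>0. \<exists>r. 0 < r \<and> r < r0 \<and>
            ennreal (t * r\<^sup>2) < emeasure m (h -` cball x r \<inter> space m)} = 0"
    (is "hausdorff 2 ?Z = 0")
proof (rule hausdorff_eq_0I)
  fix \<delta> :: real assume "0 < \<delta>"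
  define P where "P x r = h -` cball x r \<inter> space m" for x r
  have "hausdorff_delta 2 \<delta> ?Z \<le> ennreal (unit_ball_vol (real 2) * 5 ^ 2 * (e / t))" if "0 < e" for e
  proof -
    obtain U where U: "U \<in> sets m" "emeasure m U \<le> ennreal e"
        "\<And>x. x \<in> E \<Longrightarrow> \<exists>r>0. P x r \<subseteq> U"
      using small[OF \<open>0 < e\<close>] unfolding P_def by blast
    define J where "J = {p. fst p \<in> ?Z \<and> 0 < snd p \<and> 10 * snd p \<le> \<delta> \<and>
        P (fst p) (snd p) \<subseteq> U \<and> ennreal (t * (snd p)\<^sup>2) < emeasure m (P (fst p) (snd p))}"
    obtain F where F: "F \<subseteq> J"
      "\<And>p q. p \<in> F \<Longrightarrow> q \<in> F \<Longrightarrow> p \<noteq> q \<Longrightarrow> cball (fst p) (snd p) \<inter> cball (fst q) (snd q) = {}"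
      "\<And>p. p \<in> J \<Longrightarrow> \<exists>q\<in>F. cball (fst p) (snd p) \<subseteq> cball (fst q) (5 * snd q)"
    proof (rule vitali_cball[of J "\<delta> / 10"])
      show "0 < snd p" "snd p \<le> \<delta> / 10" if "p \<in> J" for p
        using that by (simp_all add: J_def)
    qed blast
    show ?thesis
    proof (rule hausdorff_delta_le_packing[where F = F])
      show "0 < snd p" "10 * snd p \<le> \<delta>" if "p \<in> F" for p
        using that F(1) by (auto simp: J_def)
      show "?Z \<subseteq> (\<Union>p\<in>F. cball (fst p) (5 * snd p))"
      proof
        fix x assume x: "x \<in> ?Z"
        then obtain r1 where r1: "0 < r1" "P x r1 \<subseteq> U" using U(3) by blast
        have "0 < min r1 (\<delta> / 10)" using r1 \<open>0 < \<delta>\<close> by simp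
        then obtain r where r: "0 < r" "r < min r1 (\<delta> / 10)" "ennreal (t * r\<^sup>2) < emeasure m (P x r)"
          using x unfolding P_def by blast
        have "P x r \<subseteq> U" using r1 r(2) unfolding P_def by fastforce
        then have "(x, r) \<in> J" using r x by (auto simp: J_def)
        from F(3)[OF this] obtain q where "q \<in> F" "cball x r \<subseteq> cball (fst q) (5 * snd q)" by auto
        then show "x \<in> (\<Union>p\<in>F. cball (fst p) (5 * snd p))" using r(1) by force
      qed
      fix F' assume F': "finite F'" "F' \<subseteq> F"
      have "ennreal (t * (\<Sum>p\<in>F'. (snd p)\<^sup>2)) = (\<Sum>p\<in>F'. ennreal (t * (snd p)\<^sup>2))"
        using \<open>0 < t\<close> by (simp add: sum_distrib_left)
      also have "\<dots> \<le> (\<Sum>p\<in>F'. emeasure m (P (fst p) (snd p)))"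
        using F' F(1) by (intro sum_mono) (auto simp: J_def less_imp_le)
      also have "\<dots> = emeasure m (\<Union>p\<in>F'. P (fst p) (snd p))"
      proof (rule sum_emeasure)
        show "disjoint_family_on (\<lambda>p. P (fst p) (snd p)) F'"
          using F(2) F'(2) unfolding disjoint_family_on_def P_def by blast
      qed (use F' meas in \<open>auto simp: P_def\<close>)
      also have "\<dots> \<le> emeasure m U"
        using F' F(1) U(1) by (intro emeasure_mono) (auto simp: J_def)
      also have "\<dots> \<le> ennreal e" by fact
      finally have "t * (\<Sum>p\<in>F'. (snd p)\<^sup>2) \<le> e" using \<open>0 < e\<close> by simp
      then show "(\<Sum>p\<in>F'. (snd p)\<^sup>2) \<le> e / t" using \<open>0 < t\<close> by (simp add: field_simps)
    qed (use \<open>0 < \<delta>\<close> in auto)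
  qed
  note bound = this
  have "hausdorff_delta 2 \<delta> ?Z \<le> 0 + ennreal e" if "0 < e" for e
  proof -
    define v where "v = unit_ball_vol (real 2)"
    have "0 < v" by (simp add: v_def)
    then have "0 < e * t / (v * 5 ^ 2)" using that \<open>0 < t\<close> by simp
    from bound[OF this] have "hausdorff_delta 2 \<delta> ?Z \<le> ennreal (v * 5 ^ 2 * (e * t / (v * 5 ^ 2) / t))"
      by (simp only: v_def)
    also have "v * 5 ^ 2 * (e * t / (v * 5 ^ 2) / t) = e" using \<open>0 < t\<close> \<open>0 < v\<close> by simp
    finally show ?thesis by simp
  qed
  then have "hausdorff_delta 2 \<delta> ?Z \<le> 0" by (rule ennreal_le_epsilon)
  then show "hausdorff_delta 2 \<delta> ?Z = 0" by simp
qed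

section \<open>Lengths of curves\<close>

text \<open>Recursive form of the sum in \<open>curve_length\<close>, suited to induction over
  partitions.\<close>

fun chain_length :: "(real \<Rightarrow> 'a::metric_space) \<Rightarrow> real list \<Rightarrow> real" where
  "chain_length \<gamma> (s # t # ts) = dist (\<gamma> s) (\<gamma> t) + chain_length \<gamma> (t # ts)"
| "chain_length \<gamma> _ = 0"

lemma chain_length_nonneg: "0 \<le> chain_length \<gamma> ts"
  by (induction \<gamma> ts rule: chain_length.induct) auto

lemma sum_nth_eq_chain_length:
  "(\<Sum>i<length ts - 1. ennreal (dist (\<gamma> (ts ! i)) (\<gamma> (ts ! Suc i)))) = ennreal (chain_length \<gamma> ts)"
proof (induction \<gamma> ts rule: chain_length.induct)
  case (1 \<gamma> s t ts)
  have "(\<Sum>i<length (s # t # ts) - 1. ennreal (dist (\<gamma> ((s # t # ts) ! i)) (\<gamma> ((s # t # ts) ! Suc i))))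
      = ennreal (dist (\<gamma> s) (\<gamma> t)) +
        (\<Sum>i<length (t # ts) - 1. ennreal (dist (\<gamma> ((t # ts) ! i)) (\<gamma> ((t # ts) ! Suc i))))"
    by (simp add: sum.lessThan_Suc_shift del: sum.lessThan_Suc)
  then show ?case unfolding 1 by (simp only: chain_length.simps ennreal_plus[OF zero_le_dist chain_length_nonneg])
qed simp_all

lemma curve_length_eq_chain_length:
  "curve_length I \<gamma> = (SUP ts \<in> {ts. sorted ts \<and> set ts \<subseteq> I}. ennreal (chain_length \<gamma> ts))"
  unfolding curve_length_def sum_nth_eq_chain_length ..

lemma chain_length_le_curve_length:
  "sorted ts \<Longrightarrow> set ts \<subseteq> I \<Longrightarrow> ennreal (chain_length \<gamma> ts) \<le> curve_length I \<gamma>"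
  unfolding curve_length_eq_chain_length by (intro SUP_upper) auto

lemma curve_length_mono: "I \<subseteq> J \<Longrightarrow> curve_length I \<gamma> \<le> curve_length J \<gamma>"
  unfolding curve_length_eq_chain_length by (intro SUP_subset_mono) auto

lemma chain_length_snoc: "chain_length \<gamma> (ts @ [s, t]) = chain_length \<gamma> (ts @ [s]) + dist (\<gamma> s) (\<gamma> t)"
  by (induction \<gamma> ts rule: chain_length.induct) auto

lemma chain_length_le_snoc: "chain_length \<gamma> ts \<le> chain_length \<gamma> (ts @ [s])"
  by (induction \<gamma> ts rule: chain_length.induct) auto

lemma chain_length_le_Cons: "chain_length \<gamma> ts \<le> chain_length \<gamma> (t # ts)"
  by (cases ts) auto

lemma chain_length_append_le:
  "chain_length \<gamma> (ss @ ts) \<le> chain_length \<gamma> (ss @ [s]) + chain_length \<gamma> (s # ts)"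
proof (induction \<gamma> ss rule: chain_length.induct)
  case ("2_1" \<gamma>)
  then show ?case using chain_length_le_Cons[of \<gamma> ts s] by simp
next
  case ("2_2" \<gamma> u)
  show ?case
  proof (cases ts)
    case (Cons v vs)
    then show ?thesis using dist_triangle[of "\<gamma> u" "\<gamma> v" "\<gamma> s"] by simp
  qed simp
qed simp_all

lemma chain_length_le_increment:
  assumes "\<And>t t'. t \<in> I \<Longrightarrow> t' \<in> I \<Longrightarrow> t \<le> t' \<Longrightarrow> dist (\<gamma> t) (\<gamma> t') \<le> s t' - s t"
    and "sorted ts" "set ts \<subseteq> I" "ts \<noteq> []"
  shows "chain_length \<gamma> ts \<le> s (last ts) - s (hd ts)"
  using assms
proof (induction \<gamma> ts rule: chain_length.induct)
  case (1 \<gamma> t u ts)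
  have "dist (\<gamma> t) (\<gamma> u) \<le> s u - s t" using "1.prems"(2,3) by (intro "1.prems"(1)) simp_all
  moreover have "chain_length \<gamma> (u # ts) \<le> s (last (u # ts)) - s (hd (u # ts))"
    using "1.prems" by (intro "1.IH") simp_all
  ultimately show ?case by simp
qed simp_all

lemma curve_length_add_dist:
  assumes "a \<le> t" "t \<le> t'"
  shows "curve_length {a..t} \<gamma> + ennreal (dist (\<gamma> t) (\<gamma> t')) \<le> curve_length {a..t'} \<gamma>"
proof -
  have "curve_length {a..t} \<gamma> + ennreal (dist (\<gamma> t) (\<gamma> t')) =
      (SUP ts \<in> {ts. sorted ts \<and> set ts \<subseteq> {a..t}}. ennreal (chain_length \<gamma> ts) + ennreal (dist (\<gamma> t) (\<gamma> t')))"
    unfolding curve_length_eq_chain_length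
    by (rule ennreal_SUP_add_left[symmetric]) (auto intro!: exI[of _ "[]"])
  also have "\<dots> \<le> curve_length {a..t'} \<gamma>"
  proof (rule SUP_least)
    fix ts assume "ts \<in> {ts. sorted ts \<and> set ts \<subseteq> {a..t}}"
    then have ts: "sorted ts" "set ts \<subseteq> {a..t}" by auto
    have "ennreal (chain_length \<gamma> ts) + ennreal (dist (\<gamma> t) (\<gamma> t')) = ennreal (chain_length \<gamma> ts + dist (\<gamma> t) (\<gamma> t'))"
      by (simp add: chain_length_nonneg)
    also have "\<dots> \<le> ennreal (chain_length \<gamma> (ts @ [t, t']))"
      using chain_length_le_snoc[of \<gamma> ts t] by (intro ennreal_leI) (simp add: chain_length_snoc)
    also have "\<dots> \<le> curve_length {a..t'} \<gamma>"
    proof (rule chain_length_le_curve_length)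
      show "sorted (ts @ [t, t'])" "set (ts @ [t, t']) \<subseteq> {a..t'}"
        using ts assms by (force simp: sorted_append)+
    qed
    finally show "ennreal (chain_length \<gamma> ts) + ennreal (dist (\<gamma> t) (\<gamma> t')) \<le> curve_length {a..t'} \<gamma>" .
  qed
  finally show ?thesis .
qed

text \<open>In terms of arc length a curve is 1-Lipschitz. This comes from superadditivity of the
  length, obtained by appending \<open>t\<close> and \<open>t'\<close> to the partitions of
  \<open>{a..t}\<close>.\<close>

lemma dist_le_curve_length_diff:
  assumes "a \<le> t" "t \<le> t'" and fin: "curve_length {a..t'} \<gamma> < \<infinity>"
  shows "dist (\<gamma> t) (\<gamma> t') \<le> enn2real (curve_length {a..t'} \<gamma>) - enn2real (curve_length {a..t} \<gamma>)"
proof -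
  define s where "s t = enn2real (curve_length {a..t} \<gamma>)" for t
  have s0: "0 \<le> s t" for t by (simp add: s_def)
  have "curve_length {a..t} \<gamma> < \<infinity>"
    using le_less_trans[OF curve_length_mono fin, of "{a..t}"] assms(2) by auto
  then have "ennreal (s t + dist (\<gamma> t) (\<gamma> t')) = curve_length {a..t} \<gamma> + ennreal (dist (\<gamma> t) (\<gamma> t'))"
    by (subst ennreal_plus) (simp_all add: s_def)
  also have "\<dots> \<le> curve_length {a..t'} \<gamma>" by (rule curve_length_add_dist[OF assms(1,2)])
  also have "\<dots> = ennreal (s t')" using fin by (simp add: s_def)
  finally have "s t + dist (\<gamma> t) (\<gamma> t') \<le> s t'" by (subst (asm) ennreal_le_iff) (rule s0)
  then show ?thesis by (simp add: s_def)
qed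

text \<open>A partition is cut at \<open>t\<close>, the point \<open>t\<close> is inserted on both
  sides of the cut, and the sum over the right part telescopes against
  \<open>C * (t' - t)\<close>.\<close>

lemma curve_length_extend_le:
  assumes "\<And>s s'. t \<le> s \<Longrightarrow> s \<le> s' \<Longrightarrow> s' \<le> t' \<Longrightarrow> dist (\<gamma> s) (\<gamma> s') \<le> C * (s' - s)"
    and "0 \<le> C" "a \<le> t" "t \<le> t'"
  shows "curve_length {a..t'} \<gamma> \<le> curve_length {a..t} \<gamma> + ennreal (C * (t' - t))"
  unfolding curve_length_eq_chain_length[of "{a..t'}"]
proof (rule SUP_least)
  fix ts assume "ts \<in> {ts. sorted ts \<and> set ts \<subseteq> {a..t'}}"
  then have ts: "sorted ts" "set ts \<subseteq> {a..t'}" by auto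
  define xs where "xs = takeWhile (\<lambda>x. x \<le> t) ts"
  define ys where "ys = dropWhile (\<lambda>x. x \<le> t) ts"
  have eq: "ts = xs @ ys" by (simp add: xs_def ys_def)
  have xs: "x \<le> t" if "x \<in> set xs" for x using that set_takeWhileD unfolding xs_def by metis
  have sorted: "sorted xs" "sorted ys" using ts(1) by (simp_all add: eq sorted_append)
  have ys: "t \<le> y" if "y \<in> set ys" for y
  proof -
    have "ys \<noteq> []" using that by auto
    then have "\<not> hd ys \<le> t" unfolding ys_def by (rule hd_dropWhile)
    moreover have "hd ys \<le> y" using sorted(2) that by (cases ys) auto
    ultimately show ?thesis by simp
  qed
  have "chain_length \<gamma> (t # ys) \<le> C * last (t # ys) - C * hd (t # ys)"
  proof (rule chain_length_le_increment[where I = "{t..t'}"])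
    show "dist (\<gamma> s) (\<gamma> s') \<le> C * s' - C * s" if "s \<in> {t..t'}" "s' \<in> {t..t'}" "s \<le> s'" for s s'
      using assms(1)[of s s'] that by (simp add: right_diff_distrib)
    show "sorted (t # ys)" using sorted(2) ys by simp
    show "set (t # ys) \<subseteq> {t..t'}" using ys ts(2) assms(4) by (auto simp: eq)
  qed simp
  also have "\<dots> \<le> C * (t' - t)"
  proof -
    have "last (t # ys) \<in> insert t (set ys)" using last_in_set[of "t # ys"] by simp
    then have "last (t # ys) \<le> t'" using ts(2) assms(4) unfolding eq by auto
    then show ?thesis using \<open>0 \<le> C\<close> by (simp add: right_diff_distrib mult_left_mono)
  qed
  finally have 1: "chain_length \<gamma> (t # ys) \<le> C * (t' - t)" .
  have "ennreal (chain_length \<gamma> ts) \<le> ennreal (chain_length \<gamma> (xs @ [t]) + C * (t' - t))"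
    using chain_length_append_le[of \<gamma> xs ys t] 1 by (intro ennreal_leI) (simp add: eq)
  also have "\<dots> = ennreal (chain_length \<gamma> (xs @ [t])) + ennreal (C * (t' - t))"
    using assms by (intro ennreal_plus) (simp_all add: chain_length_nonneg)
  also have "ennreal (chain_length \<gamma> (xs @ [t])) \<le> curve_length {a..t} \<gamma>"
  proof (rule chain_length_le_curve_length)
    show "sorted (xs @ [t])" using sorted(1) xs by (simp add: sorted_append)
    show "set (xs @ [t]) \<subseteq> {a..t}" using xs ts(2) assms(3) by (auto simp: eq)
  qed
  finally show "ennreal (chain_length \<gamma> ts) \<le> curve_length {a..t} \<gamma> + ennreal (C * (t' - t))"
    by (simp add: add_right_mono)
qed

text \<open>Two continua through \<open>x\<close> that leave \<open>x\<close> in quantitatively different directions. At \<open>\<H>\<^sup>1\<close>-almost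
  every point of a rectifiable curve the two halves of the curve have this property.\<close>

definition two_sided :: "'a::metric_space \<Rightarrow> bool" where
  "two_sided x \<longleftrightarrow> (\<exists>K L. connected K \<and> connected L \<and> x \<in> K \<and> x \<in> L \<and> K \<noteq> {x} \<and> L \<noteq> {x} \<and>
     (\<forall>p\<in>K. \<forall>q\<in>L. max (dist x p) (dist x q) \<le> 2 * dist p q))"

section \<open>Two-sidedness of almost every point of a rectifiable curve\<close>

lemma sum_increments_disjoint:
  fixes g :: "real \<Rightarrow> real"
  assumes "finite F" "\<And>s t. a \<le> s \<Longrightarrow> s \<le> t \<Longrightarrow> t \<le> b \<Longrightarrow> g s \<le> g t"
    and "\<And>p. p \<in> F \<Longrightarrow> a \<le> l p \<and> l p \<le> u p \<and> u p \<le> b"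
    and "\<And>p q. p \<in> F \<Longrightarrow> q \<in> F \<Longrightarrow> p \<noteq> q \<Longrightarrow> {l p..u p} \<inter> {l q..u q} = {}"
    and "a \<le> b"
  shows "(\<Sum>p\<in>F. g (u p) - g (l p)) \<le> g b - g a"
  using assms
proof (induction F arbitrary: b rule: finite_ranking_induct[where f = u])
  case empty
  then show ?case using empty.prems(1)[of a b] by simp
next
  case (insert p F)
  show ?case
  proof (cases "p \<in> F")
    case True
    then have "insert p F = F" by blast
    then show ?thesis using insert.IH[OF insert.prems(1)] insert.prems by simp
  next
    case False
    have lp: "a \<le> l p" "l p \<le> u p" "u p \<le> b" using insert.prems(2)[of p] by auto
    \<comment> \<open>\<open>p\<close> carries the largest right endpoint. All other intervals end
      before it begins, so the induction hypothesis applies on \<open>{a..l p}\<close>.\<close>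
    have "u q \<le> l p" if "q \<in> F" for q
    proof (rule ccontr)
      assume "\<not> u q \<le> l p"
      then have "u q \<in> {l p..u p} \<inter> {l q..u q}"
        using insert.hyps(2)[OF that] insert.prems(2)[of q] that by auto
      then show False using insert.prems(3)[of p q] that False by auto
    qed
    note uq = this
    have "(\<Sum>p\<in>F. g (u p) - g (l p)) \<le> g (l p) - g a"
    proof (rule insert.IH)
      show "g s \<le> g t" if "a \<le> s" "s \<le> t" "t \<le> l p" for s t
        using that lp by (intro insert.prems(1)) linarith+
      show "a \<le> l q \<and> l q \<le> u q \<and> u q \<le> l p" if "q \<in> F" for q
        using insert.prems(2)[of q] uq[of q] that by simp
      show "{l q..u q} \<inter> {l r..u r} = {}" if "q \<in> F" "r \<in> F" "q \<noteq> r" for q r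
        using that by (intro insert.prems(3)) simp_all
    qed (use lp in simp)
    moreover have "g (u p) \<le> g b" using lp by (intro insert.prems(1)) linarith+
    ultimately show ?thesis using False insert.hyps(1) by simp
  qed
qed

text \<open>With \<open>s\<close> as arc length, \<open>\<eta>\<close> is the excess of the length
  over the chord. If \<open>f\<close> is the distance from \<open>\<gamma> a\<close>, then
  \<open>g = s - f\<close> is nondecreasing with total increase \<open>\<eta>\<close>. Where
  \<open>g\<close> grows at most half as fast as \<open>s\<close> in both directions,
  \<open>f\<close> grows at least half as fast as \<open>s\<close>, which makes the point two-sided.
  Every other point is the centre of a ball whose radius is twice an increment of \<open>g\<close>,
  and disjoint balls come from disjoint parameter intervals. The constant is
  \<open>2 * 5 * 2\<close>: the length of the unit ball, Vitali's factor, and the factor between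
  radius and increment.\<close>

lemma hausdorff_delta_not_two_sided_le:
  fixes \<gamma> :: "real \<Rightarrow> 'a::metric_space"
  assumes "a \<le> b" "continuous_on {a..b} \<gamma>"
    and s: "\<And>t t'. a \<le> t \<Longrightarrow> t \<le> t' \<Longrightarrow> t' \<le> b \<Longrightarrow> dist (\<gamma> t) (\<gamma> t') \<le> s t' - s t"
    and \<eta>: "\<eta> = s b - s a - dist (\<gamma> a) (\<gamma> b)" "20 * \<eta> \<le> \<delta>"
  shows "hausdorff_delta 1 \<delta> (\<gamma> ` {a..b} - Collect two_sided - {\<gamma> a, \<gamma> b}) \<le> ennreal (20 * \<eta>)"
proof -
  define f where "f t = dist (\<gamma> a) (\<gamma> t)" for t
  define g where "g t = s t - f t" for t
  have f_le: "\<bar>f t' - f t\<bar> \<le> dist (\<gamma> t) (\<gamma> t')" for t t'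
    unfolding f_def using abs_dist_diff_le[of "\<gamma> t'" "\<gamma> a" "\<gamma> t"] by (simp add: dist_commute)
  have s_mono: "s t \<le> s t'" if "a \<le> t" "t \<le> t'" "t' \<le> b" for t t'
    using order_trans[OF zero_le_dist s[OF that]] by simp
  have g_mono: "g t \<le> g t'" if "a \<le> t" "t \<le> t'" "t' \<le> b" for t t'
    using s[OF that] f_le[of t' t] by (simp add: g_def)
  have "0 \<le> \<eta>" using s[of a b] assms(1) \<eta> by simp
  have g_tot: "g b - g a = \<eta>" by (simp add: g_def f_def \<eta>)
  \<comment> \<open>Balls centred at an end of a parameter interval on which \<open>s\<close>
    increases less than twice as much as \<open>g\<close>. The last condition puts the image of the
    whole interval into the ball.\<close>
  define J where "J = {p. \<exists>l u. a \<le> l \<and> l \<le> u \<and> u \<le> b \<and> fst p \<in> {\<gamma> l, \<gamma> u} \<and>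
      snd p = 2 * (g u - g l) \<and> s u - s l < snd p}"
  have J: "0 < snd p" "snd p \<le> 2 * \<eta>" if "p \<in> J" for p
  proof -
    obtain l u where lu: "a \<le> l" "l \<le> u" "u \<le> b" "snd p = 2 * (g u - g l)" "s u - s l < snd p"
      using \<open>p \<in> J\<close> unfolding J_def by blast
    show "0 < snd p" using lu(5) s[OF lu(1-3)] zero_le_dist[of "\<gamma> l" "\<gamma> u"] by linarith
    have "g a \<le> g l" "g u \<le> g b" using lu(1-3) by (auto intro: g_mono)
    then show "snd p \<le> 2 * \<eta>" unfolding lu(4) g_tot[symmetric] by simp
  qed
  have interval: "\<exists>l u. a \<le> l \<and> l \<le> u \<and> u \<le> b \<and> snd p = 2 * (g u - g l) \<and> \<gamma> ` {l..u} \<subseteq> cball (fst p) (snd p)"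
    if "p \<in> J" for p
  proof -
    obtain l u where lu: "a \<le> l" "l \<le> u" "u \<le> b" "fst p \<in> {\<gamma> l, \<gamma> u}" "snd p = 2 * (g u - g l)" "s u - s l < snd p"
      using \<open>p \<in> J\<close> unfolding J_def by blast
    have "dist (fst p) (\<gamma> t) \<le> snd p" if "t \<in> {l..u}" for t
    proof -
      have "dist (\<gamma> l) (\<gamma> t) \<le> s u - s l" "dist (\<gamma> t) (\<gamma> u) \<le> s u - s l"
        using s[of l t] s[of t u] s_mono[of l t] s_mono[of t u] lu(1-3) that by auto
      then show ?thesis using lu by (auto simp: dist_commute)
    qed
    then show ?thesis using lu by (intro exI[of _ l] exI[of _ u]) auto
  qed
  obtain F where F: "F \<subseteq> J"
      "\<And>p q. p \<in> F \<Longrightarrow> q \<in> F \<Longrightarrow> p \<noteq> q \<Longrightarrow> cball (fst p) (snd p) \<inter> cball (fst q) (snd q) = {}"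
      "\<And>p. p \<in> J \<Longrightarrow> \<exists>q\<in>F. cball (fst p) (snd p) \<subseteq> cball (fst q) (5 * snd q)"
    using vitali_cball[of J "2 * \<eta>"] J by blast
  have "hausdorff_delta 1 \<delta> (\<gamma> ` {a..b} - Collect two_sided - {\<gamma> a, \<gamma> b})
      \<le> ennreal (unit_ball_vol (real 1) * 5 ^ 1 * (2 * \<eta>))"
  proof (rule hausdorff_delta_le_packing[where F = F])
    show "0 < snd p" "10 * snd p \<le> \<delta>" if "p \<in> F" for p
      using J[of p] that F(1) \<eta>(2) by auto
    show "0 \<le> \<delta>" using \<eta>(2) \<open>0 \<le> \<eta>\<close> by simp
    show "\<gamma> ` {a..b} - Collect two_sided - {\<gamma> a, \<gamma> b} \<subseteq> (\<Union>p\<in>F. cball (fst p) (5 * snd p))"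
    proof
      fix x assume "x \<in> \<gamma> ` {a..b} - Collect two_sided - {\<gamma> a, \<gamma> b}"
      then obtain t where x: "x = \<gamma> t" and t: "t \<in> {a..b}" "\<not> two_sided (\<gamma> t)" "\<gamma> t \<notin> {\<gamma> a, \<gamma> b}"
        by blast
      have "\<exists>r. (\<gamma> t, r) \<in> J"
      proof (rule ccontr)
        assume no: "\<nexists>r. (\<gamma> t, r) \<in> J"
        have right: "2 * (g u - g t) \<le> s u - s t" if "t \<le> u" "u \<le> b" for u
        proof (rule ccontr)
          assume "\<not> ?thesis"
          then have "(\<gamma> t, 2 * (g u - g t)) \<in> J" using that t unfolding J_def by force
          then show False using no by blast
        qed
        have left: "2 * (g t - g l) \<le> s t - s l" if "a \<le> l" "l \<le> t" for l
        proof (rule ccontr)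
          assume "\<not> ?thesis"
          then have "(\<gamma> t, 2 * (g t - g l)) \<in> J" using that t unfolding J_def by force
          then show False using no by blast
        qed
        have "two_sided (\<gamma> t)"
          unfolding two_sided_def
        proof (intro exI conjI ballI)
          show "connected (\<gamma> ` {a..t})" "connected (\<gamma> ` {t..b})"
            using t(1) assms(2) by (auto intro!: connected_continuous_image continuous_on_subset[OF assms(2)])
          show "\<gamma> t \<in> \<gamma> ` {a..t}" "\<gamma> t \<in> \<gamma> ` {t..b}" using t(1) by auto
          \<comment> \<open>The points \<open>\<gamma> a\<close> and \<open>\<gamma> b\<close> were
            removed so that neither half of the curve collapses to the point under
            consideration.\<close>
          have "\<gamma> a \<in> \<gamma> ` {a..t}" "\<gamma> b \<in> \<gamma> ` {t..b}" using t(1) by auto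
          then show "\<gamma> ` {a..t} \<noteq> {\<gamma> t}" and "\<gamma> ` {t..b} \<noteq> {\<gamma> t}"
            using t(3) by (metis insertI1 insertI2 singletonD)+
          fix p q assume "p \<in> \<gamma> ` {a..t}" "q \<in> \<gamma> ` {t..b}"
          then obtain l u where lu: "a \<le> l" "l \<le> t" "t \<le> u" "u \<le> b" "p = \<gamma> l" "q = \<gamma> u" by auto
          have "s u - s l \<le> 2 * (f u - f l)"
            using right[of u] left[of l] lu by (simp add: g_def)
          moreover have "f u - f l \<le> dist p q" using f_le[of u l] lu by simp
          moreover have "dist (\<gamma> t) p \<le> s t - s l" "dist (\<gamma> t) q \<le> s u - s t"
            using s[of l t] s[of t u] lu t(1) by (auto simp: dist_commute)
          moreover have "0 \<le> s t - s l" "0 \<le> s u - s t"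
            using s_mono[of l t] s_mono[of t u] lu t(1) by auto
          ultimately show "max (dist (\<gamma> t) p) (dist (\<gamma> t) q) \<le> 2 * dist p q" by simp
        qed
        then show False using t(2) by simp
      qed
      then obtain r where r: "(\<gamma> t, r) \<in> J" by blast
      from F(3)[OF r] obtain q where "q \<in> F" "cball (\<gamma> t) r \<subseteq> cball (fst q) (5 * snd q)" by auto
      moreover have "0 < r" using J(1)[OF r] by simp
      ultimately show "x \<in> (\<Union>p\<in>F. cball (fst p) (5 * snd p))" unfolding x by force
    qed
    fix F' assume F': "finite F'" "F' \<subseteq> F"
    obtain l u where lu: "\<And>p. p \<in> F' \<Longrightarrow> a \<le> l p \<and> l p \<le> u p \<and> u p \<le> b"
        "\<And>p. p \<in> F' \<Longrightarrow> snd p = 2 * (g (u p) - g (l p))"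
        "\<And>p. p \<in> F' \<Longrightarrow> \<gamma> ` {l p..u p} \<subseteq> cball (fst p) (snd p)"
    proof -
      have "\<forall>p\<in>F'. \<exists>l u. a \<le> l \<and> l \<le> u \<and> u \<le> b \<and> snd p = 2 * (g u - g l) \<and> \<gamma> ` {l..u} \<subseteq> cball (fst p) (snd p)"
        using interval F' F(1) by blast
      then show ?thesis using that by metis
    qed
    have "(\<Sum>p\<in>F'. g (u p) - g (l p)) \<le> g b - g a"
    proof (rule sum_increments_disjoint[OF F'(1) g_mono lu(1)])
      fix p q assume pq: "p \<in> F'" "q \<in> F'" "p \<noteq> q"
      then have "\<gamma> ` {l p..u p} \<inter> \<gamma> ` {l q..u q} = {}"
        using lu(3)[of p] lu(3)[of q] F(2)[of p q] F'(2) by blast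
      then show "{l p..u p} \<inter> {l q..u q} = {}" by blast
    qed (use assms(1) in auto)
    moreover have "(\<Sum>p\<in>F'. snd p) = 2 * (\<Sum>p\<in>F'. g (u p) - g (l p))"
      unfolding sum_distrib_left using lu(2) by (rule sum.cong[OF refl])
    ultimately show "(\<Sum>p\<in>F'. snd p ^ 1) \<le> 2 * \<eta>" using g_tot by simp
  qed simp
  also have "unit_ball_vol (real 1) * 5 ^ 1 * (2 * \<eta>) = 20 * \<eta>" by (simp add: unit_ball_vol_1)
  finally show ?thesis .
qed

lemma sorted_le_last: "sorted xs \<Longrightarrow> x \<in> set xs \<Longrightarrow> x \<le> last xs"
  by (induction xs) auto

text \<open>The excesses over the chords of consecutive pieces add up to the excess over the
  inscribed polygon; the nodes are finitely many points and have no length.\<close>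

lemma hausdorff_delta_not_two_sided_chain_le:
  fixes \<gamma> :: "real \<Rightarrow> 'a::metric_space"
  assumes "sorted (t # ts)" "b = last (t # ts)" "continuous_on {t..b} \<gamma>"
    and "\<And>u u'. t \<le> u \<Longrightarrow> u \<le> u' \<Longrightarrow> u' \<le> b \<Longrightarrow> dist (\<gamma> u) (\<gamma> u') \<le> s u' - s u"
    and "20 * (s b - s t - chain_length \<gamma> (t # ts)) \<le> \<delta>" "0 < \<delta>"
  shows "hausdorff_delta 1 \<delta> (\<gamma> ` {t..b} - Collect two_sided)
      \<le> ennreal (20 * (s b - s t - chain_length \<gamma> (t # ts)))"
  using assms
proof (induction ts arbitrary: t)
  case Nil
  have "hausdorff_delta 1 \<delta> (\<gamma> ` {t..b} - Collect two_sided) \<le> hausdorff_delta 1 \<delta> {\<gamma> t}"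
    using Nil.prems(2) by (intro hausdorff_delta_mono) auto
  also have "\<dots> \<le> hausdorff 1 {\<gamma> t}" by (rule hausdorff_delta_le_hausdorff) fact
  finally show ?case by simp
next
  case (Cons u ts)
  have b: "b = last (u # ts)" using Cons.prems(2) by simp
  have sorted: "sorted (u # ts)" using Cons.prems(1) by simp
  have ub: "u \<le> b" unfolding b by (rule sorted_le_last[OF sorted]) simp
  have tu: "t \<le> u" using Cons.prems(1) by simp
  define \<eta>1 where "\<eta>1 = s u - s t - dist (\<gamma> t) (\<gamma> u)"
  define \<eta>2 where "\<eta>2 = s b - s u - chain_length \<gamma> (u # ts)"
  have \<eta>: "s b - s t - chain_length \<gamma> (t # u # ts) = \<eta>1 + \<eta>2" by (simp add: \<eta>1_def \<eta>2_def)
  have "0 \<le> \<eta>1" using Cons.prems(4)[of t u] tu ub by (simp add: \<eta>1_def)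
  have "chain_length \<gamma> (u # ts) \<le> s (last (u # ts)) - s (hd (u # ts))"
  proof (rule chain_length_le_increment[where I = "{u..b}"])
    show "dist (\<gamma> v) (\<gamma> v') \<le> s v' - s v" if "v \<in> {u..b}" "v' \<in> {u..b}" "v \<le> v'" for v v'
      using that tu by (intro Cons.prems(4)) auto
    show "set (u # ts) \<subseteq> {u..b}"
      using sorted sorted_le_last[OF sorted] unfolding b by (auto simp del: last.simps)
  qed (use Cons.prems(1) in auto)
  then have "0 \<le> \<eta>2" by (simp add: \<eta>2_def b)
  have "\<gamma> ` {t..b} - Collect two_sided \<subseteq>
     ((\<gamma> ` {t..u} - Collect two_sided - {\<gamma> t, \<gamma> u}) \<union> {\<gamma> t, \<gamma> u}) \<union> (\<gamma> ` {u..b} - Collect two_sided)"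
    by force
  then have "hausdorff_delta 1 \<delta> (\<gamma> ` {t..b} - Collect two_sided) \<le> hausdorff_delta 1 \<delta> 
     (((\<gamma> ` {t..u} - Collect two_sided - {\<gamma> t, \<gamma> u}) \<union> {\<gamma> t, \<gamma> u}) \<union> (\<gamma> ` {u..b} - Collect two_sided))"
    by (rule hausdorff_delta_mono)
  also have "\<dots> \<le> hausdorff_delta 1 \<delta> (\<gamma> ` {t..u} - Collect two_sided - {\<gamma> t, \<gamma> u})
     + hausdorff_delta 1 \<delta> {\<gamma> t, \<gamma> u} + hausdorff_delta 1 \<delta> (\<gamma> ` {u..b} - Collect two_sided)"
    using \<open>0 < \<delta>\<close> by (intro order_trans[OF hausdorff_delta_Un] add_right_mono hausdorff_delta_Un) auto
  also have "hausdorff_delta 1 \<delta> {\<gamma> t, \<gamma> u} = 0"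
    using hausdorff_delta_le_hausdorff[OF \<open>0 < \<delta>\<close>, of 1 "{\<gamma> t, \<gamma> u}"] hausdorff_countable[of 1 "{\<gamma> t, \<gamma> u}"] by simp
  also have "hausdorff_delta 1 \<delta> (\<gamma> ` {t..u} - Collect two_sided - {\<gamma> t, \<gamma> u}) + 0 
      + hausdorff_delta 1 \<delta> (\<gamma> ` {u..b} - Collect two_sided) \<le> ennreal (20 * \<eta>1) + 0 + ennreal (20 * \<eta>2)"
  proof (intro add_mono)
    show "hausdorff_delta 1 \<delta> (\<gamma> ` {t..u} - Collect two_sided - {\<gamma> t, \<gamma> u}) \<le> ennreal (20 * \<eta>1)"
    proof (rule hausdorff_delta_not_two_sided_le[where s = s])
      show "continuous_on {t..u} \<gamma>" using ub by (intro continuous_on_subset[OF Cons.prems(3)]) auto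
      show "dist (\<gamma> v) (\<gamma> v') \<le> s v' - s v" if "t \<le> v" "v \<le> v'" "v' \<le> u" for v v'
        using that ub by (intro Cons.prems(4)) auto
      show "20 * \<eta>1 \<le> \<delta>" using Cons.prems(5) \<open>0 \<le> \<eta>2\<close> unfolding \<eta> by simp
    qed (simp_all add: tu \<eta>1_def)
    show "hausdorff_delta 1 \<delta> (\<gamma> ` {u..b} - Collect two_sided) \<le> ennreal (20 * \<eta>2)"
      unfolding \<eta>2_def
    proof (rule Cons.IH)
      show "continuous_on {u..b} \<gamma>" using tu by (intro continuous_on_subset[OF Cons.prems(3)]) auto
      show "dist (\<gamma> v) (\<gamma> v') \<le> s v' - s v" if "u \<le> v" "v \<le> v'" "v' \<le> b" for v v'
        using that tu by (intro Cons.prems(4)) auto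
      show "20 * (s b - s u - chain_length \<gamma> (u # ts)) \<le> \<delta>"
        using Cons.prems(5) \<open>0 \<le> \<eta>1\<close> unfolding \<eta> \<eta>2_def[symmetric] by simp
    qed (use Cons.prems b in auto)
  qed simp
  also have "\<dots> = ennreal (20 * (\<eta>1 + \<eta>2))"
    using \<open>0 \<le> \<eta>1\<close> \<open>0 \<le> \<eta>2\<close> by (simp flip: ennreal_plus add: algebra_simps)
  finally show ?case unfolding \<eta> .
qed

lemma hausdorff_not_two_sided_segment:
  fixes \<gamma> :: "real \<Rightarrow> 'a::metric_space"
  assumes "a \<le> b" "continuous_on {a..b} \<gamma>" and fin: "curve_length {a..b} \<gamma> < \<infinity>"
  shows "hausdorff 1 (\<gamma> ` {a..b} - Collect two_sided) = 0"
proof (rule hausdorff_eq_0I)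
  fix \<delta> :: real assume "0 < \<delta>"
  define s where "s t = enn2real (curve_length {a..t} \<gamma>)" for t
  have s0: "0 \<le> s t" for t by (simp add: s_def)
  have s_eq: "curve_length {a..b} \<gamma> = ennreal (s b)" using fin by (simp add: s_def)
  have s: "dist (\<gamma> t) (\<gamma> t') \<le> s t' - s t" if "a \<le> t" "t \<le> t'" "t' \<le> b" for t t'
    unfolding s_def
    using that le_less_trans[OF curve_length_mono fin, of "{a..t'}"] by (intro dist_le_curve_length_diff) auto
  have "hausdorff_delta 1 \<delta> (\<gamma> ` {a..b} - Collect two_sided) \<le> 0 + ennreal e" if "0 < e" for e
  proof -
    define \<eta> where "\<eta> = min e \<delta> / 20"
    have "0 < \<eta>" using that \<open>0 < \<delta>\<close> by (simp add: \<eta>_def)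
    \<comment> \<open>\<open>ennreal\<close> truncates negative numbers, so a negative lower bound
      is handled separately, by the empty partition.\<close>
    obtain ts where ts: "sorted ts" "set ts \<subseteq> {a..b}" "s b - \<eta> \<le> chain_length \<gamma> ts"
    proof (cases "s b - \<eta> < 0")
      case True
      then show ?thesis using that[of "[]"] by simp
    next
      case False
      then have "ennreal (s b - \<eta>) < curve_length {a..b} \<gamma>"
        using \<open>0 < \<eta>\<close> by (simp add: s_eq ennreal_less_iff)
      then obtain ts where "sorted ts" "set ts \<subseteq> {a..b}" "ennreal (s b - \<eta>) < ennreal (chain_length \<gamma> ts)"
        unfolding curve_length_eq_chain_length less_SUP_iff by auto
      then show ?thesis using False by (intro that[of ts]) (auto simp: ennreal_less_iff)
    qed
    \<comment> \<open>The estimate for polygons needs a partition from \<open>a\<close> to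
      \<open>b\<close>; adding the endpoints cannot shorten the polygon.\<close>
    have "chain_length \<gamma> ts \<le> chain_length \<gamma> (a # ts @ [b])"
      using chain_length_le_Cons[of \<gamma> "ts @ [b]" a] chain_length_le_snoc[of \<gamma> ts b] by simp
    then have le: "s b - s a - chain_length \<gamma> (a # ts @ [b]) \<le> \<eta>"
      using ts(3) s0[of a] by simp
    have "hausdorff_delta 1 \<delta> (\<gamma> ` {a..b} - Collect two_sided)
        \<le> ennreal (20 * (s b - s a - chain_length \<gamma> (a # ts @ [b])))"
    proof (rule hausdorff_delta_not_two_sided_chain_le)
      show "sorted (a # ts @ [b])" using ts assms(1) by (force simp: sorted_append)
      show "20 * (s b - s a - chain_length \<gamma> (a # ts @ [b])) \<le> \<delta>" using le by (simp add: \<eta>_def)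
    qed (use assms s \<open>0 < \<delta>\<close> in auto)
    also have "\<dots> \<le> ennreal e" using le by (intro ennreal_leI) (simp add: \<eta>_def)
    finally show ?thesis by simp
  qed
  then have "hausdorff_delta 1 \<delta> (\<gamma> ` {a..b} - Collect two_sided) \<le> 0" by (rule ennreal_le_epsilon)
  then show "hausdorff_delta 1 \<delta> (\<gamma> ` {a..b} - Collect two_sided) = 0" by simp
qed

theorem hausdorff_not_two_sided:
  assumes "rectifiable_curve I \<gamma>"
  shows "hausdorff 1 (\<gamma> ` I - Collect two_sided) = 0"
proof -
  have I: "is_interval I" "continuous_on I \<gamma>" "curve_length I \<gamma> < \<infinity>"
    using assms unfolding rectifiable_curve_def curve_def by blast+
  define Q where "Q = {(p, q). p \<in> \<rat> \<inter> I \<and> q \<in> \<rat> \<inter> I \<and> p \<le> q}"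
  \<comment> \<open>\<open>E\<close> holds the at most two ends of \<open>I\<close> that belong to
    \<open>I\<close>; every other point lies between two rationals of \<open>I\<close>.\<close>
  define E where "E = {t \<in> I. \<forall>s\<in>I. t \<le> s} \<union> {t \<in> I. \<forall>s\<in>I. s \<le> t}"
  have sub: "{p..q} \<subseteq> I" if "p \<in> I" "q \<in> I" for p q
    using I(1) that unfolding is_interval_1 by (meson atLeastAtMost_iff subsetI)
  have "countable Q"
    by (rule countable_subset[of _ "\<rat> \<times> \<rat>"]) (auto simp: Q_def countable_rat)
  have "I \<subseteq> (\<Union>(p, q)\<in>Q. {p..q}) \<union> E"
  proof
    fix t assume "t \<in> I"
    show "t \<in> (\<Union>(p, q)\<in>Q. {p..q}) \<union> E"
    proof (cases "t \<in> E")
      case False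
      then obtain l u where "l \<in> I" "l < t" "u \<in> I" "t < u" using \<open>t \<in> I\<close> by (auto simp: E_def not_le)
      then obtain p q where "p \<in> \<rat>" "l < p" "p < t" "q \<in> \<rat>" "t < q" "q < u"
        using Rats_dense_in_real by metis
      then have "(p, q) \<in> Q" "t \<in> {p..q}"
        using sub[OF \<open>l \<in> I\<close> \<open>u \<in> I\<close>] by (auto simp: Q_def)
      then show ?thesis by blast
    qed simp
  qed
  then have "\<gamma> ` I - Collect two_sided \<subseteq> (\<Union>(p, q)\<in>Q. \<gamma> ` {p..q} - Collect two_sided) \<union> \<gamma> ` E"
    by blast
  then have "hausdorff 1 (\<gamma> ` I - Collect two_sided)
      \<le> hausdorff 1 (\<Union>(p, q)\<in>Q. \<gamma> ` {p..q} - Collect two_sided) + hausdorff 1 (\<gamma> ` E)"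
    by (intro order_trans[OF hausdorff_mono hausdorff_Un])
  also have "hausdorff 1 (\<Union>(p, q)\<in>Q. \<gamma> ` {p..q} - Collect two_sided) = 0"
  proof (rule hausdorff_null_UN[OF \<open>countable Q\<close>])
    fix i assume "i \<in> Q"
    then obtain p q where i: "i = (p, q)" "p \<in> I" "q \<in> I" "p \<le> q" by (auto simp: Q_def)
    have "hausdorff 1 (\<gamma> ` {p..q} - Collect two_sided) = 0"
      using sub[OF i(2,3)] i(4) curve_length_mono[OF sub[OF i(2,3)], of \<gamma>] I
      by (intro hausdorff_not_two_sided_segment) (auto intro: continuous_on_subset le_less_trans)
    then show "hausdorff 1 (case i of (p, q) \<Rightarrow> \<gamma> ` {p..q} - Collect two_sided) = 0" by (simp add: i)
  qed
  also have "hausdorff 1 (\<gamma> ` E) = 0"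
  proof (rule hausdorff_countable)
    have fin: "finite A" if A: "\<And>x y. x \<in> A \<Longrightarrow> y \<in> A \<Longrightarrow> x = y" for A :: "real set"
    proof (cases "A = {}")
      case False
      then obtain x where "x \<in> A" by blast
      then have "A \<subseteq> {x}" using A by blast
      then show ?thesis by (rule finite_subset) simp
    qed simp
    have "finite {t \<in> I. \<forall>s\<in>I. t \<le> s}" "finite {t \<in> I. \<forall>s\<in>I. s \<le> t}"
      by (rule fin, force intro: antisym)+
    then show "countable (\<gamma> ` E)" by (simp add: E_def countable_finite)
  qed simp
  finally show ?thesis by simp
qed

section \<open>A length-area argument on squares\<close>

text \<open>The line integral over the boundary of a square, side by side. The plane is
  \<open>real \<times> real\<close> so that Fubini's theorem for \<open>lborel\<close> applies to
  the sides directly.\<close>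

definition square_integral :: "real \<times> real \<Rightarrow> (real \<times> real \<Rightarrow> ennreal) \<Rightarrow> real \<Rightarrow> ennreal" where
  "square_integral c F t =
     (\<integral>\<^sup>+ y \<in> {snd c - t..snd c + t}. F (fst c + t, y) \<partial>lborel) +
     (\<integral>\<^sup>+ y \<in> {snd c - t..snd c + t}. F (fst c - t, y) \<partial>lborel) +
     (\<integral>\<^sup>+ x \<in> {fst c - t..fst c + t}. F (x, snd c + t) \<partial>lborel) +
     (\<integral>\<^sup>+ x \<in> {fst c - t..fst c + t}. F (x, snd c - t) \<partial>lborel)"

abbreviation closed_square :: "real \<times> real \<Rightarrow> real \<Rightarrow> (real \<times> real) set" where
  "closed_square c t \<equiv> {fst c - t..fst c + t} \<times> {snd c - t..snd c + t}"

definition square_boundary :: "real \<times> real \<Rightarrow> real \<Rightarrow> (real \<times> real) set" where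
  "square_boundary c t = {p. max \<bar>fst p - fst c\<bar> \<bar>snd p - snd c\<bar> = t}"

lemma square_integral_mono:
  assumes "0 \<le> t" "\<And>p. p \<in> square_boundary c t \<Longrightarrow> F p \<le> G p"
  shows "square_integral c F t \<le> square_integral c G t"
  unfolding square_integral_def
proof (intro add_mono nn_integral_mono)
  let ?X = "{fst c - t..fst c + t}" and ?Y = "{snd c - t..snd c + t}"
  fix y
  have y: "(fst c + t, y) \<in> square_boundary c t" "(fst c - t, y) \<in> square_boundary c t" if "y \<in> ?Y"
    using that assms(1) by (auto simp: square_boundary_def)
  show "F (fst c + t, y) * indicator ?Y y \<le> G (fst c + t, y) * indicator ?Y y"
    "F (fst c - t, y) * indicator ?Y y \<le> G (fst c - t, y) * indicator ?Y y"
    using assms(2)[OF y(1)] assms(2)[OF y(2)] by (auto split: split_indicator)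
  have x: "(y, snd c + t) \<in> square_boundary c t" "(y, snd c - t) \<in> square_boundary c t" if "y \<in> ?X"
    using that assms(1) by (auto simp: square_boundary_def)
  show "F (y, snd c + t) * indicator ?X y \<le> G (y, snd c + t) * indicator ?X y"
    "F (y, snd c - t) * indicator ?X y \<le> G (y, snd c - t) * indicator ?X y"
    using assms(2)[OF x(1)] assms(2)[OF x(2)] by (auto split: split_indicator)
qed

lemma square_integral_cmult:
  assumes [measurable]: "F \<in> borel_measurable borel"
  shows "square_integral c (\<lambda>p. k * F p) t = k * square_integral c F t"
  unfolding square_integral_def by (simp add: nn_integral_cmult mult.assoc distrib_left)

lemma square_integral_const:
  assumes "0 \<le> t" shows "square_integral c (\<lambda>_. 1) t = ennreal (8 * t)"
  unfolding square_integral_def using assms by (simp flip: ennreal_plus)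

lemma ennreal_add_four: "a + a + a + a = 4 * (a :: ennreal)"
proof -
  have "4 * a = (1 + 1 + 1 + 1) * a" by simp
  then show ?thesis by (simp only: distrib_right mult_1)
qed

text \<open>As \<open>t\<close> runs through the real line, each of the four sides sweeps the plane
  at most once. Extending the sides to full lines turns their integrals into the partial integrals
  of Fubini's theorem.\<close>

lemma nn_integral_square_integral_le:
  assumes F [measurable]: "F \<in> borel_measurable borel"
  shows "(\<integral>\<^sup>+ t \<in> T. square_integral c F t \<partial>lborel) \<le> 4 * (\<integral>\<^sup>+ p. F p \<partial>lborel)"
proof -
  define g where "g x = (\<integral>\<^sup>+ y. F (x, y) \<partial>lborel)" for x
  define k where "k y = (\<integral>\<^sup>+ x. F (x, y) \<partial>lborel)" for y
  have gk [measurable]: "g \<in> borel_measurable borel" "k \<in> borel_measurable borel"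
    unfolding g_def k_def by measurable
  have F2: "F \<in> borel_measurable (lborel \<Otimes>\<^sub>M lborel)" unfolding lborel_prod by simp
  have g: "(\<integral>\<^sup>+ x. g x \<partial>lborel) = (\<integral>\<^sup>+ p. F p \<partial>lborel)"
    unfolding g_def lborel.nn_integral_fst[OF F2] lborel_prod ..
  have k: "(\<integral>\<^sup>+ y. k y \<partial>lborel) = (\<integral>\<^sup>+ p. F p \<partial>lborel)"
    unfolding k_def lborel_pair.nn_integral_snd[OF F2] lborel_prod ..
  have aff: "(\<integral>\<^sup>+ t. f (a + t) \<partial>lborel) = (\<integral>\<^sup>+ t. f t \<partial>lborel)" "(\<integral>\<^sup>+ t. f (a - t) \<partial>lborel) = (\<integral>\<^sup>+ t. f t \<partial>lborel)"
    if "f \<in> borel_measurable borel" for f :: "real \<Rightarrow> ennreal" and a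
    using nn_integral_real_affine[OF that, of 1 a] nn_integral_real_affine[OF that, of "-1" a] by simp_all
  have "(\<integral>\<^sup>+ t \<in> T. square_integral c F t \<partial>lborel)
      \<le> (\<integral>\<^sup>+ t. g (fst c + t) + g (fst c - t) + k (snd c + t) + k (snd c - t) \<partial>lborel)"
  proof (rule nn_integral_mono)
    fix t :: real
    have "square_integral c F t \<le> g (fst c + t) + g (fst c - t) + k (snd c + t) + k (snd c - t)"
      unfolding square_integral_def g_def k_def
      by (intro add_mono nn_integral_mono) (auto split: split_indicator)
    then show "square_integral c F t * indicator T t
        \<le> g (fst c + t) + g (fst c - t) + k (snd c + t) + k (snd c - t)"
      by (auto split: split_indicator)
  qed
  also have "\<dots> = (\<integral>\<^sup>+ t. g (fst c + t) \<partial>lborel) + (\<integral>\<^sup>+ t. g (fst c - t) \<partial>lborel)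
      + (\<integral>\<^sup>+ t. k (snd c + t) \<partial>lborel) + (\<integral>\<^sup>+ t. k (snd c - t) \<partial>lborel)"
    by (simp add: nn_integral_add)
  also have "\<dots> = (\<integral>\<^sup>+ p. F p \<partial>lborel) + (\<integral>\<^sup>+ p. F p \<partial>lborel)
      + (\<integral>\<^sup>+ p. F p \<partial>lborel) + (\<integral>\<^sup>+ p. F p \<partial>lborel)"
    by (simp only: aff[OF gk(1)] aff[OF gk(2)] g k)
  also have "\<dots> = 4 * (\<integral>\<^sup>+ p. F p \<partial>lborel)" by (rule ennreal_add_four)
  finally show ?thesis .
qed

text \<open>Cauchy-Schwarz on a side of length \<open>2 * t\<close>, after which a sum of four terms
  is bounded by four times the largest: \<open>32 * t\<close> is
  \<open>4\<^sup>2 * (2 * t)\<close>.\<close>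

lemma square_integral_square_le:
  assumes [measurable]: "\<rho> \<in> borel_measurable borel" and "0 \<le> t"
  shows "(square_integral c \<rho> t)\<^sup>2 \<le> ennreal (32 * t) * square_integral c (\<lambda>p. (\<rho> p)\<^sup>2) t"
proof -
  have CS: "(\<integral>\<^sup>+ y \<in> {a - t..a + t}. f y \<partial>lborel)\<^sup>2 \<le> ennreal (2 * t) * (\<integral>\<^sup>+ y \<in> {a - t..a + t}. (f y)\<^sup>2 \<partial>lborel)"
    if [measurable]: "f \<in> borel_measurable borel" for f :: "real \<Rightarrow> ennreal" and a
  proof -
    let ?I = "{a - t..a + t}"
    have "(\<integral>\<^sup>+ y. (f y * indicator ?I y) * indicator ?I y \<partial>lborel)\<^sup>2
        \<le> (\<integral>\<^sup>+ y. (f y * indicator ?I y)\<^sup>2 \<partial>lborel) * (\<integral>\<^sup>+ y. (indicator ?I y)\<^sup>2 \<partial>lborel)"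
      by (rule Cauchy_Schwarz_nn_integral) measurable
    also have "(\<integral>\<^sup>+ y. (indicator ?I y)\<^sup>2 \<partial>lborel) = (\<integral>\<^sup>+ y. indicator ?I y \<partial>lborel)"
      by (intro nn_integral_cong) (auto split: split_indicator)
    also have "\<dots> = ennreal (2 * t)" using \<open>0 \<le> t\<close> by simp
    also have "(\<integral>\<^sup>+ y. (f y * indicator ?I y)\<^sup>2 \<partial>lborel) = (\<integral>\<^sup>+ y \<in> ?I. (f y)\<^sup>2 \<partial>lborel)"
      by (intro nn_integral_cong) (auto split: split_indicator)
    also have "(\<integral>\<^sup>+ y. (f y * indicator ?I y) * indicator ?I y \<partial>lborel) = (\<integral>\<^sup>+ y \<in> ?I. f y \<partial>lborel)"
      by (intro nn_integral_cong) (auto split: split_indicator)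
    finally show ?thesis by (simp add: mult.commute)
  qed
  have four: "(w + x + y + z)\<^sup>2 \<le> ennreal (32 * t) * (w' + x' + y' + z')"
    if le: "w\<^sup>2 \<le> ennreal (2 * t) * w'" "x\<^sup>2 \<le> ennreal (2 * t) * x'"
        "y\<^sup>2 \<le> ennreal (2 * t) * y'" "z\<^sup>2 \<le> ennreal (2 * t) * z'" for w x y z w' x' y' z' :: ennreal
  proof -
    define m where "m = max (max w x) (max y z)"
    have "w + x + y + z \<le> m + m + m + m"
      unfolding m_def by (intro add_mono) (simp_all add: le_max_iff_disj)
    also have "\<dots> = 4 * m" by (rule ennreal_add_four)
    finally have "(w + x + y + z)\<^sup>2 \<le> (4 * m)\<^sup>2" by (intro power_mono) auto
    also have "\<dots> = 16 * m\<^sup>2" by (simp add: power_mult_distrib)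
    also have "m\<^sup>2 \<le> ennreal (2 * t) * (w' + x' + y' + z')"
    proof -
      have "m = w \<or> m = x \<or> m = y \<or> m = z" unfolding m_def by (auto simp: max_def)
      moreover have "w' \<le> w' + x' + y' + z'" "x' \<le> w' + x' + y' + z'"
        "y' \<le> w' + x' + y' + z'" "z' \<le> w' + x' + y' + z'"
        using le_iff_add[of w' "w' + x' + y' + z'"] le_iff_add[of x' "w' + x' + y' + z'"]
          le_iff_add[of y' "w' + x' + y' + z'"] le_iff_add[of z' "w' + x' + y' + z'"]
        by (metis ab_semigroup_add_class.add_ac(1) add.commute)+
      ultimately show ?thesis
        by (elim disjE) (simp_all only: order_trans[OF le(1) mult_left_mono] order_trans[OF le(2) mult_left_mono]
            order_trans[OF le(3) mult_left_mono] order_trans[OF le(4) mult_left_mono] zero_le)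
    qed
    also have "16 * (ennreal (2 * t) * (w' + x' + y' + z')) = ennreal (32 * t) * (w' + x' + y' + z')"
      using ennreal_mult[of 16 "2 * t"] \<open>0 \<le> t\<close> by (simp add: mult.assoc[symmetric])
    finally show ?thesis by (simp add: mult_left_mono)
  qed
  show ?thesis
    unfolding square_integral_def by (intro four CS) measurable
qed

text \<open>What the length-area argument takes from an upper gradient: the inequality along
  horizontal and vertical segments, with the line integral written as an integral over the
  coordinate.\<close>

locale axis_upper_gradient =
  fixes S :: "(real \<times> real) set" and h :: "real \<times> real \<Rightarrow> 'x::metric_space" and \<rho> :: "real \<times> real \<Rightarrow> ennreal"
  assumes S: "open S" and cont: "continuous_on S h" and \<rho> [measurable]: "\<rho> \<in> borel_measurable borel"
    and hor: "\<And>a b y. a \<le> b \<Longrightarrow> {a..b} \<times> {y} \<subseteq> S \<Longrightarrow>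
        ennreal (dist (h (a, y)) (h (b, y))) \<le> (\<integral>\<^sup>+ x \<in> {a..b}. \<rho> (x, y) \<partial>lborel)"
    and ver: "\<And>a b x. a \<le> b \<Longrightarrow> {x} \<times> {a..b} \<subseteq> S \<Longrightarrow>
        ennreal (dist (h (x, a)) (h (x, b))) \<le> (\<integral>\<^sup>+ y \<in> {a..b}. \<rho> (x, y) \<partial>lborel)"
begin

text \<open>A boundary point reaches the upper right corner along at most two sides, each traversed
  at most once.\<close>

lemma dist_corner_le:
  assumes "closed_square c t \<subseteq> S" "p \<in> square_boundary c t"
  shows "ennreal (dist (h p) (h (fst c + t, snd c + t))) \<le> square_integral c \<rho> t"
proof -
  let ?X = "{fst c - t..fst c + t}" and ?Y = "{snd c - t..snd c + t}"
  obtain x y where p: "p = (x, y)" by fastforce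
  have bd: "\<bar>x - fst c\<bar> \<le> t" "\<bar>y - snd c\<bar> \<le> t" using assms(2) by (auto simp: square_boundary_def p)
  have H: "ennreal (dist (h (a, z)) (h (b, z))) \<le> (\<integral>\<^sup>+ x \<in> ?X. \<rho> (x, z) \<partial>lborel)"
    if "fst c - t \<le> a" "a \<le> b" "b \<le> fst c + t" "snd c - t \<le> z" "z \<le> snd c + t" for a b z
  proof -
    have "ennreal (dist (h (a, z)) (h (b, z))) \<le> (\<integral>\<^sup>+ x \<in> {a..b}. \<rho> (x, z) \<partial>lborel)"
      using assms(1) that by (intro hor) fastforce+
    also have "\<dots> \<le> (\<integral>\<^sup>+ x \<in> ?X. \<rho> (x, z) \<partial>lborel)"
      using that by (intro nn_integral_mono) (auto split: split_indicator)
    finally show ?thesis .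
  qed
  have V: "ennreal (dist (h (z, a)) (h (z, b))) \<le> (\<integral>\<^sup>+ y \<in> ?Y. \<rho> (z, y) \<partial>lborel)"
    if "snd c - t \<le> a" "a \<le> b" "b \<le> snd c + t" "fst c - t \<le> z" "z \<le> fst c + t" for a b z
  proof -
    have "ennreal (dist (h (z, a)) (h (z, b))) \<le> (\<integral>\<^sup>+ y \<in> {a..b}. \<rho> (z, y) \<partial>lborel)"
      using assms(1) that by (intro ver) fastforce+
    also have "\<dots> \<le> (\<integral>\<^sup>+ y \<in> ?Y. \<rho> (z, y) \<partial>lborel)"
      using that by (intro nn_integral_mono) (auto split: split_indicator)
    finally show ?thesis .
  qed
  have tri: "ennreal (dist a b) \<le> ennreal (dist a d) + ennreal (dist d b)" for a b d :: 'x
    by (simp add: dist_triangle flip: ennreal_plus)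
  let ?I1 = "\<integral>\<^sup>+ y \<in> ?Y. \<rho> (fst c + t, y) \<partial>lborel"
  let ?I2 = "\<integral>\<^sup>+ y \<in> ?Y. \<rho> (fst c - t, y) \<partial>lborel"
  let ?I3 = "\<integral>\<^sup>+ x \<in> ?X. \<rho> (x, snd c + t) \<partial>lborel"
  let ?I4 = "\<integral>\<^sup>+ x \<in> ?X. \<rho> (x, snd c - t) \<partial>lborel"
  have sum: "?I1 + ?I2 + ?I3 + ?I4 = square_integral c \<rho> t" by (simp add: square_integral_def)
  have t0: "0 \<le> t" using bd by linarith
  consider "x = fst c + t" | "x = fst c - t" | "y = snd c + t" | "y = snd c - t"
    using assms(2) by (auto simp: square_boundary_def p max_def abs_if split: if_splits)
  then show ?thesis
  proof cases
    case 1
    have "ennreal (dist (h p) (h (fst c + t, snd c + t))) \<le> ?I1"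
      unfolding p 1 using bd t0 by (intro V) auto
    also have "\<dots> \<le> square_integral c \<rho> t" unfolding sum[symmetric] by (simp add: add.assoc)
    finally show ?thesis .
  next
    case 2
    have "ennreal (dist (h p) (h (fst c + t, snd c + t))) \<le> ?I2 + ?I3"
      unfolding p 2 using bd t0 by (intro order_trans[OF tri[of _ _ "h (fst c - t, snd c + t)"]] add_mono V H) auto
    also have "\<dots> \<le> (?I2 + ?I3) + (?I1 + ?I4)" by simp
    also have "\<dots> = square_integral c \<rho> t" unfolding sum[symmetric] by (simp add: ac_simps)
    finally show ?thesis .
  next
    case 3
    have "ennreal (dist (h p) (h (fst c + t, snd c + t))) \<le> ?I3"
      unfolding p 3 using bd t0 by (intro H) auto
    also have "\<dots> \<le> ?I3 + (?I1 + ?I2 + ?I4)" by simp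
    also have "\<dots> = square_integral c \<rho> t" unfolding sum[symmetric] by (simp add: ac_simps)
    finally show ?thesis .
  next
    case 4
    have "ennreal (dist (h p) (h (fst c + t, snd c + t))) \<le> ?I4 + ?I1"
      unfolding p 4 using bd t0 by (intro order_trans[OF tri[of _ _ "h (fst c + t, snd c - t)"]] add_mono V H) auto
    also have "\<dots> \<le> (?I4 + ?I1) + (?I2 + ?I3)" by simp
    also have "\<dots> = square_integral c \<rho> t" unfolding sum[symmetric] by (simp add: ac_simps)
    finally show ?thesis .
  qed
qed

lemma dist_square_le:
  assumes "closed_square c t \<subseteq> S"
    "p \<in> square_boundary c t" "q \<in> square_boundary c t"
  shows "ennreal (dist (h p) (h q)) \<le> 2 * square_integral c \<rho> t"
proof -
  let ?c = "h (fst c + t, snd c + t)"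
  have "ennreal (dist (h p) (h q)) \<le> ennreal (dist (h p) ?c) + ennreal (dist (h q) ?c)"
    by (simp add: dist_triangle2 flip: ennreal_plus)
  also have "\<dots> \<le> square_integral c \<rho> t + square_integral c \<rho> t"
    by (intro add_mono dist_corner_le assms)
  finally show ?thesis by (simp add: mult_2)
qed

text \<open>If the largest distance \<open>\<sigma>\<close> from \<open>h c\<close> to the image of the square boundary with half-side \<open>t\<close> is
  attained up to a constant by the oscillation on it, then Cauchy-Schwarz gives
  \<open>1 / t \<le> const * \<integral> \<rho>\<^sup>2 / \<sigma>\<^sup>2\<close> along the boundary. Sorting the squares by the dyadic size of \<open>\<sigma>\<close>
  and integrating in \<open>t\<close>, the left side grows like \<open>n ln 2\<close> as \<open>n\<close> dyadic scales are used, while each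
  scale contributes at most a small constant on the right. Squares with \<open>\<sigma>\<close> below the smallest scale are
  counted by area, which is why the density hypothesis concerns \<open>\<rho>\<^sup>2 + 1\<close>.\<close>

lemma no_wide_squares:
  assumes "0 < R" and box: "closed_square c R \<subseteq> S"
    and wide: "\<And>t. 0 < t \<Longrightarrow> t < R \<Longrightarrow> \<exists>p\<in>square_boundary c t. \<exists>q\<in>square_boundary c t.
                max (dist (h c) (h p)) (dist (h c) (h q)) \<le> 2 * dist (h p) (h q)"
    and density: "\<And>e. 0 < e \<Longrightarrow> \<exists>r0>0. \<forall>r. 0 < r \<and> r < r0 \<longrightarrow>
                (\<integral>\<^sup>+ p \<in> {p\<in>S. dist (h c) (h p) \<le> r}. (\<rho> p)\<^sup>2 + 1 \<partial>lborel) \<le> ennreal (e * r\<^sup>2)"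
  shows False
proof -
  \<comment> \<open>Small enough that \<open>4 * 4608 * e\<close> is below \<open>1 / 5\<close> and
    hence below \<open>ln 2\<close>; the factor \<open>4608\<close> is a coefficient of
    \<open>F\<close>, the factor \<open>4\<close> comes from the four sides.\<close>
  define e :: real where "e = 1 / 1000000"
  define D where "D r = {p\<in>S. dist (h c) (h p) \<le> r}" for r
  obtain r0 where r0: "0 < r0" "\<And>r. 0 < r \<Longrightarrow> r < r0 \<Longrightarrow>
      (\<integral>\<^sup>+ p \<in> D r. (\<rho> p)\<^sup>2 + 1 \<partial>lborel) \<le> ennreal (e * r\<^sup>2)"
    using density[of e] unfolding D_def e_def by auto
  define s where "s k = r0 / 2 / 2 ^ k" for k :: nat
  have s: "0 < s k" "s k < r0" "s (Suc k) = s k / 2" for k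
  proof -
    show "0 < s k" using r0(1) by (simp add: s_def)
    have "r0 / 2 / 2 ^ k \<le> r0 / 2" using r0(1) by (simp add: field_simps)
    then show "s k < r0" using r0(1) unfolding s_def by linarith
    show "s (Suc k) = s k / 2" by (simp add: s_def)
  qed
  have D_meas [measurable]: "D r \<in> sets borel" for r
  proof -
    have "closedin (top_of_set S) (S \<inter> (\<lambda>p. dist (h c) (h p)) -` {..r})"
      by (intro continuous_closedin_preimage continuous_intros cont)
    then obtain T where "closed T" "S \<inter> (\<lambda>p. dist (h c) (h p)) -` {..r} = S \<inter> T"
      by (auto simp: closedin_closed)
    moreover have "D r = S \<inter> (\<lambda>p. dist (h c) (h p)) -` {..r}" by (auto simp: D_def)
    ultimately show ?thesis using S by simp
  qed
  have "c \<in> closed_square c R"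
    using \<open>0 < R\<close> by (simp add: mem_Times_iff)
  then have cS: "c \<in> S" using box by blast
  \<comment> \<open>Half-sides up to \<open>R'\<close> keep the boundary image within the largest
    scale \<open>s 0\<close>, which starts the sorting by scales.\<close>
  obtain R' where R': "0 < R'" "R' < R" "\<And>t. t \<le> R' \<Longrightarrow> square_boundary c t \<subseteq> D (s 0)"
  proof -
    have "isCont h c" using cont S cS by (simp add: continuous_on_eq_continuous_at)
    then obtain d where d: "0 < d" "\<And>p. dist p c < d \<Longrightarrow> dist (h p) (h c) < s 0"
      unfolding continuous_at_eps_delta using s(1)[of 0] by blast
    define R' where "R' = min (R / 2) (d / 3)"
    show ?thesis
    proof (rule that[of R'])
      show "0 < R'" "R' < R" using \<open>0 < R\<close> \<open>0 < d\<close> by (auto simp: R'_def)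
      fix t assume t: "t \<le> R'"
      show "square_boundary c t \<subseteq> D (s 0)"
      proof
        fix p assume p: "p \<in> square_boundary c t"
        have "dist p c \<le> \<bar>fst p - fst c\<bar> + \<bar>snd p - snd c\<bar>"
          unfolding dist_prod_def dist_real_def by (rule sqrt_sum_squares_le_sum) auto
        also have "\<dots> \<le> 2 * t" using p by (simp add: square_boundary_def max_def split: if_splits)
        also have "\<dots> < d" using t \<open>0 < d\<close> by (simp add: R'_def)
        finally have "dist (h p) (h c) < s 0" by (rule d(2))
        moreover have "p \<in> S"
        proof -
          have "\<bar>fst p - fst c\<bar> \<le> R" "\<bar>snd p - snd c\<bar> \<le> R"
            using p t \<open>0 < R\<close> by (simp_all add: square_boundary_def R'_def max_def split: if_splits)
          then have "p \<in> closed_square c R"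
            by (auto simp: mem_Times_iff abs_le_iff)
          then show ?thesis using box by blast
        qed
        ultimately show "p \<in> D (s 0)" by (simp add: D_def dist_commute)
      qed
    qed
  qed
  \<comment> \<open>The constant is \<open>2 * 2 + 2\<close>: the distance from \<open>h c\<close>
    to the point \<open>h q1\<close> of the wide pair is at most twice an oscillation, going on to
    \<open>h p\<close> costs one more, and an oscillation is at most two boundary integrals.\<close>
  have osc: "ennreal (dist (h c) (h p)) \<le> 6 * square_integral c \<rho> t"
    if t: "0 < t" "t < R" and p: "p \<in> square_boundary c t" for t p
  proof -
    have sub: "closed_square c t \<subseteq> S" using box t by force
    obtain q1 q2 where q: "q1 \<in> square_boundary c t" "q2 \<in> square_boundary c t"
      "dist (h c) (h q1) \<le> 2 * dist (h q1) (h q2)"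
      using wide[OF t] by auto
    have "dist (h c) (h p) \<le> 2 * dist (h q1) (h q2) + dist (h q1) (h p)"
      using q(3) dist_triangle[of "h c" "h p" "h q1"] by linarith
    then have "ennreal (dist (h c) (h p)) \<le> ennreal (2 * dist (h q1) (h q2) + dist (h q1) (h p))"
      by (rule ennreal_leI)
    also have "\<dots> = 2 * ennreal (dist (h q1) (h q2)) + ennreal (dist (h q1) (h p))"
      by (simp add: ennreal_plus ennreal_mult')
    also have "\<dots> \<le> 2 * (2 * square_integral c \<rho> t) + 2 * square_integral c \<rho> t"
      by (intro add_mono mult_left_mono dist_square_le sub q p) auto
    also have "\<dots> = (2 * 2 + 2) * square_integral c \<rho> t" by (simp only: distrib_right mult.assoc)
    finally show ?thesis by simp
  qed
  have main: "ennreal (real n * ln 2 + ln (R' / s 0)) \<le> ennreal (real n / 5 + 1)" if n: "s n < R'" for n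
  proof -
    \<comment> \<open>\<open>4608 = 4 * 6\<^sup>2 * 32\<close> collects the square of
      \<open>s k / 2\<close>, the constant of \<open>osc\<close> and that of Cauchy-Schwarz. The
      last term serves the squares whose boundary image lies within the smallest scale: the
      perimeter \<open>8 * t\<close> gives \<open>t / (s n)\<^sup>2\<close>, which is at least
      \<open>1 / t\<close> because \<open>t \<ge> s n\<close>.\<close>
    define F where "F p = (\<Sum>k<n. ennreal (4608 / (s k)\<^sup>2) * ((\<rho> p)\<^sup>2 * indicator (D (s k)) p))
        + ennreal (1 / (8 * (s n)\<^sup>2)) * indicator (D (s n)) p" for p
    have [measurable]: "F \<in> borel_measurable borel" unfolding F_def by measurable
    have pointwise: "ennreal (1 / t) \<le> square_integral c F t" if t: "t \<in> {s n..R'}" for t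
    proof -
      have t0: "0 < t" "t < R" using t s(1)[of n] R' by auto
      define P where "P k \<longleftrightarrow> square_boundary c t \<subseteq> D (s k)" for k
      have "P 0" using R'(3)[of t] t by (simp add: P_def)
      show ?thesis
      proof (cases "P n")
        case True
        have "ennreal (1 / t) \<le> ennreal (t / (s n)\<^sup>2)"
        proof (rule ennreal_leI)
          have "(s n)\<^sup>2 \<le> t\<^sup>2" using t s(1)[of n] by (intro power_mono) auto
          then show "1 / t \<le> t / (s n)\<^sup>2" using t0 s(1)[of n] by (simp add: field_simps power2_eq_square)
        qed
        also have "\<dots> = ennreal (1 / (8 * (s n)\<^sup>2)) * square_integral c (\<lambda>_. 1) t"
          using t0 by (simp add: square_integral_const ennreal_mult'[symmetric] del: ennreal_mult')
        also have "\<dots> = square_integral c (\<lambda>_. ennreal (1 / (8 * (s n)\<^sup>2)) * 1) t"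
          by (rule square_integral_cmult[symmetric]) simp
        also have "\<dots> \<le> square_integral c F t"
        proof (rule square_integral_mono)
          fix p assume "p \<in> square_boundary c t"
          then have "p \<in> D (s n)" using True by (auto simp: P_def)
          then show "ennreal (1 / (8 * (s n)\<^sup>2)) * 1 \<le> F p" by (simp add: F_def)
        qed (use t0 in simp)
        finally show ?thesis .
      next
        case False
        \<comment> \<open>At such a \<open>k\<close> the largest distance from \<open>h c\<close> on
          the boundary image lies between \<open>s k / 2\<close> and \<open>s k\<close>.\<close>
        have "\<exists>k<n. P k \<and> \<not> P (Suc k)"
        proof (rule ccontr)
          assume "\<not> ?thesis"
          then have *: "P (Suc k)" if "k < n" "P k" for k using that by blast
          have "k \<le> n \<Longrightarrow> P k" for k by (induction k) (use \<open>P 0\<close> * in auto)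
          then show False using False by blast
        qed
        then obtain k where k: "k < n" "P k" "\<not> P (Suc k)" by blast
        obtain p where p: "p \<in> square_boundary c t" "p \<notin> D (s (Suc k))" using k(3) by (auto simp: P_def)
        have "p \<in> S" using k(2) p(1) by (auto simp: P_def D_def)
        then have "s k / 2 \<le> dist (h c) (h p)" using p(2) by (simp add: D_def s(3))
        then have "ennreal (s k / 2) \<le> 6 * square_integral c \<rho> t"
          using osc[OF t0 p(1)] by (meson ennreal_leI order_trans)
        then have "(ennreal (s k / 2))\<^sup>2 \<le> (6 * square_integral c \<rho> t)\<^sup>2" by (rule power_mono) simp
        also have "\<dots> = 36 * (square_integral c \<rho> t)\<^sup>2" by (simp add: power_mult_distrib)
        also have "\<dots> \<le> 36 * (ennreal (32 * t) * square_integral c (\<lambda>p. (\<rho> p)\<^sup>2) t)"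
          using t0 by (intro mult_left_mono square_integral_square_le) auto
        also have "\<dots> = ennreal (1152 * t) * square_integral c (\<lambda>p. (\<rho> p)\<^sup>2) t"
          using ennreal_mult[of 36 "32 * t"] t0 by (simp add: mult.assoc[symmetric])
        finally have sq: "ennreal ((s k)\<^sup>2 / 4) \<le> ennreal (1152 * t) * square_integral c (\<lambda>p. (\<rho> p)\<^sup>2) t"
          using s(1)[of k] by (simp add: ennreal_power power_divide)
        have "ennreal (1 / t) = ennreal (4 / ((s k)\<^sup>2 * t)) * ennreal ((s k)\<^sup>2 / 4)"
          using s(1)[of k] t0 by (simp add: ennreal_mult'[symmetric])
        also have "\<dots> \<le> ennreal (4 / ((s k)\<^sup>2 * t)) * (ennreal (1152 * t) * square_integral c (\<lambda>p. (\<rho> p)\<^sup>2) t)"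
          by (intro mult_left_mono sq) simp
        also have "\<dots> = ennreal (4608 / (s k)\<^sup>2) * square_integral c (\<lambda>p. (\<rho> p)\<^sup>2) t"
          using s(1)[of k] t0 by (simp add: mult.assoc[symmetric] ennreal_mult'[symmetric])
        also have "\<dots> = square_integral c (\<lambda>p. ennreal (4608 / (s k)\<^sup>2) * (\<rho> p)\<^sup>2) t"
          by (rule square_integral_cmult[symmetric]) measurable
        also have "\<dots> \<le> square_integral c F t"
        proof (rule square_integral_mono)
          fix p assume "p \<in> square_boundary c t"
          then have "p \<in> D (s k)" using k(2) by (auto simp: P_def)
          then have "ennreal (4608 / (s k)\<^sup>2) * (\<rho> p)\<^sup>2 =
              ennreal (4608 / (s k)\<^sup>2) * ((\<rho> p)\<^sup>2 * indicator (D (s k)) p)" by simp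
          also have "\<dots> \<le> (\<Sum>k<n. ennreal (4608 / (s k)\<^sup>2) * ((\<rho> p)\<^sup>2 * indicator (D (s k)) p))"
            using k(1) by (intro member_le_sum) auto
          also have "\<dots> \<le> F p" unfolding F_def by simp
          finally show "ennreal (4608 / (s k)\<^sup>2) * (\<rho> p)\<^sup>2 \<le> F p" .
        qed (use t0 in simp)
        finally show ?thesis .
      qed
    qed
    have intD: "(\<integral>\<^sup>+ p. (\<rho> p)\<^sup>2 * indicator (D (s k)) p \<partial>lborel) \<le> ennreal (e * (s k)\<^sup>2)"
      "(\<integral>\<^sup>+ p. indicator (D (s k)) p \<partial>lborel) \<le> ennreal (e * (s k)\<^sup>2)" for k
    proof -
      have "(\<integral>\<^sup>+ p. (\<rho> p)\<^sup>2 * indicator (D (s k)) p \<partial>lborel) \<le> (\<integral>\<^sup>+ p \<in> D (s k). (\<rho> p)\<^sup>2 + 1 \<partial>lborel)"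
        "(\<integral>\<^sup>+ p. indicator (D (s k)) p \<partial>lborel) \<le> (\<integral>\<^sup>+ p \<in> D (s k). (\<rho> p)\<^sup>2 + 1 \<partial>lborel)"
        by (intro nn_integral_mono; auto split: split_indicator)+
      then show "(\<integral>\<^sup>+ p. (\<rho> p)\<^sup>2 * indicator (D (s k)) p \<partial>lborel) \<le> ennreal (e * (s k)\<^sup>2)"
        "(\<integral>\<^sup>+ p. indicator (D (s k)) p \<partial>lborel) \<le> ennreal (e * (s k)\<^sup>2)"
        using r0(2)[OF s(1,2), of k] by (blast intro: order_trans)+
    qed
    have "(\<integral>\<^sup>+ p. F p \<partial>lborel) = (\<Sum>k<n. ennreal (4608 / (s k)\<^sup>2) * (\<integral>\<^sup>+ p. (\<rho> p)\<^sup>2 * indicator (D (s k)) p \<partial>lborel))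
        + ennreal (1 / (8 * (s n)\<^sup>2)) * (\<integral>\<^sup>+ p. indicator (D (s n)) p \<partial>lborel)"
      unfolding F_def by (simp add: nn_integral_add nn_integral_sum nn_integral_cmult)
    also have "\<dots> \<le> (\<Sum>k<n. ennreal (4608 / (s k)\<^sup>2) * ennreal (e * (s k)\<^sup>2))
        + ennreal (1 / (8 * (s n)\<^sup>2)) * ennreal (e * (s n)\<^sup>2)"
      by (intro add_mono sum_mono mult_left_mono intD) auto
    also have "\<dots> = (\<Sum>k<n. ennreal (4608 * e)) + ennreal (e / 8)"
    proof -
      have "ennreal (4608 / (s k)\<^sup>2) * ennreal (e * (s k)\<^sup>2) = ennreal (4608 * e)" for k
        using s(1)[of k] by (simp add: ennreal_mult'[symmetric])
      moreover have "ennreal (1 / (8 * (s n)\<^sup>2)) * ennreal (e * (s n)\<^sup>2) = ennreal (e / 8)"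
        using s(1)[of n] by (simp add: ennreal_mult'[symmetric])
      ultimately show ?thesis by simp
    qed
    also have "\<dots> = ennreal (real n * (4608 * e) + e / 8)"
      by (simp add: e_def ennreal_of_nat_eq_real_of_nat ennreal_mult'[symmetric] flip: ennreal_plus)
    finally have intF: "(\<integral>\<^sup>+ p. F p \<partial>lborel) \<le> ennreal (real n * (4608 * e) + e / 8)" .
    \<comment> \<open>The left side is \<open>ln (R' / s n)\<close>, which gains \<open>ln 2\<close>
      with every further scale.\<close>
    have "ennreal (ln R' - ln (s n)) = (\<integral>\<^sup>+ t. ennreal (1 / t) * indicator {s n..R'} t \<partial>lborel)"
      using n s(1)[of n]
      by (intro nn_integral_FTC_Icc[symmetric]) (auto intro!: derivative_eq_intros simp: has_real_derivative_iff_has_vector_derivative[symmetric])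
    also have "\<dots> \<le> (\<integral>\<^sup>+ t \<in> {s n..R'}. square_integral c F t \<partial>lborel)"
      using pointwise by (intro nn_integral_mono) (auto split: split_indicator)
    also have "\<dots> \<le> 4 * (\<integral>\<^sup>+ p. F p \<partial>lborel)" by (rule nn_integral_square_integral_le) measurable
    also have "\<dots> \<le> 4 * ennreal (real n * (4608 * e) + e / 8)" by (intro mult_left_mono intF) simp
    also have "\<dots> = ennreal (4 * (real n * (4608 * e) + e / 8))"
      using ennreal_mult[of 4 "real n * (4608 * e) + e / 8"] by (simp add: e_def)
    also have "\<dots> \<le> ennreal (real n / 5 + 1)" by (intro ennreal_leI) (simp add: e_def)
    also have "ln R' - ln (s n) = real n * ln 2 + ln (R' / s 0)"
      using R'(1) r0(1) by (simp add: s_def ln_div ln_realpow ln_mult)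
    finally show ?thesis .
  qed
  have ln2: "1 / 4 \<le> ln (2 :: real)"
  proof -
    have "1 / 4 \<le> ln (1 + 1 / 2 :: real)"
      using ln_one_plus_pos_lower_bound[of "1 / 2"] by (simp add: power2_eq_square)
    also have "\<dots> \<le> ln 2" by simp
    finally show ?thesis .
  qed
  define l where "l = ln (R' / s 0)"
  \<comment> \<open>\<open>n / 4 + l \<le> n / 5 + 1\<close> fails beyond
    \<open>20 * (1 - l)\<close>; the second bound \<open>n2\<close> makes \<open>s n < R'\<close>,
    so that \<open>main\<close> applies.\<close>
  obtain n1 :: nat where n1: "20 * (1 - l) < real n1" using reals_Archimedean2 by blast
  obtain n2 where n2: "(1 / 2) ^ n2 < R' / s 0"
    using real_arch_pow_inv[of "R' / s 0" "1 / 2"] R'(1) s(1)[of 0] by auto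
  define n where "n = max n1 n2"
  have "s n \<le> s n2" unfolding s_def n_def using r0(1) by (intro divide_left_mono power_increasing) auto
  also have "s n2 = s 0 * (1 / 2) ^ n2" by (simp add: s_def power_one_over)
  also have "\<dots> < R'" using n2 s(1)[of 0] by (simp add: field_simps)
  finally have "real n * ln 2 + l \<le> real n / 5 + 1"
    using main[of n] unfolding l_def by (subst (asm) ennreal_le_iff) auto
  moreover have "real n * (1 / 4) \<le> real n * ln 2" by (intro mult_left_mono ln2) simp
  ultimately have "real n * (1 / 4) + l \<le> real n / 5 + 1" by linarith
  then have "real n \<le> 20 * (1 - l)" by (simp add: field_simps)
  moreover have "real n1 \<le> real n" by (simp add: n_def)
  ultimately show False using n1 by simp
qed

end

section \<open>Comparison with Lebesgue measure\<close>

lemma nn_integral_le_of_emeasure_le: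
  assumes "sets M = sets N" "\<And>A. A \<in> sets M \<Longrightarrow> emeasure M A \<le> c * emeasure N A"
    and "f \<in> borel_measurable M"
  shows "(\<integral>\<^sup>+ x. f x \<partial>M) \<le> c * (\<integral>\<^sup>+ x. f x \<partial>N)"
proof -
  have "M \<le> scale_measure c N"
    using assms(1,2) by (subst le_measure) auto
  then have "(\<integral>\<^sup>+ x. f x \<partial>M) \<le> (\<integral>\<^sup>+ x. f x \<partial>scale_measure c N)"
    using assms(1) by (intro nn_integral_mono_measure) auto
  also have "\<dots> = c * (\<integral>\<^sup>+ x. f x \<partial>N)"
  proof (rule nn_integral_scale_measure)
    show "f \<in> borel_measurable N" using assms(1,3) measurable_cong_sets by blast
  qed
  finally show ?thesis .
qed

lemma emeasure_lborel_le_diameter: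
  fixes A :: "(real \<times> real) set"
  assumes "A \<subseteq> cball p d" "A \<in> sets borel" "0 \<le> d"
  shows "emeasure lborel A \<le> ennreal (4 * d\<^sup>2)"
proof -
  have "A \<subseteq> {fst p - d..fst p + d} \<times> {snd p - d..snd p + d}"
  proof
    fix q assume "q \<in> A"
    then have "dist p q \<le> d" using assms(1) by auto
    then have "dist (fst p) (fst q) \<le> d" "dist (snd p) (snd q) \<le> d"
      using dist_fst_le[of p q] dist_snd_le[of p q] by linarith+
    then show "q \<in> {fst p - d..fst p + d} \<times> {snd p - d..snd p + d}"
      by (auto simp: mem_Times_iff dist_real_def abs_le_iff)
  qed
  then have "emeasure lborel A \<le> emeasure lborel ({fst p - d..fst p + d} \<times> {snd p - d..snd p + d})"
    by (intro emeasure_mono) (auto intro: borel_closed closed_Times)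
  also have "\<dots> = emeasure (lborel \<Otimes>\<^sub>M lborel) ({fst p - d..fst p + d} \<times> {snd p - d..snd p + d})"
    by (simp add: lborel_prod)
  also have "\<dots> = ennreal (2 * d) * ennreal (2 * d)"
    using \<open>0 \<le> d\<close> by (subst lborel.emeasure_pair_measure_Times) auto
  also have "\<dots> = ennreal (4 * d\<^sup>2)"
    using \<open>0 \<le> d\<close> by (simp add: ennreal_mult[symmetric] power2_eq_square)
  finally show ?thesis .
qed

text \<open>The inverse of \<open>\<theta>\<close> is \<open>C\<close>-Lipschitz, so a covering set
  of diameter \<open>d\<close> pulls back into a ball of radius \<open>C * d\<close>, of area at
  most \<open>4 * (C * d)\<^sup>2\<close>. Its cost is \<open>pi * d\<^sup>2 / 4\<close>, and the
  quotient is \<open>16 * C\<^sup>2 / pi\<close>.\<close>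

lemma emeasure_lborel_le_hausdorff:
  fixes \<theta> :: "real \<times> real \<Rightarrow> 'a::metric_space"
  assumes expand: "\<And>p q. p \<in> B \<Longrightarrow> q \<in> B \<Longrightarrow> dist p q \<le> C * dist (\<theta> p) (\<theta> q)"
    and "0 < C" and B: "B \<in> sets borel"
  shows "emeasure lborel B \<le> ennreal (16 * C\<^sup>2 / pi) * hausdorff 2 (\<theta> ` B)"
proof -
  have "ennreal (pi / (16 * C\<^sup>2)) * emeasure lborel B \<le> hausdorff_delta 2 1 (\<theta> ` B)"
    unfolding hausdorff_delta_gauge_cost
  proof (rule INF_greatest)
    fix D :: "nat \<Rightarrow> 'a set" assume "D \<in> {D. \<theta> ` B \<subseteq> (\<Union>i. D i) \<and> (\<forall>i. bounded (D i) \<and> diameter (D i) \<le> 1)}"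
    then have D: "\<theta> ` B \<subseteq> (\<Union>i. D i)" "\<And>i. bounded (D i)" by auto
    \<comment> \<open>If \<open>D i\<close> misses the image of \<open>B\<close>, this centre is
      arbitrary; that is harmless, since the area bound for \<open>K i\<close> holds with every
      centre.\<close>
    define p where "p i = (SOME p. p \<in> B \<and> \<theta> p \<in> D i)" for i
    define K where "K i = (if D i = {} then {} else B \<inter> cball (p i) (C * diameter (D i)))" for i
    have [measurable]: "K i \<in> sets borel" for i using B by (auto simp: K_def)
    have "B \<subseteq> (\<Union>i. K i)"
    proof
      fix q assume q: "q \<in> B"
      then obtain i where i: "\<theta> q \<in> D i" using D(1) by blast
      have "p i \<in> B \<and> \<theta> (p i) \<in> D i" unfolding p_def by (rule someI[of _ q]) (use q i in simp)
      then have "dist (p i) q \<le> C * dist (\<theta> (p i)) (\<theta> q)" "dist (\<theta> (p i)) (\<theta> q) \<le> diameter (D i)"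
        using expand q i diameter_bounded_bound[OF D(2)] by auto
      then have "dist (p i) q \<le> C * diameter (D i)"
        using \<open>0 < C\<close> by (meson mult_left_mono less_imp_le order_trans)
      then have "q \<in> K i" using q i by (auto simp: K_def)
      then show "q \<in> (\<Union>i. K i)" by blast
    qed
    then have "emeasure lborel B \<le> emeasure lborel (\<Union>i. K i)" by (intro emeasure_mono) auto
    also have "\<dots> \<le> (\<Sum>i. emeasure lborel (K i))"
      by (rule emeasure_subadditive_countably) auto
    finally have "ennreal (pi / (16 * C\<^sup>2)) * emeasure lborel B \<le> ennreal (pi / (16 * C\<^sup>2)) * (\<Sum>i. emeasure lborel (K i))"
      by (rule mult_left_mono) simp
    also have "\<dots> = (\<Sum>i. ennreal (pi / (16 * C\<^sup>2)) * emeasure lborel (K i))" by simp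
    also have "\<dots> \<le> (\<Sum>i. gauge_cost 2 (D i))"
    proof (rule suminf_le)
      fix i
      show "ennreal (pi / (16 * C\<^sup>2)) * emeasure lborel (K i) \<le> gauge_cost 2 (D i)"
      proof (cases "D i = {}")
        case False
        have d: "0 \<le> diameter (D i)" by (rule diameter_ge_0[OF D(2)])
        have "emeasure lborel (K i) \<le> ennreal (4 * (C * diameter (D i))\<^sup>2)"
          using d \<open>0 < C\<close> by (intro emeasure_lborel_le_diameter[of _ "p i"]) (auto simp: K_def B)
        then have "ennreal (pi / (16 * C\<^sup>2)) * emeasure lborel (K i)
            \<le> ennreal (pi / (16 * C\<^sup>2)) * ennreal (4 * (C * diameter (D i))\<^sup>2)"
          by (rule mult_left_mono) simp
        also have "\<dots> = ennreal (pi / (16 * C\<^sup>2) * (4 * (C * diameter (D i))\<^sup>2))"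
          by (rule ennreal_mult[symmetric]) auto
        also have "pi / (16 * C\<^sup>2) * (4 * (C * diameter (D i))\<^sup>2) = pi * (diameter (D i) / 2) ^ 2"
          using \<open>0 < C\<close> by (simp add: field_simps power2_eq_square)
        finally show ?thesis using False by (simp add: gauge_cost_def unit_ball_vol_2)
      qed (simp add: K_def)
    qed auto
    finally show "ennreal (pi / (16 * C\<^sup>2)) * emeasure lborel B \<le> (\<Sum>i. gauge_cost 2 (D i))" .
  qed
  also have "\<dots> \<le> hausdorff 2 (\<theta> ` B)" by (rule hausdorff_delta_le_hausdorff) simp
  finally have "ennreal (16 * C\<^sup>2 / pi) * (ennreal (pi / (16 * C\<^sup>2)) * emeasure lborel B)
      \<le> ennreal (16 * C\<^sup>2 / pi) * hausdorff 2 (\<theta> ` B)" by (rule mult_left_mono) simp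
  moreover have "ennreal (16 * C\<^sup>2 / pi) * ennreal (pi / (16 * C\<^sup>2)) = 1"
    using \<open>0 < C\<close> by (subst ennreal_mult[symmetric]) auto
  ultimately show ?thesis by (simp add: mult.assoc[symmetric])
qed

text \<open>Lebesgue measure on the range of \<open>s\<close> is at most \<open>C\<close> times the
  push-forward of Lebesgue measure under \<open>s\<close>. The preimage \<open>Q\<close> is covered
  by non-overlapping intervals of total length close to its measure. By monotonicity
  \<open>s\<close> maps each of them into the interval between its values at the endpoints, and by
  the Lipschitz bound that interval is at most \<open>C\<close> times as long.\<close>

lemma emeasure_monotone_lipschitz_image_le:
  fixes s :: "real \<Rightarrow> real"
  assumes "a \<le> b" "0 < C" and cont: "continuous_on {a..b} s"
    and mono: "\<And>t t'. a \<le> t \<Longrightarrow> t \<le> t' \<Longrightarrow> t' \<le> b \<Longrightarrow> s t \<le> s t'"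
    and lip: "\<And>t t'. a \<le> t \<Longrightarrow> t \<le> t' \<Longrightarrow> t' \<le> b \<Longrightarrow> s t' - s t \<le> C * (t' - t)"
    and P: "P \<in> sets borel" "P \<subseteq> s ` {a..b}"
  shows "emeasure lborel P \<le> ennreal C * emeasure lborel ({a..b} \<inter> s -` P)"
proof -
  define Q where "Q = {a..b} \<inter> s -` P"
  have Q: "Q \<in> sets borel"
    using measurable_sets[OF borel_measurable_continuous_on_restrict[OF cont] P(1)]
    by (simp add: sets_restrict_space_iff space_restrict_space Q_def Int_commute)
  have "emeasure lborel Q \<le> emeasure lborel {a..b}" using Q by (intro emeasure_mono) (auto simp: Q_def)
  also have "\<dots> < \<infinity>" by (simp add: emeasure_lborel_Icc_eq)
  finally have Qfin: "emeasure lborel Q < \<infinity>" .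
  have Qm: "Q \<in> lmeasurable" using Q Qfin by (intro fmeasurableI) auto
  have bound: "emeasure lborel P \<le> ennreal (C * (measure lebesgue Q + e))" if "0 < e" for e
  proof -
    have "Q \<subseteq> cbox a b" by (simp add: Q_def)
    then obtain \<D> where D: "countable \<D>" "\<And>K. K \<in> \<D> \<Longrightarrow> K \<subseteq> cbox a b \<and> K \<noteq> {} \<and> (\<exists>c d. K = cbox c d)"
      "pairwise (\<lambda>A B. interior A \<inter> interior B = {}) \<D>" "Q \<subseteq> \<Union>\<D>" "\<Union>\<D> \<in> lmeasurable"
      "measure lebesgue (\<Union>\<D>) \<le> measure lebesgue Q + e"
      by (rule measurable_outer_intervals_bounded[OF Qm _ \<open>0 < e\<close>]) (rule that; assumption)
    \<comment> \<open>\<open>Inf\<close> and \<open>Sup\<close> recover the endpoints, so that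
      \<open>J\<close> depends on the interval as a set.\<close>
    define J where "J K = {s (Inf K)..s (Sup K)}" for K
    have K: "\<exists>c d. K = {c..d} \<and> a \<le> c \<and> c \<le> d \<and> d \<le> b \<and> J K = {s c..s d}" if KD: "K \<in> \<D>" for K
    proof -
      obtain c d where "K = {c..d}" "{c..d} \<noteq> {}" "{c..d} \<subseteq> {a..b}"
        using D(2)[OF KD] unfolding box_real by blast
      then show ?thesis by (intro exI[of _ c] exI[of _ d]) (auto simp: J_def)
    qed
    have "P \<subseteq> (\<Union>K\<in>\<D>. J K)"
    proof
      fix r assume "r \<in> P"
      obtain t where t': "t \<in> {a..b}" "r = s t" using \<open>r \<in> P\<close> P(2) by blast
      then have t: "t \<in> Q" "r = s t" using \<open>r \<in> P\<close> by (auto simp: Q_def)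
      then obtain L where L: "L \<in> \<D>" "t \<in> L" using D(4) by blast
      then obtain c d where "L = {c..d}" "a \<le> c" "d \<le> b" "J L = {s c..s d}" using K by blast
      then have "r \<in> J L" using L(2) mono[of c t] mono[of t d] t(2) by auto
      then show "r \<in> (\<Union>K\<in>\<D>. J K)" using L(1) by blast
    qed
    \<comment> \<open>A bound for finite subfamilies passes to the countable union. Non-overlapping
      intervals meet in negligible sets, so their lengths add up.\<close>
    have fin: "measure lebesgue (\<Union>K\<in>D'. J K) \<le> C * (measure lebesgue Q + e)" if D': "D' \<subseteq> \<D>" "finite D'" for D'
    proof -
      have Klm: "K \<in> lmeasurable" if "K \<in> D'" for K using K[of K] D' that by auto
      have "measure lebesgue (\<Union>K\<in>D'. J K) \<le> (\<Sum>K\<in>D'. measure lebesgue (J K))"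
        using D' by (intro measure_UNION_le) (auto simp: J_def)
      also have "\<dots> \<le> (\<Sum>K\<in>D'. C * measure lebesgue K)"
      proof (rule sum_mono)
        fix L assume "L \<in> D'"
        then obtain c d where cd: "L = {c..d}" "a \<le> c" "c \<le> d" "d \<le> b" "J L = {s c..s d}" using K D' by blast
        then show "measure lebesgue (J L) \<le> C * measure lebesgue L"
          using mono[of c d] lip[of c d] by simp
      qed
      also have "\<dots> = C * measure lebesgue (\<Union>D')"
      proof -
        have "pairwise (\<lambda>A B. negligible (A \<inter> B)) D'"
          unfolding pairwise_def
        proof (intro ballI impI)
          fix A B assume AB: "A \<in> D'" "B \<in> D'" "A \<noteq> B"
          then obtain c d c' d' where "A = {c..d}" "B = {c'..d'}" using K D'(1) by (meson subsetD)
          then have "convex (A \<inter> B)" by (simp add: convex_Int)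
          moreover have "interior (A \<inter> B) = {}" using D(3) AB D'(1) by (auto simp: pairwise_def)
          ultimately show "negligible (A \<inter> B)" using negligible_convex_interior by blast
        qed
        from measure_negligible_finite_Union[OF D'(2) Klm this] show ?thesis by (simp add: sum_distrib_left)
      qed
      also have "\<dots> \<le> C * measure lebesgue (\<Union>\<D>)"
        using \<open>0 < C\<close> D' D(5) Klm by (intro mult_left_mono measure_mono_fmeasurable) (auto intro: fmeasurableD fmeasurable.finite_Union)
      also have "\<dots> \<le> C * (measure lebesgue Q + e)" using \<open>0 < C\<close> D(6) by (intro mult_left_mono) auto
      finally show ?thesis .
    qed
    have Jm: "J K \<in> lmeasurable" for K by (simp add: J_def)
    have U: "(\<Union>K\<in>\<D>. J K) \<in> lmeasurable" "measure lebesgue (\<Union>K\<in>\<D>. J K) \<le> C * (measure lebesgue Q + e)"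
      using fmeasurable_UN_bound[OF D(1) Jm fin] measure_UN_bound[OF D(1) Jm fin] by auto
    have "emeasure lborel P = emeasure lebesgue P" using P(1) by simp
    also have "\<dots> \<le> emeasure lebesgue (\<Union>K\<in>\<D>. J K)"
      using \<open>P \<subseteq> (\<Union>K\<in>\<D>. J K)\<close> U(1) by (intro emeasure_mono) (auto intro: fmeasurableD)
    also have "\<dots> = ennreal (measure lebesgue (\<Union>K\<in>\<D>. J K))" using U(1) by (simp add: emeasure_eq_measure2)
    also have "\<dots> \<le> ennreal (C * (measure lebesgue Q + e))" by (intro ennreal_leI U)
    finally show ?thesis .
  qed
  have "emeasure lborel P \<le> ennreal (C * measure lebesgue Q) + ennreal e" if "0 < e" for e
    using bound[of "e / C"] that \<open>0 < C\<close> by (simp add: distrib_left)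
  then have "emeasure lborel P \<le> ennreal (C * measure lebesgue Q)" by (rule ennreal_le_epsilon)
  also have "\<dots> = ennreal C * emeasure lborel Q"
  proof -
    have "emeasure lborel Q = emeasure lebesgue Q" using Q by simp
    also have "\<dots> = ennreal (measure lebesgue Q)" by (rule emeasure_eq_measure2[OF Qm])
    finally show ?thesis using \<open>0 < C\<close> by (simp add: ennreal_mult)
  qed
  finally show ?thesis by (simp add: Q_def)
qed

section \<open>Line integrals in a Lipschitz parameter\<close>

lemma continuous_on_lipschitz_increments:
  fixes f :: "real \<Rightarrow> 'a::metric_space"
  assumes "\<And>t t'. a \<le> t \<Longrightarrow> t \<le> t' \<Longrightarrow> t' \<le> b \<Longrightarrow> dist (f t) (f t') \<le> C * (t' - t)" "0 \<le> C"
  shows "continuous_on {a..b} f"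
proof (rule lipschitz_on_continuous_on, rule lipschitz_onI)
  fix t t' assume "t \<in> {a..b}" "t' \<in> {a..b}"
  then show "dist (f t) (f t') \<le> C * dist t t'"
    using assms(1)[of t t'] assms(1)[of t' t] by (cases "t \<le> t'") (auto simp: dist_real_def dist_commute)
qed fact

text \<open>\<open>line_integral\<close> integrates over arc length. The length function
  \<open>s\<close> is monotone and \<open>C\<close>-Lipschitz in the parameter, so Lebesgue measure
  on \<open>{0..s b}\<close> is at most \<open>C\<close> times the push-forward under
  \<open>s\<close> of Lebesgue measure on \<open>{a..b}\<close>; integrating \<open>\<rho>\<close>
  along the arc-length parametrization gives the bound. Finite length is recorded because an upper
  gradient is tested on rectifiable curves.\<close>

lemma line_integral_le:
  fixes \<gamma> :: "real \<Rightarrow> 'a::metric_space"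
  assumes "a \<le> b" "0 < C"
    and lip: "\<And>s t. a \<le> s \<Longrightarrow> s \<le> t \<Longrightarrow> t \<le> b \<Longrightarrow> dist (\<gamma> s) (\<gamma> t) \<le> C * (t - s)"
    and \<rho>: "(\<lambda>x. \<rho> x * indicator U x) \<in> borel_measurable borel" "\<gamma> ` {a..b} \<subseteq> U"
  shows "line_integral a b \<gamma> \<rho> \<le> ennreal C * (\<integral>\<^sup>+ t \<in> {a..b}. \<rho> (\<gamma> t) \<partial>lborel)"
    and "curve_length {a..b} \<gamma> < \<infinity>"
proof -
  define s where "s t = enn2real (curve_length {a..t} \<gamma>)" for t
  define f where "f r = \<rho> (\<gamma> (inv_into {a..b} s r))" for r
  have len_a: "curve_length {a} \<gamma> = 0"
  proof -
    have "curve_length {a} \<gamma> \<le> 0"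
      unfolding curve_length_eq_chain_length
    proof (rule SUP_least)
      fix ts assume ts: "ts \<in> {ts. sorted ts \<and> set ts \<subseteq> {a}}"
      have "chain_length \<gamma> ts \<le> 0"
      proof (cases "ts = []")
        case False
        have "chain_length \<gamma> ts \<le> (\<lambda>_. 0) (last ts) - (\<lambda>_. 0) (hd ts)"
          using ts False by (intro chain_length_le_increment[of "{a}"]) auto
        then show ?thesis by simp
      qed simp
      then show "ennreal (chain_length \<gamma> ts) \<le> 0" by (simp add: ennreal_neg)
    qed
    then show ?thesis by simp
  qed
  have ext: "curve_length {a..t'} \<gamma> \<le> curve_length {a..t} \<gamma> + ennreal (C * (t' - t))"
    if "a \<le> t" "t \<le> t'" "t' \<le> b" for t t'
    using that \<open>0 < C\<close> by (intro curve_length_extend_le lip) auto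
  have fin: "curve_length {a..t} \<gamma> < \<infinity>" if "a \<le> t" "t \<le> b" for t
    using le_less_trans[OF ext[of a t], of \<infinity>] that by (simp add: len_a)
  then show "curve_length {a..b} \<gamma> < \<infinity>" using \<open>a \<le> b\<close> by simp
  have s_eq: "curve_length {a..t} \<gamma> = ennreal (s t)" if "a \<le> t" "t \<le> b" for t
    using fin[OF that] by (simp add: s_def)
  have s0: "0 \<le> s t" for t by (simp add: s_def)
  have sa: "s a = 0" by (simp add: s_def len_a)
  have s_dist: "dist (\<gamma> t) (\<gamma> t') \<le> s t' - s t" if "a \<le> t" "t \<le> t'" "t' \<le> b" for t t'
    unfolding s_def using that fin[of t'] by (intro dist_le_curve_length_diff) auto
  have s_lip: "s t' - s t \<le> C * (t' - t)" if "a \<le> t" "t \<le> t'" "t' \<le> b" for t t'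
  proof -
    have "ennreal (s t') \<le> ennreal (s t) + ennreal (C * (t' - t))"
      using ext[OF that] that by (simp add: s_eq)
    also have "\<dots> = ennreal (s t + C * (t' - t))"
      using that \<open>0 < C\<close> by (intro ennreal_plus[symmetric] s0) simp
    finally have "s t' \<le> s t + C * (t' - t)"
      using that \<open>0 < C\<close> s0[of t] by (subst (asm) ennreal_le_iff) auto
    then show ?thesis by simp
  qed
  have s_mono: "s t \<le> s t'" if "a \<le> t" "t \<le> t'" "t' \<le> b" for t t'
    using order_trans[OF zero_le_dist s_dist[OF that]] by simp
  have s_cont: "continuous_on {a..b} s"
    using s_lip s_mono \<open>0 < C\<close> by (intro continuous_on_lipschitz_increments[where C = C]) (simp_all add: dist_real_def)
  have img: "s ` {a..b} = {0..s b}"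
  proof
    show "s ` {a..b} \<subseteq> {0..s b}" using s0 s_mono by auto
    show "{0..s b} \<subseteq> s ` {a..b}"
    proof
      fix r assume "r \<in> {0..s b}"
      then obtain t where "a \<le> t" "t \<le> b" "s t = r"
        using IVT'[of s a r b] s_cont \<open>a \<le> b\<close> sa by auto
      then show "r \<in> s ` {a..b}" by auto
    qed
  qed
  have fs: "f (s t) = \<rho> (\<gamma> t)" if t: "t \<in> {a..b}" for t
  proof -
    define t' where "t' = inv_into {a..b} s (s t)"
    have "s t \<in> s ` {a..b}" using t by (rule imageI)
    then have t': "t' \<in> {a..b}" "s t' = s t" unfolding t'_def by (rule inv_into_into f_inv_into_f)+
    then have "dist (\<gamma> t) (\<gamma> t') \<le> 0"
      using s_dist[of t t'] s_dist[of t' t] t by (cases "t \<le> t'") (auto simp: dist_commute)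
    then show ?thesis by (simp add: f_def t'_def)
  qed
  \<comment> \<open>Clamping the parameter makes the length function continuous, hence Borel, on the
    whole line.\<close>
  define s' where "s' t = s (max a (min b t))" for t
  have s'_eq: "s' t = s t" if "t \<in> {a..b}" for t using that by (simp add: s'_def)
  have s'_meas [measurable]: "s' \<in> borel_measurable borel"
  proof (rule borel_measurable_continuous_onI)
    show "continuous_on UNIV s'"
      unfolding s'_def using \<open>a \<le> b\<close>
      by (intro continuous_on_compose2[OF s_cont] continuous_intros) auto
  qed
  define M where "M = distr (density lborel (indicator {a..b})) borel s'"
  define N where "N = density (lborel :: real measure) (indicator {0..s b})"
  \<comment> \<open>The clamped arc-length parametrization. It is 1-Lipschitz and therefore Borel,
    which the choice made by \<open>inv_into\<close> does not show; measurability of the integrand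
    \<open>f\<close> on \<open>{0..s b}\<close> follows.\<close>
  define g where "g r = \<gamma> (inv_into {a..b} s (max 0 (min (s b) r)))" for r
  have [measurable]: "g \<in> borel_measurable borel"
  proof (rule borel_measurable_continuous_onI, rule lipschitz_on_continuous_on[of 1])
    have clamp: "max 0 (min (s b) r) \<in> s ` {a..b}" for r unfolding img using s0[of b] by auto
    show "1-lipschitz_on UNIV g"
    proof (rule lipschitz_onI)
      fix r r' :: real
      define t t' where "t = inv_into {a..b} s (max 0 (min (s b) r))"
        and "t' = inv_into {a..b} s (max 0 (min (s b) r'))"
      have t: "t \<in> {a..b}" "t' \<in> {a..b}" "s t = max 0 (min (s b) r)" "s t' = max 0 (min (s b) r')"
        unfolding t_def t'_def by (rule inv_into_into f_inv_into_f, rule clamp)+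
      have "dist (\<gamma> t) (\<gamma> t') \<le> \<bar>s t - s t'\<bar>"
        using s_dist[of t t'] s_dist[of t' t] t(1,2) by (cases "t \<le> t'") (auto simp: dist_commute)
      also have "\<dots> \<le> \<bar>r - r'\<bar>" unfolding t(3,4) by (auto simp: max_def min_def)
      finally show "dist (g r) (g r') \<le> 1 * dist r r'" by (simp add: g_def t_def t'_def dist_real_def)
    qed simp
  qed
  have gU: "g r \<in> U" for r
  proof -
    have "max 0 (min (s b) r) \<in> s ` {a..b}" unfolding img using s0[of b] by auto
    then have "inv_into {a..b} s (max 0 (min (s b) r)) \<in> {a..b}" by (rule inv_into_into)
    then show ?thesis using \<rho>(2) by (auto simp: g_def)
  qed
  have fg: "f r * indicator {0..s b} r = (\<rho> (g r) * indicator U (g r)) * indicator {0..s b} r" for r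
    using gU[of r] by (auto simp: f_def g_def split: split_indicator)
  have f_meas [measurable]: "(\<lambda>r. f r * indicator {0..s b} r) \<in> borel_measurable borel"
  proof -
    have "(\<lambda>r. \<rho> (g r) * indicator U (g r)) \<in> borel_measurable borel"
      by (rule measurable_compose[OF \<open>g \<in> borel_measurable borel\<close> \<rho>(1)])
    then show ?thesis unfolding fg by (rule borel_measurable_times_ennreal) simp
  qed
  have "line_integral a b \<gamma> \<rho> = (\<integral>\<^sup>+ r. f r * indicator {0..s b} r \<partial>lborel)"
    by (simp add: line_integral_def f_def s_def[abs_def])
  also have "\<dots> = (\<integral>\<^sup>+ r. f r * indicator {0..s b} r \<partial>N)"
    unfolding N_def using f_meas by (subst nn_integral_density) (auto intro!: nn_integral_cong split: split_indicator)
  also have "\<dots> \<le> ennreal C * (\<integral>\<^sup>+ r. f r * indicator {0..s b} r \<partial>M)"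
  proof (rule nn_integral_le_of_emeasure_le)
    fix A assume "A \<in> sets N"
    then have "A \<in> sets borel" by (simp add: N_def)
    have "s' -` A \<in> sets borel" using measurable_sets[OF s'_meas \<open>A \<in> sets borel\<close>] by simp
    have "emeasure N A = emeasure lborel (A \<inter> {0..s b})"
      unfolding N_def using \<open>A \<in> sets borel\<close> by (subst emeasure_restricted) (auto simp: Int_commute)
    also have "\<dots> \<le> ennreal C * emeasure lborel ({a..b} \<inter> s -` (A \<inter> {0..s b}))"
      by (rule emeasure_monotone_lipschitz_image_le) (use assms(1,2) s_cont s_mono s_lip img \<open>A \<in> sets borel\<close> in auto)
    also have "{a..b} \<inter> s -` (A \<inter> {0..s b}) = {a..b} \<inter> s' -` A"
      using img s'_eq by auto
    also have "emeasure lborel ({a..b} \<inter> s' -` A) = emeasure M A"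
      unfolding M_def using \<open>A \<in> sets borel\<close> \<open>s' -` A \<in> sets borel\<close> by (subst emeasure_distr; (subst emeasure_restricted)?) auto
    finally show "emeasure N A \<le> ennreal C * emeasure M A" .
  qed (use f_meas in \<open>auto simp: N_def M_def\<close>)
  also have "(\<integral>\<^sup>+ r. f r * indicator {0..s b} r \<partial>M) = (\<integral>\<^sup>+ t \<in> {a..b}. \<rho> (\<gamma> t) \<partial>lborel)"
  proof -
    have "(\<integral>\<^sup>+ r. f r * indicator {0..s b} r \<partial>M) =
        (\<integral>\<^sup>+ t. f (s' t) * indicator {0..s b} (s' t) \<partial>density lborel (indicator {a..b}))"
      unfolding M_def by (rule nn_integral_distr) measurable
    also have "\<dots> = (\<integral>\<^sup>+ t. indicator {a..b} t * (f (s' t) * indicator {0..s b} (s' t)) \<partial>lborel)"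
      by (rule nn_integral_density) measurable
    also have "\<dots> = (\<integral>\<^sup>+ t \<in> {a..b}. \<rho> (\<gamma> t) \<partial>lborel)"
      using fs s'_eq img by (intro nn_integral_cong) (auto split: split_indicator)
    finally show ?thesis .
  qed
  finally show "line_integral a b \<gamma> \<rho> \<le> ennreal C * (\<integral>\<^sup>+ t \<in> {a..b}. \<rho> (\<gamma> t) \<partial>lborel)" .
qed

section \<open>Coordinates on a Riemannian surface\<close>

text \<open>Unlike in the library's \<open>nn_integral_cmult\<close>, \<open>f\<close> need not be measurable.\<close>

lemma mult_nn_integral_le: "c * (\<integral>\<^sup>+ x. f x \<partial>M) \<le> (\<integral>\<^sup>+ x. c * f x \<partial>M)"
proof -
  have "c * (\<integral>\<^sup>+ x. f x \<partial>M) = (SUP h\<in>{h. simple_function M h \<and> h \<le> f}. c * integral\<^sup>S M h)"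
    unfolding nn_integral_def by (rule SUP_mult_left_ennreal)
  also have "\<dots> \<le> (\<integral>\<^sup>+ x. c * f x \<partial>M)"
  proof (rule SUP_least)
    fix h assume "h \<in> {h. simple_function M h \<and> h \<le> f}"
    then have h: "simple_function M h" "h \<le> f" by auto
    have "c * integral\<^sup>S M h = (\<integral>\<^sup>+ x. c * h x \<partial>M)"
      using h(1) by (simp add: nn_integral_cmult borel_measurable_simple_function nn_integral_eq_simple_integral)
    also have "\<dots> \<le> (\<integral>\<^sup>+ x. c * f x \<partial>M)" using h(2) by (intro nn_integral_mono mult_left_mono) (auto simp: le_fun_def)
    finally show "c * integral\<^sup>S M h \<le> (\<integral>\<^sup>+ x. c * f x \<partial>M)" .
  qed
  finally show ?thesis .
qed

text \<open>The derivative may be unbounded near the finitely many exceptional points. If the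
  integral of its norm is infinite there is nothing to show; otherwise it is Lebesgue integrable,
  and the fundamental theorem for the Henstock-Kurzweil integral, which tolerates the exceptional
  points, gives the value of its integral.\<close>

lemma norm_diff_le_nn_integral_deriv:
  fixes f :: "real \<Rightarrow> 'a::euclidean_space"
  assumes "a \<le> b" "f piecewise_C1_differentiable_on {a..b}"
  shows "ennreal (norm (f b - f a)) \<le> (\<integral>\<^sup>+ t \<in> {a..b}. ennreal (norm (vector_derivative f (at t))) \<partial>lborel)"
    (is "_ \<le> ?I")
proof (cases "?I = \<infinity>")
  case False
  obtain S D where S: "continuous_on {a..b} f" "finite S"
    "\<And>t. t \<in> {a..b} - S \<Longrightarrow> (f has_vector_derivative D t) (at t)" "continuous_on ({a..b} - S) D"
    using assms(2) unfolding piecewise_C1_differentiable_on_def C1_differentiable_on_def by blast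
  define E where "E t = indicator ({a..b} - S) t *\<^sub>R D t" for t
  have [measurable]: "{a..b} - S \<in> sets borel"
    using S(2) by (intro sets.Diff) (auto intro: borel_closed finite_imp_closed)
  have [measurable]: "E \<in> borel_measurable borel"
    unfolding E_def by (rule borel_measurable_continuous_on_indicator[OF _ S(4)]) measurable
  have "(\<integral>\<^sup>+ t. ennreal (norm (E t)) \<partial>lborel) \<le> ?I"
    by (intro nn_integral_mono) (auto simp: E_def vector_derivative_at[OF S(3)] split: split_indicator)
  with False have int: "integrable lborel E"
    by (intro integrableI_bounded) (auto simp: less_top[symmetric] top_unique)
  then have "(E has_integral integral\<^sup>L lborel E) UNIV" by (rule has_integral_integral_lborel)
  moreover have "(\<lambda>t. if t \<in> {a..b} then E t else 0) = E" by (auto simp: E_def fun_eq_iff)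
  ultimately have 1: "(E has_integral integral\<^sup>L lborel E) {a..b}"
    using has_integral_restrict_UNIV[of "{a..b}" E] by simp
  have "(D has_integral (f b - f a)) {a..b}"
    using S by (intro fundamental_theorem_of_calculus_interior_strong[OF S(2) assms(1)]) auto
  then have "(E has_integral (f b - f a)) {a..b}"
    by (rule has_integral_spike_finite[OF S(2), rotated]) (simp add: E_def)
  with 1 have "f b - f a = integral\<^sup>L lborel E" using has_integral_unique by blast
  then have "norm (f b - f a) \<le> integral\<^sup>L lborel (\<lambda>t. norm (E t))" by simp
  then have "ennreal (norm (f b - f a)) \<le> ennreal (integral\<^sup>L lborel (\<lambda>t. norm (E t)))" by (rule ennreal_leI)
  also have "\<dots> = (\<integral>\<^sup>+ t. ennreal (norm (E t)) \<partial>lborel)"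
    using int by (intro nn_integral_eq_integral[symmetric]) auto
  also have "\<dots> \<le> ?I" by fact
  finally show ?thesis .
qed simp

section \<open>Charts, and coordinate distance against Riemannian distance\<close>

lemma is_chartD:
  assumes "is_chart c"
  shows "open (fst c)" "open (chart_image c)"
    "\<And>z. z \<in> fst c \<Longrightarrow> chart_inv c (snd c z) = z" "\<And>x. x \<in> chart_image c \<Longrightarrow> snd c (chart_inv c x) = x"
    "\<And>x. x \<in> chart_image c \<Longrightarrow> chart_inv c x \<in> fst c"
    "continuous_on (fst c) (snd c)" "continuous_on (chart_image c) (chart_inv c)"
  using assms unfolding is_chart_def homeomorphism_def by blast+

lemma is_chart_open_image:
  assumes "is_chart c" "open W" "W \<subseteq> chart_image c"
  shows "open (chart_inv c ` W)"
proof -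
  have "homeomorphism (chart_image c) (fst c) (chart_inv c) (snd c)"
    using assms(1) unfolding is_chart_def by (simp add: homeomorphism_symD)
  then have "openin (top_of_set (fst c)) (chart_inv c ` W)"
    using assms by (intro homeomorphism_imp_open_map) (auto simp: open_subset)
  then show ?thesis using openin_open_eq[OF is_chartD(1)[OF assms(1)]] by blast
qed

lemma is_chart_open_coordinates:
  assumes "is_chart c" "open W"
  shows "open (snd c ` (fst c \<inter> W))"
proof -
  have "homeomorphism (fst c) (chart_image c) (snd c) (chart_inv c)"
    using assms(1) unfolding is_chart_def by simp
  then have "openin (top_of_set (chart_image c)) (snd c ` (fst c \<inter> W))"
    using assms is_chartD(1)[OF assms(1)] by (intro homeomorphism_imp_open_map) (auto simp: open_subset)
  then show ?thesis using openin_open_eq[OF is_chartD(2)[OF assms(1)]] by blast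
qed

locale riemannian_surface =
  fixes \<A> :: "'m::metric_space chart set" and g :: "'m metric_tensor"
  assumes riem: "riemannian_2_manifold \<A> g"
begin

lemma charts: "c \<in> \<A> \<Longrightarrow> is_chart c" "(\<Union>c\<in>\<A>. fst c) = UNIV"
  "c \<in> \<A> \<Longrightarrow> c' \<in> \<A> \<Longrightarrow> compatible c c'"
  using riem unfolding riemannian_2_manifold_def smooth_structure_def by blast+

lemma metric_transforms:
  assumes "c \<in> \<A>" "c' \<in> \<A>" "x \<in> snd c ` (fst c \<inter> fst c')"
  shows "g c x = transpose (jacobian (transition c c') (at x)) ** g c' (transition c c' x) ** jacobian (transition c c') (at x)"
  using riem assms unfolding riemannian_2_manifold_def riemannian_metric_def Let_def by blast

lemma transition_smooth:
  assumes "c \<in> \<A>" "c' \<in> \<A>"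
  shows "\<And>x. x \<in> snd c ` (fst c \<inter> fst c') \<Longrightarrow> transition c c' differentiable at x"
    "continuous_on (snd c ` (fst c \<inter> fst c')) (partial i (transition c c'))"
proof -
  have "Ck_on (Suc 0) (transition c c') (snd c ` (fst c \<inter> fst c'))"
    using charts(3)[OF assms] unfolding compatible_def smooth_on_def by blast
  then show "\<And>x. x \<in> snd c ` (fst c \<inter> fst c') \<Longrightarrow> transition c c' differentiable at x"
    and "continuous_on (snd c ` (fst c \<inter> fst c')) (partial i (transition c c'))"
    unfolding Ck_on.simps by blast+
qed

text \<open>The chart inside \<open>riemannian_speed\<close> is an arbitrary choice at every
  \<open>t\<close>. Near \<open>t\<close> the curve stays in both charts, so the chain rule
  multiplies the velocity by the Jacobian of the transition map, and the transformation law of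
  \<open>g\<close> absorbs it.\<close>

lemma riemannian_speed_eq:
  assumes c: "c \<in> \<A>" and \<gamma>: "isCont \<gamma> t" "\<gamma> t \<in> fst c"
    and v: "((snd c \<circ> \<gamma>) has_vector_derivative v) (at t)"
  shows "riemannian_speed \<A> g \<gamma> t = sqrt (v \<bullet> (g c (snd c (\<gamma> t)) *v v))"
proof -
  define c' where "c' = (SOME c. c \<in> \<A> \<and> \<gamma> t \<in> fst c)"
  have "c' \<in> \<A> \<and> \<gamma> t \<in> fst c'" unfolding c'_def by (rule someI[of _ c]) (use assms in simp)
  then have c': "c' \<in> \<A>" "\<gamma> t \<in> fst c'" by auto
  define x where "x = snd c (\<gamma> t)"
  define J where "J = jacobian (transition c c') (at x)"
  have x: "x \<in> snd c ` (fst c \<inter> fst c')" using \<gamma>(2) c'(2) by (auto simp: x_def)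
  have "(transition c c' has_derivative (\<lambda>h. J *v h)) (at x)"
    unfolding J_def using transition_smooth(1)[OF c c'(1) x] jacobian_works by blast
  then have comp: "((transition c c' \<circ> (snd c \<circ> \<gamma>)) has_vector_derivative (J *v v)) (at t)"
    by (intro vector_derivative_diff_chain_within[OF v]) (simp add: x_def has_derivative_at_withinI)
  have "open (fst c \<inter> fst c')" using is_chartD(1) charts(1) c c'(1) by blast
  moreover have "(\<gamma> \<longlongrightarrow> \<gamma> t) (nhds t)"
    using \<gamma>(1) by (simp add: isCont_def tendsto_at_iff_tendsto_nhds)
  ultimately have "\<forall>\<^sub>F s in nhds t. \<gamma> s \<in> fst c \<inter> fst c'"
    using \<gamma>(2) c'(2) by (intro topological_tendstoD) auto
  then obtain d where d: "0 < d" "\<And>s. dist s t < d \<Longrightarrow> \<gamma> s \<in> fst c \<inter> fst c'"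
    unfolding eventually_nhds_metric by blast
  have "(transition c c' \<circ> (snd c \<circ> \<gamma>)) s = (snd c' \<circ> \<gamma>) s" if "dist s t < d" for s
    using d(2)[OF that] is_chartD(3)[OF charts(1)[OF c]] by (simp add: transition_def)
  then have "((snd c' \<circ> \<gamma>) has_vector_derivative (J *v v)) (at t)"
    by (intro has_vector_derivative_transform_within[OF comp d(1)]) auto
  then have v': "vector_derivative (snd c' \<circ> \<gamma>) (at t) = J *v v" by (rule vector_derivative_at)
  have "transition c c' x = snd c' (\<gamma> t)"
    using is_chartD(3)[OF charts(1)[OF c] \<gamma>(2)] by (simp add: transition_def x_def)
  then have "g c x = transpose J ** g c' (snd c' (\<gamma> t)) ** J"
    using metric_transforms[OF c c'(1) x] by (simp add: J_def)
  then have "v \<bullet> (g c x *v v) = (J *v v) \<bullet> (g c' (snd c' (\<gamma> t)) *v (J *v v))"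
    using dot_lmul_matrix[of v "transpose J" "g c' (snd c' (\<gamma> t)) *v (J *v v)"]
    by (simp only: matrix_vector_mul_assoc[symmetric] vector_transpose_matrix)
  then show ?thesis
    unfolding riemannian_speed_def Let_def c'_def[symmetric] v' x_def by simp
qed

text \<open>Extrema of the quadratic form over the compact set of pairs of a point of
  \<open>K\<close> and a unit vector, extended by homogeneity.\<close>

lemma quadratic_bounds:
  assumes c: "c \<in> \<A>" and K: "compact K" "K \<subseteq> chart_image c" "K \<noteq> {}"
  obtains l u where "0 < l" "0 < u"
    "\<And>x v. x \<in> K \<Longrightarrow> (l * norm v)\<^sup>2 \<le> v \<bullet> (g c x *v v)"
    "\<And>x v. x \<in> K \<Longrightarrow> v \<bullet> (g c x *v v) \<le> (u * norm v)\<^sup>2"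
proof -
  define q where "q = (\<lambda>(x, v). v \<bullet> (g c x *v v))"
  have "continuous_on (chart_image c) (g c)" and pos: "\<And>x v. x \<in> chart_image c \<Longrightarrow> v \<noteq> 0 \<Longrightarrow> 0 < v \<bullet> (g c x *v v)"
    using riem c unfolding riemannian_2_manifold_def riemannian_metric_def smooth_on_def
    by (metis Ck_on.simps(1), blast)
  then have gK: "continuous_on (K \<times> sphere 0 1) (\<lambda>p :: (real^2) \<times> (real^2). g c (fst p))"
    using K(2) by (intro continuous_on_compose2[of "chart_image c" "g c" _ fst] continuous_on_fst continuous_on_id) auto
  have q_eq: "q = (\<lambda>p. \<Sum>i\<in>UNIV. \<Sum>j\<in>UNIV. snd p $ i * (g c (fst p) $ i $ j * snd p $ j))"
    by (simp add: q_def inner_vec_def matrix_vector_mult_def sum_distrib_left case_prod_unfold)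
  have cont: "continuous_on (K \<times> sphere 0 1) q"
    unfolding q_eq by (intro continuous_on_sum continuous_on_mult continuous_on_component continuous_on_snd continuous_on_id gK)
  have comp: "compact (K \<times> sphere (0 :: real^2) 1)" by (intro compact_Times K) simp
  obtain e :: "real^2" where "norm e = 1" using vector_choose_size[of 1] by auto
  then have ne: "K \<times> sphere (0 :: real^2) 1 \<noteq> {}" using K(3) by auto
  obtain p where p: "p \<in> K \<times> sphere 0 1" "\<And>y. y \<in> K \<times> sphere 0 1 \<Longrightarrow> q p \<le> q y"
    using continuous_attains_inf[OF comp ne cont] by blast
  obtain p' where p': "p' \<in> K \<times> sphere 0 1" "\<And>y. y \<in> K \<times> sphere 0 1 \<Longrightarrow> q y \<le> q p'"
    using continuous_attains_sup[OF comp ne cont] by blast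
  have qp: "0 < q p"
  proof -
    have "fst p \<in> chart_image c" "norm (snd p) = 1" using p(1) K(2) by auto
    then have "0 < snd p \<bullet> (g c (fst p) *v snd p)" by (intro pos) auto
    then show ?thesis by (simp add: q_def case_prod_unfold)
  qed
  then have qp': "0 < q p'" using p'(2)[OF p(1)] by simp
  have scale: "v \<bullet> (g c x *v v) = q (x, v /\<^sub>R norm v) * (norm v)\<^sup>2" if "v \<noteq> 0" for x v
    using that by (simp add: q_def matrix_vector_mult_scaleR power2_eq_square field_simps)
  show ?thesis
  proof (rule that[of "sqrt (q p)" "sqrt (q p')"])
    fix x v assume x: "x \<in> K"
    show "(sqrt (q p) * norm v)\<^sup>2 \<le> v \<bullet> (g c x *v v)"
    proof (cases "v = 0")
      case False
      then have "q p \<le> q (x, v /\<^sub>R norm v)" using x by (intro p(2)) auto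
      then show ?thesis unfolding scale[OF False] using qp by (simp add: power_mult_distrib mult_right_mono)
    qed simp
    show "v \<bullet> (g c x *v v) \<le> (sqrt (q p') * norm v)\<^sup>2"
    proof (cases "v = 0")
      case False
      then have "q (x, v /\<^sub>R norm v) \<le> q p'" using x by (intro p'(2)) auto
      then show ?thesis unfolding scale[OF False] using qp' by (simp add: power_mult_distrib mult_right_mono)
    qed simp
  qed (use qp qp' in auto)
qed

text \<open>The coordinate segment from \<open>p\<close> to \<open>q\<close> is a competitor for the
  Riemannian distance, with speed at most \<open>u * dist p q\<close>.\<close>

lemma dist_le_coordinates:
  assumes c: "c \<in> \<A>" and K: "convex K" "K \<subseteq> chart_image c" and "0 \<le> u"
    and u: "\<And>x v. x \<in> K \<Longrightarrow> v \<bullet> (g c x *v v) \<le> (u * norm v)\<^sup>2"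
    and pq: "p \<in> K" "q \<in> K"
  shows "dist (chart_inv c p) (chart_inv c q) \<le> u * dist p q"
proof -
  note ch = is_chartD[OF charts(1)[OF c]]
  define \<l> where "\<l> t = p + t *\<^sub>R (q - p)" for t :: real
  define \<gamma> where "\<gamma> = chart_inv c \<circ> \<l>"
  have \<l>_deriv: "(\<l> has_vector_derivative (q - p)) (at t)" for t
    unfolding \<l>_def by (auto intro!: derivative_eq_intros)
  have \<l>_cont: "continuous_on A \<l>" for A unfolding \<l>_def by (intro continuous_intros)
  have \<l>K: "\<l> t \<in> K" if "t \<in> {0..1}" for t
  proof -
    have "\<l> t = (1 - t) *\<^sub>R p + t *\<^sub>R q" by (simp add: \<l>_def algebra_simps)
    then show ?thesis using K(1) pq that by (simp add: convex_alt)
  qed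
  have \<l>c: "\<l> t \<in> chart_image c" if "t \<in> {0..1}" for t using \<l>K[OF that] K(2) by blast
  have \<gamma>_cont: "continuous_on {0..1} \<gamma>"
    unfolding \<gamma>_def using \<l>c by (intro continuous_on_compose \<l>_cont continuous_on_subset[OF ch(7)]) auto
  \<comment> \<open>\<open>piecewise_C1_path\<close> asks for smoothness in every chart of the
    structure, hence the passage through transition maps.\<close>
  have C1: "(snd c' \<circ> \<gamma>) piecewise_C1_differentiable_on {a..b}"
    if c': "c' \<in> \<A>" and ab: "{a..b} \<subseteq> {0..1}" "\<gamma> ` {a..b} \<subseteq> fst c'" for c' a b
  proof -
    define O' where "O' = snd c ` (fst c \<inter> fst c')"
    have in_O: "\<l> t \<in> O'" if "t \<in> {a..b}" for t
    proof -
      have "\<l> t \<in> chart_image c" using \<l>c that ab(1) by blast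
      then have "snd c (\<gamma> t) = \<l> t" "\<gamma> t \<in> fst c" using ch(4,5) by (simp_all add: \<gamma>_def)
      moreover have "\<gamma> t \<in> fst c'" using that ab(2) by blast
      ultimately show ?thesis unfolding O'_def by (metis IntI imageI)
    qed
    have eq: "snd c' \<circ> \<gamma> = transition c c' \<circ> \<l>" by (simp add: transition_def \<gamma>_def o_assoc)
    define D where "D t = (\<Sum>i\<in>UNIV. (q - p) $ i *\<^sub>R partial i (transition c c') (\<l> t))" for t
    have "((transition c c' \<circ> \<l>) has_vector_derivative D t) (at t)" if t: "t \<in> {a..b}" for t
    proof -
      define F where "F = frechet_derivative (transition c c') (at (\<l> t))"
      have F: "(transition c c' has_derivative F) (at (\<l> t))"
        unfolding F_def using transition_smooth(1)[OF c c'] in_O[OF t] O'_def frechet_derivative_works by blast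
      have "F (q - p) = F (\<Sum>i\<in>UNIV. (q - p) $ i *\<^sub>R axis i 1)"
        using basis_expansion[of "q - p"] by (simp add: scalar_mult_eq_scaleR)
      also have "\<dots> = D t"
        unfolding D_def partial_def F_def[symmetric]
        using has_derivative_linear[OF F] by (simp add: linear_sum linear_scale)
      finally have "F (q - p) = D t" .
      then show ?thesis
        using vector_derivative_diff_chain_within[OF \<l>_deriv has_derivative_at_withinI[OF F]] by simp
    qed
    moreover have "continuous_on {a..b} D"
      unfolding D_def
      using transition_smooth(2)[OF c c'] in_O
      by (intro continuous_intros continuous_on_compose2[OF _ \<l>_cont]) (auto simp: O'_def)
    ultimately have "(snd c' \<circ> \<gamma>) C1_differentiable_on {a..b}"
      unfolding eq C1_differentiable_on_def by blast
    then show ?thesis by (rule C1_differentiable_imp_piecewise)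
  qed
  have path: "piecewise_C1_path \<A> \<gamma>"
    unfolding piecewise_C1_path_def path_def using \<gamma>_cont C1 by blast
  have speed: "riemannian_speed \<A> g \<gamma> t \<le> u * dist p q" if t: "t \<in> {0..1}" for t
  proof -
    have "open (chart_image c)" by (rule ch(2))
    then have "isCont (chart_inv c) (\<l> t)" using ch(7) \<l>c[OF t] by (simp add: continuous_on_eq_continuous_at)
    moreover have "isCont \<l> t" using \<l>_cont[of UNIV] by (simp add: continuous_on_eq_continuous_at)
    ultimately have cont: "isCont \<gamma> t" unfolding \<gamma>_def by (intro continuous_at_compose)
    have "open (\<l> -` chart_image c)" using ch(2) \<l>_cont[of UNIV] by (simp add: open_vimage)
    then obtain d where "0 < d" "\<And>s. dist s t < d \<Longrightarrow> \<l> s \<in> chart_image c"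
      using \<l>c[OF t] unfolding open_dist by auto
    then have "((snd c \<circ> \<gamma>) has_vector_derivative (q - p)) (at t)"
      using ch(4) by (intro has_vector_derivative_transform_within[OF \<l>_deriv]) (auto simp: \<gamma>_def)
    from riemannian_speed_eq[OF c cont _ this]
    have "riemannian_speed \<A> g \<gamma> t = sqrt ((q - p) \<bullet> (g c (\<l> t) *v (q - p)))"
      using ch(4,5) \<l>c[OF t] by (simp add: \<gamma>_def)
    also have "\<dots> \<le> sqrt ((u * norm (q - p))\<^sup>2)" by (intro real_sqrt_le_mono u \<l>K[OF t])
    also have "\<dots> = u * dist p q" using \<open>0 \<le> u\<close> by (simp add: dist_norm norm_minus_commute)
    finally show ?thesis .
  qed
  have "ennreal (dist (chart_inv c p) (chart_inv c q)) = riemannian_distance \<A> g (chart_inv c p) (chart_inv c q)"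
    using riem by (simp add: riemannian_2_manifold_def)
  also have "\<dots> \<le> riemannian_length \<A> g \<gamma>"
    unfolding riemannian_distance_def
    using path by (intro INF_lower) (simp add: pathstart_def pathfinish_def \<gamma>_def \<l>_def)
  also have "\<dots> \<le> (\<integral>\<^sup>+ t. ennreal (u * dist p q) * indicator {0..1 :: real} t \<partial>lborel)"
    unfolding riemannian_length_def using speed by (intro nn_integral_mono) (auto split: split_indicator intro: ennreal_leI)
  also have "\<dots> = ennreal (u * dist p q)" by (simp add: nn_integral_cmult_indicator)
  finally show ?thesis using \<open>0 \<le> u\<close> by simp
qed

text \<open>A competing path may leave the chart. But up to its first exit from the ball of radius
  \<open>3 * R\<close> it has moved in coordinates by more than \<open>2 * R\<close>, which exceeds
  the distance of \<open>p\<close> and \<open>q\<close>, both within \<open>R\<close> of the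
  centre.\<close>

lemma coordinates_le_dist:
  assumes c: "c \<in> \<A>" and R: "0 < R" "cball x0 (3 * R) \<subseteq> chart_image c" and "0 \<le> l"
    and l: "\<And>x v. x \<in> cball x0 (3 * R) \<Longrightarrow> (l * norm v)\<^sup>2 \<le> v \<bullet> (g c x *v v)"
    and pq: "p \<in> ball x0 R" "q \<in> ball x0 R"
  shows "l * dist p q \<le> dist (chart_inv c p) (chart_inv c q)"
proof -
  note ch = is_chartD[OF charts(1)[OF c]]
  have pq3: "p \<in> ball x0 (3 * R)" "q \<in> ball x0 (3 * R)" using pq R(1) by auto
  have bc: "ball x0 (3 * R) \<subseteq> chart_image c" using R(2) ball_subset_cball by blast
  \<comment> \<open>\<open>N\<close> is open, which gives a first exit time; \<open>K\<close> is
    compact, hence closed in the manifold, which keeps the exit point inside the chart.\<close>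
  define N where "N = chart_inv c ` ball x0 (3 * R)"
  define K where "K = chart_inv c ` cball x0 (3 * R)"
  have "open N" unfolding N_def using bc by (intro is_chart_open_image[OF charts(1)[OF c]]) auto
  have "compact K" unfolding K_def by (intro compact_continuous_image continuous_on_subset[OF ch(7)] R(2)) simp
  then have "closed K" by (rule compact_imp_closed)
  have NK: "N \<subseteq> K" unfolding N_def K_def by (intro image_mono) auto
  have Kc: "K \<subseteq> fst c" using R(2) ch(5) by (auto simp: K_def)
  have sK: "snd c w \<in> cball x0 (3 * R)" if "w \<in> K" for w using that R(2) ch(4) unfolding K_def by (metis (no_types) imageE subsetD)
  have sN: "w \<in> N" if "w \<in> K" "snd c w \<in> ball x0 (3 * R)" for w
    using that ch(3) Kc unfolding N_def by (metis imageI subsetD)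
  have "ennreal (l * dist p q) \<le> riemannian_distance \<A> g (chart_inv c p) (chart_inv c q)"
    unfolding riemannian_distance_def
  proof (rule INF_greatest, clarify)
    fix \<gamma> assume \<gamma>: "piecewise_C1_path \<A> \<gamma>" and ends: "pathstart \<gamma> = chart_inv c p" "pathfinish \<gamma> = chart_inv c q"
    have cont: "continuous_on {0..1} \<gamma>" using \<gamma> by (simp add: piecewise_C1_path_def path_def)
    have \<gamma>0: "\<gamma> 0 \<in> N" "snd c (\<gamma> 0) = p" using ends(1) pq3 bc ch(4) by (auto simp: pathstart_def N_def)
    have \<gamma>1: "snd c (\<gamma> 1) = q" using ends(2) pq3 bc ch(4) by (auto simp: pathfinish_def)
    obtain \<tau> where \<tau>: "0 \<le> \<tau>" "\<tau> \<le> 1" "\<gamma> ` {0..\<tau>} \<subseteq> K" "dist p q \<le> dist p (snd c (\<gamma> \<tau>))"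
    proof (cases "\<gamma> ` {0..1} \<subseteq> N")
      case True
      then show ?thesis using NK \<gamma>1 by (intro that[of 1]) auto
    next
      case False
      define Z where "Z = {0..1} \<inter> \<gamma> -` (- N)"
      have "closed Z" unfolding Z_def using \<open>open N\<close> by (intro continuous_closed_preimage[OF cont]) auto
      have Zne: "Z \<noteq> {}" using False by (auto simp: Z_def)
      have bdd: "bdd_below Z" by (auto simp: Z_def bdd_below_def)
      define \<tau> where "\<tau> = Inf Z"
      have "\<tau> \<in> Z" unfolding \<tau>_def by (rule closed_contains_Inf[OF Zne bdd \<open>closed Z\<close>])
      then have t01: "0 \<le> \<tau>" "\<tau> \<le> 1" "\<gamma> \<tau> \<notin> N" by (auto simp: Z_def)
      have before: "\<gamma> t \<in> N" if "0 \<le> t" "t < \<tau>" for t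
      proof (rule ccontr)
        assume "\<gamma> t \<notin> N"
        then have "t \<in> Z" using that t01 by (auto simp: Z_def)
        then have "\<tau> \<le> t" unfolding \<tau>_def by (rule cInf_lower[OF _ bdd])
        then show False using that by simp
      qed
      have "0 < \<tau>" using t01 \<gamma>0 by (cases "\<tau> = 0") auto
      have "\<gamma> ` closure {0..<\<tau>} \<subseteq> closure (\<gamma> ` {0..<\<tau>})"
        using t01 \<open>0 < \<tau>\<close> by (intro continuous_image_closure_subset[OF cont]) auto
      also have "\<dots> \<subseteq> K" using before NK \<open>closed K\<close> by (intro closure_minimal) auto
      finally have sub: "\<gamma> ` {0..\<tau>} \<subseteq> K" using \<open>0 < \<tau>\<close> by simp
      then have "\<gamma> \<tau> \<in> K" using t01 by auto
      then have "snd c (\<gamma> \<tau>) \<notin> ball x0 (3 * R)" using sN t01 by blast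
      then have "3 * R \<le> dist x0 (snd c (\<gamma> \<tau>))" by simp
      moreover have "dist x0 p < R" "dist x0 q < R" using pq by auto
      ultimately have "dist p q \<le> dist p (snd c (\<gamma> \<tau>))"
        using dist_triangle[of x0 "snd c (\<gamma> \<tau>)" p] dist_triangle2[of p q x0] by (simp add: dist_commute)
      then show ?thesis using t01 sub by (intro that[of \<tau>]) auto
    qed
    have pw: "(snd c \<circ> \<gamma>) piecewise_C1_differentiable_on {0..\<tau>}"
      using \<gamma> c \<tau> Kc unfolding piecewise_C1_path_def by (metis (no_types) atLeastatMost_subset_iff order_refl order_trans)
    then obtain S where S: "finite S" "(snd c \<circ> \<gamma>) C1_differentiable_on ({0..\<tau>} - S)"
      unfolding piecewise_C1_differentiable_on_def by blast
    have speed: "l * norm (vector_derivative (snd c \<circ> \<gamma>) (at t)) \<le> riemannian_speed \<A> g \<gamma> t"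
      if t: "t \<in> {0<..<\<tau>} - S" for t
    proof -
      let ?v = "vector_derivative (snd c \<circ> \<gamma>) (at t)"
      have tI: "t \<in> {0..\<tau>} - S" using t by auto
      have "(snd c \<circ> \<gamma>) differentiable (at t)"
        using S(2) tI unfolding C1_differentiable_on_eq by blast
      then have v: "((snd c \<circ> \<gamma>) has_vector_derivative ?v) (at t)" by (simp add: vector_derivative_works)
      have "t \<in> interior {0..1}" using t \<tau> by auto
      then have "isCont \<gamma> t" by (rule continuous_on_interior[OF cont])
      have "\<gamma> t \<in> K" using \<tau>(3) tI by auto
      then have "riemannian_speed \<A> g \<gamma> t = sqrt (?v \<bullet> (g c (snd c (\<gamma> t)) *v ?v))"
        using Kc by (intro riemannian_speed_eq[OF c \<open>isCont \<gamma> t\<close> _ v]) auto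
      moreover have "(l * norm ?v)\<^sup>2 \<le> ?v \<bullet> (g c (snd c (\<gamma> t)) *v ?v)" using l sK \<open>\<gamma> t \<in> K\<close> by blast
      then have "l * norm ?v \<le> sqrt (?v \<bullet> (g c (snd c (\<gamma> t)) *v ?v))" by (rule real_le_rsqrt)
      ultimately show ?thesis by simp
    qed
    have "ennreal (l * dist p q) \<le> ennreal l * ennreal (norm ((snd c \<circ> \<gamma>) \<tau> - (snd c \<circ> \<gamma>) 0))"
      using \<tau>(4) \<gamma>0(2) \<open>0 \<le> l\<close> by (simp add: ennreal_mult[symmetric] dist_norm norm_minus_commute mult_left_mono)
    also have "\<dots> \<le> ennreal l * (\<integral>\<^sup>+ t \<in> {0..\<tau>}. ennreal (norm (vector_derivative (snd c \<circ> \<gamma>) (at t))) \<partial>lborel)"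
      by (intro mult_left_mono norm_diff_le_nn_integral_deriv \<tau> pw) simp
    also have "\<dots> \<le> (\<integral>\<^sup>+ t \<in> {0..\<tau>}. ennreal (l * norm (vector_derivative (snd c \<circ> \<gamma>) (at t))) \<partial>lborel)"
      using \<open>0 \<le> l\<close> by (intro order_trans[OF mult_nn_integral_le]) (simp add: ennreal_mult mult.assoc)
    also have "\<dots> \<le> (\<integral>\<^sup>+ t \<in> {0..1}. ennreal (riemannian_speed \<A> g \<gamma> t) \<partial>lborel)"
    proof (rule nn_integral_mono_AE)
      \<comment> \<open>The speed is bounded below at interior parameters off \<open>S\<close>; only
        finitely many others remain.\<close>
      have "AE t in lborel. t \<notin> S \<union> {0, \<tau>}"
        using S(1) by (intro AE_not_in) (auto intro!: finite_imp_null_set_lborel)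
      then show "AE t in lborel. ennreal (l * norm (vector_derivative (snd c \<circ> \<gamma>) (at t))) * indicator {0..\<tau>} t
          \<le> ennreal (riemannian_speed \<A> g \<gamma> t) * indicator {0..1} t"
      proof eventually_elim
        case (elim t)
        then show ?case using speed[of t] \<tau>(2) by (auto split: split_indicator intro!: ennreal_leI)
      qed
    qed
    also have "\<dots> = riemannian_length \<A> g \<gamma>" by (simp add: riemannian_length_def)
    finally show "ennreal (l * dist p q) \<le> riemannian_length \<A> g \<gamma>" .
  qed
  also have "\<dots> = ennreal (dist (chart_inv c p) (chart_inv c q))"
    using riem by (simp add: riemannian_2_manifold_def)
  finally show ?thesis by simp
qed

text \<open>The two comparisons of distances on a small ball, transported by the isometry
  \<open>\<iota>\<close> from the product plane on which the length-area argument lives.\<close>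

lemma bilipschitz_coordinates:
  assumes "open U" "z \<in> U"
  obtains \<theta> :: "real \<times> real \<Rightarrow> 'm" and S C where "open S" "bounded S" "\<theta> ` S \<subseteq> U" "z \<in> \<theta> ` S"
    "\<And>W. open W \<Longrightarrow> W \<subseteq> S \<Longrightarrow> open (\<theta> ` W)" "0 < C"
    "\<And>p q. p \<in> S \<Longrightarrow> q \<in> S \<Longrightarrow> dist (\<theta> p) (\<theta> q) \<le> C * dist p q"
    "\<And>p q. p \<in> S \<Longrightarrow> q \<in> S \<Longrightarrow> dist p q \<le> C * dist (\<theta> p) (\<theta> q)"
proof -
  obtain c where c: "c \<in> \<A>" "z \<in> fst c" using charts(2) by blast
  note ch = is_chartD[OF charts(1)[OF c(1)]]
  define x0 where "x0 = snd c z"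
  have "open (snd c ` (fst c \<inter> U))" by (rule is_chart_open_coordinates[OF charts(1)[OF c(1)] assms(1)])
  moreover have "x0 \<in> snd c ` (fst c \<inter> U)" using c(2) assms(2) by (simp add: x0_def)
  ultimately obtain e where e: "0 < e" "cball x0 e \<subseteq> snd c ` (fst c \<inter> U)" by (meson open_contains_cball)
  define R where "R = e / 3"
  have R: "0 < R" "cball x0 (3 * R) \<subseteq> snd c ` (fst c \<inter> U)" using e by (simp_all add: R_def)
  then have sub: "cball x0 (3 * R) \<subseteq> chart_image c" by (auto simp: chart_image_def)
  have bsub: "ball x0 R \<subseteq> cball x0 (3 * R)" using R(1) by auto
  obtain l u where lu: "0 < l" "0 < u"
    "\<And>x v. x \<in> cball x0 (3 * R) \<Longrightarrow> (l * norm v)\<^sup>2 \<le> v \<bullet> (g c x *v v)"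
    "\<And>x v. x \<in> cball x0 (3 * R) \<Longrightarrow> v \<bullet> (g c x *v v) \<le> (u * norm v)\<^sup>2"
    using quadratic_bounds[OF c(1) compact_cball sub] R(1) by (metis cball_eq_empty less_le_not_le mult_nonneg_nonneg not_le zero_le_numeral less_imp_le)
  define \<iota> :: "real \<times> real \<Rightarrow> real^2" where "\<iota> p = (\<chi> i. if i = 1 then fst p else snd p)" for p
  have iso: "dist (\<iota> p) (\<iota> q) = dist p q" for p q
    by (simp add: dist_vec_def L2_set_def sum_2 \<iota>_def dist_prod_def)
  have surj: "\<iota> (x $ 1, x $ 2) = x" for x
    by (simp add: \<iota>_def vec_eq_iff forall_2)
  define p0 where "p0 = (x0 $ 1, x0 $ 2)"
  define S where "S = ball p0 R"
  define \<theta> where "\<theta> = chart_inv c \<circ> \<iota>"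
  have \<iota>S: "\<iota> p \<in> ball x0 R" if "p \<in> S" for p
    using that iso[of p0 p] by (simp add: S_def p0_def surj)
  define C where "C = max u (1 / l)"
  show ?thesis
  proof (rule that[of S \<theta> C])
    show "open S" "bounded S" by (simp_all add: S_def)
    show "\<theta> ` S \<subseteq> U"
    proof clarify
      fix a b assume "(a, b) \<in> S"
      then have "\<iota> (a, b) \<in> snd c ` (fst c \<inter> U)" using \<iota>S bsub R(2) by blast
      then show "\<theta> (a, b) \<in> U" using ch(3) by (auto simp: \<theta>_def)
    qed
    have "\<theta> p0 = z" using ch(3)[OF c(2)] by (simp add: \<theta>_def p0_def surj x0_def)
    then show "z \<in> \<theta> ` S" using R(1) by (auto simp: S_def)
    show "open (\<theta> ` W)" if "open W" "W \<subseteq> S" for W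
    proof -
      have "\<iota> ` W = (\<lambda>x. (x $ 1, x $ 2)) -` W"
      proof
        show "\<iota> ` W \<subseteq> (\<lambda>x. (x $ 1, x $ 2)) -` W" by (auto simp: \<iota>_def)
        show "(\<lambda>x. (x $ 1, x $ 2)) -` W \<subseteq> \<iota> ` W"
        proof
          fix x :: "real^2" assume "x \<in> (\<lambda>x. (x $ 1, x $ 2)) -` W"
          then have "\<iota> (x $ 1, x $ 2) \<in> \<iota> ` W" by blast
          then show "x \<in> \<iota> ` W" by (simp only: surj)
        qed
      qed
      moreover have "continuous_on UNIV (\<lambda>x :: real^2. (x $ 1, x $ 2))" by (intro continuous_intros)
      ultimately have "open (\<iota> ` W)" using \<open>open W\<close> by (simp add: open_vimage)
      moreover have "\<iota> ` W \<subseteq> chart_image c" using \<iota>S that(2) bsub sub by blast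
      ultimately show ?thesis
        unfolding \<theta>_def image_comp[symmetric] by (intro is_chart_open_image[OF charts(1)[OF c(1)]])
    qed
    show "0 < C" using lu by (simp add: C_def)
    fix p q assume pq: "p \<in> S" "q \<in> S"
    then have "\<iota> p \<in> cball x0 (3 * R)" "\<iota> q \<in> cball x0 (3 * R)" using \<iota>S bsub by blast+
    then have "dist (\<theta> p) (\<theta> q) \<le> u * dist (\<iota> p) (\<iota> q)"
      unfolding \<theta>_def o_def
      using lu(2) by (intro dist_le_coordinates[OF c(1) convex_cball sub _ lu(4)]) auto
    also have "\<dots> \<le> C * dist p q" unfolding iso by (intro mult_right_mono) (auto simp: C_def)
    finally show "dist (\<theta> p) (\<theta> q) \<le> C * dist p q" .
    have "l * dist (\<iota> p) (\<iota> q) \<le> dist (\<theta> p) (\<theta> q)"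
      unfolding \<theta>_def o_def
      using lu(1) by (intro coordinates_le_dist[OF c(1) R(1) sub _ lu(3)] \<iota>S pq) auto
    then have "dist p q \<le> 1 / l * dist (\<theta> p) (\<theta> q)" using lu(1) by (simp add: iso field_simps)
    also have "\<dots> \<le> C * dist (\<theta> p) (\<theta> q)" by (intro mult_right_mono) (auto simp: C_def)
    finally show "dist p q \<le> C * dist (\<theta> p) (\<theta> q)" .
  qed
qed

end

section \<open>The image of the singular set\<close>

lemma closed_image_proper:
  fixes u :: "'m::metric_space \<Rightarrow> 'x::metric_space"
  assumes cont: "continuous_on UNIV u" and proper: "\<And>K. compact K \<Longrightarrow> compact (u -` K)" and "closed C"
  shows "closed (u ` C)"
  unfolding closed_sequential_limits
proof (intro allI impI, elim conjE)
  fix y l assume y: "\<forall>n. y n \<in> u ` C" "y \<longlonglongrightarrow> l"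
  \<comment> \<open>A convergent sequence together with its limit is compact, so properness confines
    the preimages of its members to a compact set.\<close>
  define K where "K = insert l (range y)"
  have "compactin euclidean K" unfolding K_def using y(2) by (intro compactin_sequence_with_limit) auto
  then have "compact K" by simp
  then have "compact (C \<inter> u -` K)" using proper \<open>closed C\<close> by (intro closed_Int_compact) auto
  then have "compact (u ` (C \<inter> u -` K))" by (intro compact_continuous_image continuous_on_subset[OF cont]) auto
  then have "closed (u ` (C \<inter> u -` K))" by (rule compact_imp_closed)
  moreover have "y n \<in> u ` (C \<inter> u -` K)" for n
  proof -
    obtain z where "z \<in> C" "y n = u z" using y(1) by blast
    moreover have "y n \<in> K" by (simp add: K_def)
    ultimately show ?thesis by auto
  qed
  ultimately have "l \<in> u ` (C \<inter> u -` K)" using y(2) by (rule closed_sequentially)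
  then show "l \<in> u ` C" by blast
qed

text \<open>\<open>u\<close> is a closed map, so the image of the complement of \<open>W\<close> is
  closed; it misses \<open>x\<close>.\<close>

lemma small_ball_preimage:
  fixes u :: "'m::metric_space \<Rightarrow> 'x::metric_space"
  assumes "continuous_on UNIV u" "\<And>K. compact K \<Longrightarrow> compact (u -` K)" and "open W" "u -` {x} \<subseteq> W"
  obtains r where "0 < r" "u -` cball x r \<subseteq> W"
proof -
  have "closed (u ` (- W))" using assms by (intro closed_image_proper) auto
  moreover have "x \<notin> u ` (- W)" using assms(4) by auto
  ultimately obtain r where r: "0 < r" "cball x r \<subseteq> - (u ` (- W))"
    using open_contains_cball[of "- (u ` (- W))"] open_Compl by blast
  then show ?thesis by (intro that[of r]) auto
qed

text \<open>Each connected fibre lies on one side of a separation of the preimage, and since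
  \<open>u\<close> is closed the separation would push forward to one of \<open>Q\<close>.\<close>

lemma connected_preimage_monotone:
  fixes u :: "'m::metric_space \<Rightarrow> 'x::metric_space"
  assumes "continuous_on UNIV u" "\<And>K. compact K \<Longrightarrow> compact (u -` K)" "surj u"
    and "\<And>x. connected (u -` {x})" "connected Q"
  shows "connected (u -` Q)"
proof -
  have "connected (UNIV \<inter> u -` Q)"
  proof (rule connected_closed_monotone_preimage[where T = UNIV])
    fix C :: "'m set" assume "closedin (top_of_set UNIV) C"
    then show "closedin (top_of_set UNIV) (u ` C)"
      using closed_image_proper[OF assms(1,2)] by simp
  qed (use assms in simp_all)
  then show ?thesis by simp
qed

text \<open>\<open>\<theta>\<close> maps the open square to an open set and the closed square to a
  closed one. If \<open>Q\<close> missed the image of the boundary, the image of the open square and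
  the complement of the image of the closed square would disconnect it.\<close>

lemma connected_meets_square_boundary:
  fixes \<theta> :: "real \<times> real \<Rightarrow> 'm::metric_space"
  assumes "open S" "continuous_on S \<theta>" "\<And>W. open W \<Longrightarrow> W \<subseteq> S \<Longrightarrow> open (\<theta> ` W)"
    and box: "closed_square c t \<subseteq> S" "0 < t"
    and Q: "connected Q" "\<theta> c \<in> Q" "w \<in> Q" "w \<notin> \<theta> ` closed_square c t"
  shows "\<exists>p\<in>square_boundary c t. \<theta> p \<in> Q"
proof (rule ccontr)
  assume no: "\<not> ?thesis"
  define B where "B = closed_square c t"
  define O1 where "O1 = \<theta> ` ({fst c - t<..<fst c + t} \<times> {snd c - t<..<snd c + t})"
  have sub: "{fst c - t<..<fst c + t} \<times> {snd c - t<..<snd c + t} \<subseteq> B" by (auto simp: B_def)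
  have "open O1" unfolding O1_def using sub box(1) by (intro assms(3)) (auto simp: open_Times B_def)
  have "compact B" unfolding B_def by (intro compact_Times) auto
  then have "closed (\<theta> ` B)"
    using assms(2) box(1) by (intro compact_imp_closed compact_continuous_image continuous_on_subset[OF assms(2)]) (auto simp: B_def)
  then have "open (- (\<theta> ` B))" by (rule open_Compl)
  have "p \<in> square_boundary c t" if "p \<in> B" "p \<notin> {fst c - t<..<fst c + t} \<times> {snd c - t<..<snd c + t}" for p
    using that box(2) by (auto simp: B_def square_boundary_def mem_Times_iff max_def abs_if)
  then have "Q \<subseteq> O1 \<union> - (\<theta> ` B)" using no unfolding O1_def by blast
  moreover have "O1 \<inter> - (\<theta> ` B) \<inter> Q = {}" using sub by (auto simp: O1_def)
  moreover have "O1 \<inter> Q \<noteq> {}"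
  proof -
    have "c \<in> {fst c - t<..<fst c + t} \<times> {snd c - t<..<snd c + t}" using box(2) by (simp add: mem_Times_iff)
    then show ?thesis using Q(2) by (auto simp: O1_def)
  qed
  moreover have "- (\<theta> ` B) \<inter> Q \<noteq> {}" using Q(3,4) by (auto simp: B_def)
  ultimately show False
    using connectedD[OF Q(1) \<open>open O1\<close> \<open>open (- (\<theta> ` B))\<close>] by blast
qed

section \<open>Local exceptional sets\<close>

locale monotone_sobolev = riemannian_surface \<A> g
  for \<A> :: "'m::metric_space chart set" and g :: "'m metric_tensor" +
  fixes u :: "'m \<Rightarrow> 'x::metric_space"
  assumes sobolev: "u \<in> N12_loc" and u_cont: "continuous_on UNIV u"
    and proper: "\<And>K. compact K \<Longrightarrow> compact (u -` K)" and surj: "surj u"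
    and fibres: "\<And>x. connected (u -` {x})"
begin

text \<open>\<open>A\<close> collects those \<open>x\<close> with fibre a single point of
  \<open>G\<close> in the neighbourhood at which the mass over small balls fails to be
  \<open>o(r\<^sup>2)\<close>. The statement is local because both the upper gradient and the
  coordinates are.\<close>

lemma local_exceptional_set:
  assumes G: "hausdorff 2 G = 0" "G \<in> sets borel"
  obtains N A where "open N" "z \<in> N" "hausdorff 2 A = 0"
    "\<And>w x. w \<in> N \<inter> G \<Longrightarrow> u -` {x} = {w} \<Longrightarrow> x \<notin> A \<Longrightarrow> \<not> two_sided x"
proof -
  obtain U \<rho> where U: "open U" "z \<in> U" and ug: "upper_gradient_on U u \<rho>"
      and energy: "(\<integral>\<^sup>+ z \<in> U. (\<rho> z)\<^sup>2 \<partial>hausdorff_measure 2) < \<infinity>"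
    using sobolev unfolding N12_loc_def N12_on_def by blast
  obtain \<theta> :: "real \<times> real \<Rightarrow> 'm" and S C where Sp: "open S" "bounded S" and \<theta>U: "\<theta> ` S \<subseteq> U" "z \<in> \<theta> ` S"
    and \<theta>open: "\<And>W. open W \<Longrightarrow> W \<subseteq> S \<Longrightarrow> open (\<theta> ` W)" and "0 < C"
    and upper: "\<And>p q. p \<in> S \<Longrightarrow> q \<in> S \<Longrightarrow> dist (\<theta> p) (\<theta> q) \<le> C * dist p q"
    and lower: "\<And>p q. p \<in> S \<Longrightarrow> q \<in> S \<Longrightarrow> dist p q \<le> C * dist (\<theta> p) (\<theta> q)"
    using bilipschitz_coordinates[OF U] by metis
  have inj: "p = q" if "p \<in> S" "q \<in> S" "\<theta> p = \<theta> q" for p q using lower[OF that(1,2)] that(3) by simp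
  have \<theta>cont: "continuous_on S \<theta>"
    using upper \<open>0 < C\<close> by (intro lipschitz_on_continuous_on[of C] lipschitz_onI) auto
  define h where "h = u \<circ> \<theta>"
  have hcont: "continuous_on S h"
    unfolding h_def by (intro continuous_on_compose \<theta>cont continuous_on_subset[OF u_cont]) auto
  have S_meas [measurable]: "S \<in> sets borel" using Sp(1) by simp
  \<comment> \<open>\<open>\<rho>\<close> is Borel only on \<open>U\<close>, and
    \<open>\<theta>\<close> is controlled only on \<open>S\<close>. The extensions
    \<open>\<rho>U\<close> by \<open>0\<close> and \<open>\<theta>'\<close> by the constant
    \<open>z\<close> are Borel everywhere.\<close>
  define \<rho>U where "\<rho>U w = \<rho> w * indicator U w" for w
  have \<rho>U [measurable]: "\<rho>U \<in> borel_measurable borel"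
    using ug U(1) unfolding upper_gradient_on_def \<rho>U_def
    by (subst (asm) borel_measurable_restrict_space_iff_ennreal) auto
  define \<theta>' where "\<theta>' p = (if p \<in> S then \<theta> p else z)" for p
  have \<theta>'_meas [measurable]: "\<theta>' \<in> borel_measurable borel"
    unfolding \<theta>'_def by (rule borel_measurable_continuous_on_if) (use S_meas \<theta>cont in auto)
  define \<rho>' where "\<rho>' p = ennreal C * \<rho>U (\<theta>' p)" for p
  have \<rho>'_meas [measurable]: "\<rho>' \<in> borel_measurable borel" unfolding \<rho>'_def by measurable
  \<comment> \<open>\<open>\<theta>\<close> stretches an isometrically parametrized segment by at
    most \<open>C\<close>, which is the factor in \<open>\<rho>'\<close>.\<close>
  have seg: "ennreal (dist (u (\<theta> (\<sigma> a))) (u (\<theta> (\<sigma> b)))) \<le> (\<integral>\<^sup>+ t \<in> {a..b}. \<rho>' (\<sigma> t) \<partial>lborel)"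
    if ab: "a \<le> b" and \<sigma>: "\<sigma> ` {a..b} \<subseteq> S" "\<And>s t. dist (\<sigma> s) (\<sigma> t) = \<bar>s - t\<bar>" for a b and \<sigma> :: "real \<Rightarrow> real \<times> real"
  proof -
    have lip: "dist ((\<theta> \<circ> \<sigma>) s) ((\<theta> \<circ> \<sigma>) t) \<le> C * (t - s)" if "a \<le> s" "s \<le> t" "t \<le> b" for s t
      using upper[of "\<sigma> s" "\<sigma> t"] \<sigma> that by (auto simp: image_subset_iff)
    have im: "(\<theta> \<circ> \<sigma>) ` {a..b} \<subseteq> U" using \<sigma>(1) \<theta>U(1) by auto
    have \<rho>U': "(\<lambda>w. \<rho> w * indicator U w) \<in> borel_measurable borel" using \<rho>U by (simp add: \<rho>U_def[abs_def])
    note li = line_integral_le[OF ab \<open>0 < C\<close> lip \<rho>U' im]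
    have "continuous_on {a..b} \<sigma>"
      using \<sigma>(2) by (intro lipschitz_on_continuous_on[of 1] lipschitz_onI) (auto simp: dist_real_def)
    then have "rectifiable_curve {a..b} (\<theta> \<circ> \<sigma>)"
      unfolding rectifiable_curve_def curve_def using li(2)
      by (intro conjI continuous_on_compose continuous_on_subset[OF \<theta>cont \<sigma>(1)]) (auto simp: is_interval_cc)
    then have "ennreal (dist (u ((\<theta> \<circ> \<sigma>) a)) (u ((\<theta> \<circ> \<sigma>) b))) \<le> line_integral a b (\<theta> \<circ> \<sigma>) \<rho>"
      using ug ab im unfolding upper_gradient_on_def by blast
    also note li(1)
    also have "ennreal C * (\<integral>\<^sup>+ t \<in> {a..b}. \<rho> ((\<theta> \<circ> \<sigma>) t) \<partial>lborel) \<le> (\<integral>\<^sup>+ t. ennreal C * (\<rho> ((\<theta> \<circ> \<sigma>) t) * indicator {a..b} t) \<partial>lborel)"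
      by (rule mult_nn_integral_le)
    also have "\<dots> = (\<integral>\<^sup>+ t \<in> {a..b}. \<rho>' (\<sigma> t) \<partial>lborel)"
    proof (rule nn_integral_cong)
      fix t
      have "\<sigma> t \<in> S" "\<theta> (\<sigma> t) \<in> U" if "t \<in> {a..b}" using that \<sigma>(1) im by auto
      then show "ennreal C * (\<rho> ((\<theta> \<circ> \<sigma>) t) * indicator {a..b} t) = \<rho>' (\<sigma> t) * indicator {a..b} t"
        by (cases "t \<in> {a..b}") (simp_all add: \<rho>'_def \<theta>'_def \<rho>U_def)
    qed
    finally show ?thesis by simp
  qed
  interpret axis_upper_gradient S h \<rho>'
  proof
    show "ennreal (dist (h (a, y)) (h (b, y))) \<le> (\<integral>\<^sup>+ x \<in> {a..b}. \<rho>' (x, y) \<partial>lborel)"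
      if "a \<le> b" "{a..b} \<times> {y} \<subseteq> S" for a b y
      using seg[OF that(1), of "\<lambda>x. (x, y)"] that(2) by (auto simp: h_def dist_Pair_Pair dist_real_def)
    show "ennreal (dist (h (x, a)) (h (x, b))) \<le> (\<integral>\<^sup>+ y \<in> {a..b}. \<rho>' (x, y) \<partial>lborel)"
      if "a \<le> b" "{x} \<times> {a..b} \<subseteq> S" for a b x
      using seg[OF that(1), of "\<lambda>y. (x, y)"] that(2) by (auto simp: h_def dist_Pair_Pair dist_real_def)
  qed (use Sp(1) hcont \<rho>'_meas in auto)
  define k where "k = ennreal (16 * C\<^sup>2 / pi)"
  have leb: "emeasure lborel B \<le> k * hausdorff 2 (\<theta> ` B)" if "B \<subseteq> S" "B \<in> sets borel" for B
    unfolding k_def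
  proof (rule emeasure_lborel_le_hausdorff)
    show "dist p q \<le> C * dist (\<theta> p) (\<theta> q)" if "p \<in> B" "q \<in> B" for p q
      using lower that \<open>B \<subseteq> S\<close> by blast
  qed (use that \<open>0 < C\<close> in simp_all)
  have pre: "S \<inter> \<theta>' -` A \<in> sets borel" if "A \<in> sets borel" for A
    using measurable_sets[OF \<theta>'_meas that] by simp
  have \<rho>'_fin: "(\<integral>\<^sup>+ p \<in> S. (\<rho>' p)\<^sup>2 \<partial>lborel) < \<infinity>"
  proof -
    \<comment> \<open>The push-forward of the area on \<open>S\<close>. It is at most
      \<open>k\<close> times the Hausdorff measure, so finite energy on \<open>U\<close> passes to
      \<open>S\<close>.\<close>
    define M where "M = distr (density lborel (indicator S)) borel \<theta>'"
    have "(\<integral>\<^sup>+ w. (\<rho>U w)\<^sup>2 \<partial>M) \<le> k * (\<integral>\<^sup>+ w. (\<rho>U w)\<^sup>2 \<partial>hausdorff_measure 2)"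
    proof (rule nn_integral_le_of_emeasure_le)
      fix A assume "A \<in> sets M"
      then have A: "A \<in> sets borel" by (simp add: M_def)
      have "emeasure M A = emeasure lborel (S \<inter> \<theta>' -` A)"
        unfolding M_def using A S_meas measurable_sets[OF \<theta>'_meas A]
        by (subst emeasure_distr; (subst emeasure_restricted)?) auto
      also have "\<dots> \<le> k * hausdorff 2 (\<theta> ` (S \<inter> \<theta>' -` A))" by (intro leb pre A) auto
      also have "\<dots> \<le> k * hausdorff 2 A" by (intro mult_left_mono hausdorff_mono) (auto simp: \<theta>'_def)
      finally show "emeasure M A \<le> k * emeasure (hausdorff_measure 2) A"
        by (simp add: emeasure_hausdorff_measure[OF A])
    qed (auto simp: M_def)
    also have "\<dots> < \<infinity>"
    proof -
      have "(\<integral>\<^sup>+ w. (\<rho>U w)\<^sup>2 \<partial>hausdorff_measure 2) = (\<integral>\<^sup>+ z \<in> U. (\<rho> z)\<^sup>2 \<partial>hausdorff_measure 2)"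
        by (intro nn_integral_cong) (auto simp: \<rho>U_def split: split_indicator)
      then show ?thesis using energy by (simp add: k_def ennreal_mult_less_top)
    qed
    also have "(\<integral>\<^sup>+ w. (\<rho>U w)\<^sup>2 \<partial>M) = (\<integral>\<^sup>+ p. indicator S p * (\<rho>U (\<theta>' p))\<^sup>2 \<partial>lborel)"
      unfolding M_def by (subst nn_integral_distr; (subst nn_integral_density)?) auto
    finally have "ennreal (C\<^sup>2) * (\<integral>\<^sup>+ p. indicator S p * (\<rho>U (\<theta>' p))\<^sup>2 \<partial>lborel) < \<infinity>"
      by (simp add: ennreal_mult_less_top)
    also have "ennreal (C\<^sup>2) * (\<integral>\<^sup>+ p. indicator S p * (\<rho>U (\<theta>' p))\<^sup>2 \<partial>lborel)
        = (\<integral>\<^sup>+ p. ennreal (C\<^sup>2) * (indicator S p * (\<rho>U (\<theta>' p))\<^sup>2) \<partial>lborel)"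
      by (rule nn_integral_cmult[symmetric]) measurable
    also have "\<dots> = (\<integral>\<^sup>+ p \<in> S. (\<rho>' p)\<^sup>2 \<partial>lborel)"
      using \<open>0 < C\<close> by (intro nn_integral_cong) (simp add: \<rho>'_def power_mult_distrib ennreal_power ac_simps)
    finally show ?thesis .
  qed
  define m where "m = density lborel (\<lambda>p. ((\<rho>' p)\<^sup>2 + 1) * indicator S p)"
  have sets_m: "sets m = sets borel" by (simp add: m_def)
  have m_eq: "emeasure m A = (\<integral>\<^sup>+ p \<in> A. (\<rho>' p)\<^sup>2 + 1 \<partial>lborel)" if "A \<subseteq> S" "A \<in> sets borel" for A
  proof -
    have "emeasure m A = (\<integral>\<^sup>+ p. ((\<rho>' p)\<^sup>2 + 1) * indicator S p * indicator A p \<partial>lborel)"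
      unfolding m_def using that(2) by (intro emeasure_density) auto
    also have "\<dots> = (\<integral>\<^sup>+ p \<in> A. (\<rho>' p)\<^sup>2 + 1 \<partial>lborel)"
      using that(1) by (intro nn_integral_cong) (auto split: split_indicator)
    finally show ?thesis .
  qed
  \<comment> \<open>Finite total mass makes \<open>m\<close> outer regular; boundedness of
    \<open>S\<close> takes care of the summand \<open>1\<close>.\<close>
  have m_fin: "emeasure m (space m) \<noteq> \<infinity>"
  proof -
    have "emeasure m (space m) = (\<integral>\<^sup>+ p. (\<rho>' p)\<^sup>2 * indicator S p + indicator S p \<partial>lborel)"
      unfolding m_def by (subst emeasure_density) (auto intro!: nn_integral_cong split: split_indicator)
    also have "\<dots> = (\<integral>\<^sup>+ p \<in> S. (\<rho>' p)\<^sup>2 \<partial>lborel) + emeasure lborel S"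
      by (subst nn_integral_add) auto
    also have "\<dots> < \<infinity>" using \<rho>'_fin emeasure_bounded_finite[OF Sp(2)] by simp
    finally show ?thesis by simp
  qed
  define N0 where "N0 = S \<inter> \<theta>' -` G"
  have N0: "N0 \<in> sets borel" "N0 \<subseteq> S" unfolding N0_def by (auto intro: pre G(2))
  have "emeasure lborel N0 \<le> k * hausdorff 2 (\<theta> ` N0)" by (rule leb[OF N0(2,1)])
  also have "\<dots> \<le> k * hausdorff 2 G" by (intro mult_left_mono hausdorff_mono) (auto simp: N0_def \<theta>'_def)
  finally have "N0 \<in> null_sets lborel" using G(1) N0(1) by (auto simp: null_sets_def)
  then have mN0: "emeasure m N0 = 0"
    unfolding m_eq[OF N0(2,1)] by (intro nn_integral_null_set)
  define E where "E = {x. \<exists>w \<in> G \<inter> \<theta> ` S. u -` {x} = {w}}"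
  \<comment> \<open>Restricted to \<open>S\<close> because \<open>h\<close> is controlled only
    there, while the density lemma pulls balls back to the whole space of the measure.\<close>
  define m' where "m' = restrict_space m S"
  have D_meas: "h -` cball x r \<inter> S \<in> sets borel" for x r
  proof -
    have "S \<inter> h -` cball x r \<in> sets borel"
      using measurable_sets[OF borel_measurable_continuous_on_restrict[OF hcont], of "cball x r"] S_meas
      by (simp add: sets_restrict_space_iff space_restrict_space Int_commute)
    then show ?thesis by (simp add: Int_commute)
  qed
  have space_m': "space m' = S" by (simp add: m'_def m_def space_restrict_space)
  have sets_m': "A \<in> sets m'" if "A \<in> sets borel" "A \<subseteq> S" for A
    unfolding m'_def using that sets_m S_meas by (subst sets_restrict_space_iff) (auto simp: m_def)
  have em': "emeasure m' A = emeasure m A" if "A \<subseteq> S" for A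
    unfolding m'_def using that sets_m S_meas by (intro emeasure_restrict_space) (auto simp: m_def)
  \<comment> \<open>For a point of \<open>E\<close> outside all \<open>Z n\<close>, the mass over
    the ball of radius \<open>r\<close> is eventually below any positive multiple of
    \<open>r\<^sup>2\<close>.\<close>
  define Z where "Z n = {x\<in>E. \<forall>r0>0. \<exists>r. 0 < r \<and> r < r0 \<and>
      ennreal (1 / real (Suc n) * r\<^sup>2) < emeasure m' (h -` cball x r \<inter> space m')}" for n
  have Z0: "hausdorff 2 (Z n) = 0" for n
    unfolding Z_def
  proof (rule hausdorff_upper_density_null)
    show "h -` cball x r \<inter> space m' \<in> sets m'" for x r
      unfolding space_m' by (intro sets_m' D_meas) auto
    fix e :: real assume "0 < e"
    have "(INF V\<in>{V. N0 \<subseteq> V \<and> open V}. emeasure m V) < ennreal e"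
      using outer_regular[OF sets_m m_fin N0(1)] mN0 \<open>0 < e\<close> by simp
    then obtain V where V: "N0 \<subseteq> V" "open V" "emeasure m V < ennreal e" unfolding INF_less_iff by auto
    show "\<exists>U\<in>sets m'. emeasure m' U \<le> ennreal e \<and> (\<forall>x\<in>E. \<exists>r>0. h -` cball x r \<inter> space m' \<subseteq> U)"
    proof (intro bexI conjI ballI)
      show "V \<inter> S \<in> sets m'" using V(2) by (intro sets_m') auto
      have "emeasure m' (V \<inter> S) \<le> emeasure m V" using V(2) sets_m by (subst em') (auto intro: emeasure_mono)
      then show "emeasure m' (V \<inter> S) \<le> ennreal e" using V(3) by simp
      fix x assume "x \<in> E"
      then obtain p where p: "p \<in> S" "\<theta> p \<in> G" "u -` {x} = {\<theta> p}" by (auto simp: E_def)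
      then have "p \<in> V" using V(1) by (auto simp: N0_def \<theta>'_def)
      \<comment> \<open>Here it matters that the fibre is a single point: it lies in the open set
        over \<open>V\<close>, and by properness so does the preimage of a small ball.\<close>
      then have "u -` {x} \<subseteq> \<theta> ` (V \<inter> S)" using p by auto
      moreover have "open (\<theta> ` (V \<inter> S))" using V(2) Sp(1) by (intro \<theta>open) auto
      ultimately obtain r where r: "0 < r" "u -` cball x r \<subseteq> \<theta> ` (V \<inter> S)"
        using small_ball_preimage[OF u_cont proper] by metis
      have "h -` cball x r \<inter> S \<subseteq> V \<inter> S"
      proof
        fix q assume q: "q \<in> h -` cball x r \<inter> S"
        then have "\<theta> q \<in> \<theta> ` (V \<inter> S)" using r(2) by (auto simp: h_def)
        then obtain q' where "q' \<in> V \<inter> S" "\<theta> q = \<theta> q'" by blast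
        then show "q \<in> V \<inter> S" using inj[of q q'] q by simp
      qed
      then show "\<exists>r>0. h -` cball x r \<inter> space m' \<subseteq> V \<inter> S" using r(1) unfolding space_m' by blast
    qed
  qed simp
  show ?thesis
  proof (rule that[of "\<theta> ` S" "\<Union>n. Z n"])
    show "open (\<theta> ` S)" using Sp(1) by (intro \<theta>open) auto
    show "z \<in> \<theta> ` S" by fact
    show "hausdorff 2 (\<Union>n. Z n) = 0" using hausdorff_null_UN[of UNIV 2 Z] Z0 by simp
    fix w x assume w: "w \<in> \<theta> ` S \<inter> G" and fib: "u -` {x} = {w}" and xZ: "x \<notin> (\<Union>n. Z n)"
    have "x \<in> E" using w fib by (auto simp: E_def)
    obtain c where c: "c \<in> S" "w = \<theta> c" using w by blast
    have hc: "h c = x" using fib c by (auto simp: h_def)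
    show "\<not> two_sided x"
    proof
      assume "two_sided x"
      then obtain K L where KL: "connected K" "connected L" "x \<in> K" "x \<in> L" "K \<noteq> {x}" "L \<noteq> {x}"
        "\<And>p q. p \<in> K \<Longrightarrow> q \<in> L \<Longrightarrow> max (dist x p) (dist x q) \<le> 2 * dist p q"
        unfolding two_sided_def by blast
      obtain d where d: "0 < d" "ball c d \<subseteq> S" using Sp(1) c(1) by (meson openE)
      have square_ball: "closed_square c t \<subseteq> ball c (3 * t)" if "0 < t" for t
      proof
        fix p assume p: "p \<in> closed_square c t"
        have "dist c p \<le> \<bar>fst c - fst p\<bar> + \<bar>snd c - snd p\<bar>"
          unfolding dist_prod_def dist_real_def by (rule sqrt_sum_squares_le_sum) auto
        also have "\<dots> \<le> 2 * t" using p by auto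
        finally show "p \<in> ball c (3 * t)" using that by simp
      qed
      \<comment> \<open>This is applied to points of the preimages of \<open>K\<close> and
        \<open>L\<close>, which may lie outside the coordinate patch; hence the two cases.\<close>
      have avoid: "\<exists>r>0. \<forall>t. 0 < t \<and> t < r \<longrightarrow> w' \<notin> \<theta> ` closed_square c t" if "w' \<noteq> w" for w'
      proof (cases "w' \<in> \<theta> ` S")
        case True
        then obtain p where p: "p \<in> S" "w' = \<theta> p" by blast
        then have "0 < dist c p" using that c by auto
        moreover have "w' \<notin> \<theta> ` closed_square c t" if "0 < t" "t < min (dist c p) d / 3" for t
        proof
          assume "w' \<in> \<theta> ` closed_square c t"
          then obtain q where q: "q \<in> closed_square c t" "w' = \<theta> q" by blast
          then have "q \<in> ball c (3 * t)" using square_ball[OF that(1)] by blast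
          then have near: "dist c q < 3 * t" by simp
          then have "q \<in> ball c d" using that(2) by simp
          then have "q \<in> S" using d(2) by blast
          then have "q = p" using inj[of q p] p q(2) by simp
          then show False using that near by simp
        qed
        ultimately show ?thesis using d(1) by (intro exI[of _ "min (dist c p) d / 3"]) auto
      next
        case False
        have "closed_square c t \<subseteq> S" if "0 < t" "t < d / 3" for t
        proof -
          have "ball c (3 * t) \<subseteq> ball c d" using that by auto
          then show ?thesis using square_ball[OF that(1)] d(2) by blast
        qed
        then show ?thesis using False d(1) by (intro exI[of _ "d / 3"]) auto
      qed
      \<comment> \<open>\<open>K\<close> and \<open>L\<close> contain points other than
        \<open>x\<close>, so their connected preimages leave the image of every small square around
        \<open>c\<close> and meet the image of its boundary.\<close>
      obtain k1 where k1: "k1 \<in> K" "k1 \<noteq> x" using KL(3,5) by blast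
      obtain l1 where l1: "l1 \<in> L" "l1 \<noteq> x" using KL(4,6) by blast
      obtain wk wl where wkl: "u wk = k1" "u wl = l1" using surj by (metis surjD)
      have "wk \<noteq> w" "wl \<noteq> w" using wkl k1 l1 fib by auto
      then obtain rk rl where r: "0 < rk" "\<And>t. 0 < t \<Longrightarrow> t < rk \<Longrightarrow> wk \<notin> \<theta> ` closed_square c t"
        "0 < rl" "\<And>t. 0 < t \<Longrightarrow> t < rl \<Longrightarrow> wl \<notin> \<theta> ` closed_square c t"
        using avoid by metis
      define R where "R = min (min rk rl) (d / 3)"
      have R: "0 < R" "R \<le> rk" "R \<le> rl" "R \<le> d / 3" using r(1,3) d(1) by (auto simp: R_def)
      have boxS: "closed_square c t \<subseteq> S" if "0 < t" "t \<le> R" for t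
      proof -
        have "ball c (3 * t) \<subseteq> ball c d" using that R by auto
        then show ?thesis using square_ball[OF that(1)] d(2) by blast
      qed
      show False
      proof (rule no_wide_squares[OF R(1)])
        show "closed_square c R \<subseteq> S" using boxS[of R] R(1) by simp
        fix t assume t: "0 < t" "t < R"
        have bt: "closed_square c t \<subseteq> S" using boxS[of t] t by simp
        have meets: "\<exists>p\<in>square_boundary c t. \<theta> p \<in> u -` Q"
          if "connected Q" "x \<in> Q" "u w' \<in> Q" "w' \<notin> \<theta> ` closed_square c t" for Q w'
        proof (rule connected_meets_square_boundary[OF Sp(1) \<theta>cont \<theta>open bt t(1) _ _ _ that(4)])
          show "connected (u -` Q)" by (rule connected_preimage_monotone[OF u_cont proper surj fibres that(1)])
        qed (use that(2,3) fib c in auto)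
        have "wk \<notin> \<theta> ` closed_square c t" "wl \<notin> \<theta> ` closed_square c t" using r(2,4) t R by simp_all
        then have "\<exists>p\<in>square_boundary c t. \<theta> p \<in> u -` K" "\<exists>p\<in>square_boundary c t. \<theta> p \<in> u -` L"
          using meets[OF KL(1,3), of wk] meets[OF KL(2,4), of wl] wkl k1(1) l1(1) by simp_all
        then obtain p q where "p \<in> square_boundary c t" "q \<in> square_boundary c t" "h p \<in> K" "h q \<in> L"
          by (auto simp: h_def)
        then show "\<exists>p\<in>square_boundary c t. \<exists>q\<in>square_boundary c t.
            max (dist (h c) (h p)) (dist (h c) (h q)) \<le> 2 * dist (h p) (h q)"
          using KL(7) unfolding hc by blast
      next
        fix e :: real assume "0 < e"
        then obtain n where n: "1 / real (Suc n) < e" using nat_approx_posE by blast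
        have "x \<notin> Z n" using xZ by blast
        then obtain r0 where r0: "0 < r0"
          "\<nexists>r. 0 < r \<and> r < r0 \<and> ennreal (1 / real (Suc n) * r\<^sup>2) < emeasure m' (h -` cball x r \<inter> S)"
          using \<open>x \<in> E\<close> unfolding Z_def space_m' by blast
        show "\<exists>r0>0. \<forall>r. 0 < r \<and> r < r0 \<longrightarrow>
            (\<integral>\<^sup>+ p \<in> {p\<in>S. dist (h c) (h p) \<le> r}. (\<rho>' p)\<^sup>2 + 1 \<partial>lborel) \<le> ennreal (e * r\<^sup>2)"
        proof (intro exI[of _ r0] conjI allI impI)
          fix r assume r: "0 < r \<and> r < r0"
          have "{p\<in>S. dist (h c) (h p) \<le> r} = h -` cball x r \<inter> S" by (auto simp: hc)
          then have "(\<integral>\<^sup>+ p \<in> {p\<in>S. dist (h c) (h p) \<le> r}. (\<rho>' p)\<^sup>2 + 1 \<partial>lborel) = emeasure m' (h -` cball x r \<inter> S)"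
            using m_eq[OF _ D_meas] em' by simp
          also have "\<dots> \<le> ennreal (1 / real (Suc n) * r\<^sup>2)" using r r0(2) by (meson not_less)
          also have "\<dots> \<le> ennreal (e * r\<^sup>2)" using n by (intro ennreal_leI mult_right_mono) auto
          finally show "(\<integral>\<^sup>+ p \<in> {p\<in>S. dist (h c) (h p) \<le> r}. (\<rho>' p)\<^sup>2 + 1 \<partial>lborel) \<le> ennreal (e * r\<^sup>2)" .
        qed (rule r0(1))
      qed
    qed
  qed
qed

end

text \<open>The local exceptional sets are indexed by all points of the surface; a countable base
  selects countably many whose neighbourhoods still cover it.\<close>

theorem theorem1p8:
  fixes \<A> :: "'m::metric_space chart set"
    and g :: "'m metric_tensor"
    and u :: "'m \<Rightarrow> 'x::metric_space"
    and G :: "nat \<Rightarrow> 'm set"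
  assumes "metric_surface TYPE('x)"
    and "uniformization_map \<A> g u"
    and "singular_decomposition \<A> g u G"
  shows "exceptional {(I, \<gamma> :: real \<Rightarrow> 'x).
           rectifiable_curve I \<gamma> \<and> hausdorff 1 (\<gamma> ` I \<inter> u ` G 0) > 0}"
proof -
  have um: "riemannian_2_manifold \<A> g" "u \<in> N12_loc" "continuous_on UNIV u" "surj u"
    "\<forall>K. compact K \<longrightarrow> compact (u -` K)" "\<forall>x. connected (u -` {x})"
    and single: "hausdorff 2 {x. card (u -` {x}) \<noteq> 1} = 0"
    using assms(2) unfolding uniformization_map_def by simp_all
  interpret monotone_sobolev \<A> g u
    by unfold_locales (use um in blast)+
  have compact: "compact (G j)" if "1 \<le> j" for j
    using assms(3) that unfolding singular_decomposition_def by blast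
  have G0: "hausdorff 2 (G 0) = 0" "G 0 = UNIV - (\<Union>j\<in>{1..}. G j)"
    using assms(3) unfolding singular_decomposition_def by blast+
  have "G j \<in> sets borel" if "1 \<le> j" for j by (rule borel_closed[OF compact_imp_closed[OF compact[OF that]]])
  then have "(\<Union>j\<in>{1..}. G j) \<in> sets borel" by (intro sets.countable_UN') auto
  then have G0_borel: "G 0 \<in> sets borel" unfolding G0(2) by simp
  have "\<forall>z. \<exists>N A. open N \<and> z \<in> N \<and> hausdorff 2 A = 0 \<and>
      (\<forall>w x. w \<in> N \<inter> G 0 \<longrightarrow> u -` {x} = {w} \<longrightarrow> x \<notin> A \<longrightarrow> \<not> two_sided x)"
    using local_exceptional_set[OF G0(1) G0_borel] by metis
  then obtain N A where NA: "\<And>z. open (N z)" "\<And>z. z \<in> N z" "\<And>z. hausdorff 2 (A z) = 0"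
    "\<And>z w x. w \<in> N z \<inter> G 0 \<Longrightarrow> u -` {x} = {w} \<Longrightarrow> x \<notin> A z \<Longrightarrow> \<not> two_sided x"
    by metis
  have "second_countable (euclidean :: 'm topology)" using riem unfolding riemannian_2_manifold_def by blast
  then obtain \<B> :: "'m set set" where \<B>: "countable \<B>" "\<And>U x. open U \<Longrightarrow> x \<in> U \<Longrightarrow> \<exists>V\<in>\<B>. x \<in> V \<and> V \<subseteq> U"
    unfolding second_countable_def by (auto simp: open_openin[symmetric])
  \<comment> \<open>One neighbourhood is fixed for each basic open set. For a basic set contained in
    none the choice is arbitrary, but \<open>A (z V)\<close> is null in any case.\<close>
  define z where "z V = (SOME z. V \<subseteq> N z)" for V
  have zV: "V \<subseteq> N (z V)" if "V \<subseteq> N y" for V y unfolding z_def by (rule someI[of _ y]) (rule that)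
  \<comment> \<open>\<open>card\<close> is \<open>0\<close> on infinite sets, so the last set
    catches every fibre that is not a single point.\<close>
  define A' where "A' = (\<Union>V\<in>\<B>. A (z V)) \<union> {x. card (u -` {x}) \<noteq> 1}"
  have "hausdorff 2 (\<Union>V\<in>\<B>. A (z V)) = 0" by (rule hausdorff_null_UN[OF \<B>(1)]) (rule NA(3))
  then have A'0: "hausdorff 2 A' = 0"
    unfolding A'_def using hausdorff_Un[of 2 "\<Union>V\<in>\<B>. A (z V)" "{x. card (u -` {x}) \<noteq> 1}"] single by simp
  have not_two_sided: "\<not> two_sided x" if x: "x \<in> u ` G 0" "x \<notin> A'" for x
  proof -
    obtain w where w: "w \<in> G 0" "u w = x" using x(1) by blast
    have "card (u -` {x}) = 1" using x(2) by (simp add: A'_def)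
    then obtain w' where "u -` {x} = {w'}" by (rule card_1_singletonE)
    then have fib: "u -` {x} = {w}" using w(2) by auto
    obtain V where V: "V \<in> \<B>" "w \<in> V" "V \<subseteq> N w" using \<B>(2)[OF NA(1,2)] by blast
    then have "w \<in> N (z V) \<inter> G 0" using zV[of V w] w(1) by blast
    moreover have "x \<notin> A (z V)" using x(2) V(1) by (auto simp: A'_def)
    ultimately show ?thesis using NA(4) fib by blast
  qed
  have "0 < hausdorff 1 (\<gamma> ` I \<inter> A')"
    if \<gamma>: "rectifiable_curve I \<gamma>" "0 < hausdorff 1 (\<gamma> ` I \<inter> u ` G 0)" for I and \<gamma> :: "real \<Rightarrow> 'x"
  proof (rule ccontr)
    assume "\<not> ?thesis"
    then have 0: "hausdorff 1 (\<gamma> ` I \<inter> A') = 0" by (simp add: not_gr_zero)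
    \<comment> \<open>Off \<open>A'\<close> no point of the image of \<open>G 0\<close> is
      two-sided, so on the curve such points form a set of length zero.\<close>
    have "\<gamma> ` I \<inter> u ` G 0 \<subseteq> (\<gamma> ` I \<inter> A') \<union> (\<gamma> ` I - Collect two_sided)" using not_two_sided by auto
    then have "hausdorff 1 (\<gamma> ` I \<inter> u ` G 0) \<le> hausdorff 1 (\<gamma> ` I \<inter> A') + hausdorff 1 (\<gamma> ` I - Collect two_sided)"
      by (intro order_trans[OF hausdorff_mono hausdorff_Un])
    then show False using 0 hausdorff_not_two_sided[OF \<gamma>(1)] \<gamma>(2) by simp
  qed
  then have "\<forall>(I, \<gamma>) \<in> {(I, \<gamma> :: real \<Rightarrow> 'x). rectifiable_curve I \<gamma> \<and> hausdorff 1 (\<gamma> ` I \<inter> u ` G 0) > 0}.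
      0 < hausdorff 1 (\<gamma> ` I \<inter> A')"
    by (simp add: case_prod_unfold)
  then show ?thesis unfolding exceptional_def using A'0 by (intro conjI exI[of _ A']) simp_all
qed

end
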